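(* Let $\rho$ be either smooth tempered of exponential type or Gaussian, $\rho(x)=\beta e^{-\alpha|x|^2}$, and let $g(h)=1-\lambda_1(h)$ be the spectral gap of $T_h$ on $L^2(\mathbb R^d,d\nu_h)$. There exist $C>0$ and $h_0>0$ such that for all $n\in\mathbb N$, $h\in(0,h_0]$ and $\tau>0$, $$\sup_{|x|<\tau}\|T_h^n(x,dy)-d\nu_h\|_{TV}\le Cq(\tau,h)e^{-ng(h)},$$ where $q(\tau,h)=e^{\alpha\tau(\tau+3h)}$ in the Gaussian case and $q(\tau,h)=h^{-d/2}\sup_{|x|<\tau}\frac1{\rho(x)}$ in the tempered case.
   Context: $\rho\in C^1(\mathbb R^d)$ strictly positive, bounded, $\int\rho\,dx=1$. Smooth tempered of exponential type means $\rho\in C^\infty$ and there are $C_\beta>0$, $R>0$, $\kappa_0>0$ with $|\partial^\beta\rho(x)|\le C_\beta\rho(x)$ for all $\beta$ and $\sum_i\partial_{x_i}^2\rho(x)\ge\kappa_0\rho(x)$ for $|x|\ge R$. $m_h(x)=\int_{|y-x|<h}\rho(y)dy$. $T_h$ is the Markov operator $T_hf(x)=\frac1{m_h(x)}\int_{|y-x|<h}f(y)\rho(y)dy$ with kernel $t_h(x,dy)=\frac{\rho(y)}{m_h(x)}\mathbf 1_{|x-y|<h}dy$; $T_h^n(x,dy)$ is the $n$-step kernel. $d\nu_h=Z_h^{-1}m_h(x)\rho(x)dx$ is the stationary probability measure; $T_h$ is self-adjoint on $L^2(\mathbb R^d,d\nu_h)$ with $1$ a simple eigenvalue (constants), and $\lambda_1(h)$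 denotes the supremum of the spectrum of $T_h$ other than the eigenvalue $1$ (the second largest eigenvalue). For probability measures, $\|\mu-\nu\|_{TV}=\sup_A|\mu(A)-\nu(A)|$ over measurable $A$. *)

theory Defs
  imports "HOL-Analysis.Analysis"
begin

type_synonym 'n dens = "real^'n \<Rightarrow> real"

definition pd :: "'n::finite \<Rightarrow> 'n dens \<Rightarrow> 'n dens" where
  "pd i f x = frechet_derivative f (at x) (axis i 1)"

fun iter_pd :: "'n::finite list \<Rightarrow> 'n dens \<Rightarrow> 'n dens" where
  "iter_pd [] f = f"
| "iter_pd (i # is) f = pd i (iter_pd is f)"

definition smooth_fun :: "'n::finite dens \<Rightarrow> bool" where
  "smooth_fun f \<longleftrightarrow> (\<forall>is. \<forall>x. iter_pd is f differentiable (at x))"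

definition C1_fun :: "'n::finite dens \<Rightarrow> bool" where
  "C1_fun f \<longleftrightarrow> (\<forall>x. f differentiable (at x)) \<and> (\<forall>i. continuous_on UNIV (pd i f))"

definition admissible_density :: "'n::finite dens \<Rightarrow> bool" where
  "admissible_density \<rho> \<longleftrightarrow> C1_fun \<rho> \<and> (\<forall>x. \<rho> x > 0) \<and> bounded (range \<rho>)
     \<and> integrable lborel \<rho> \<and> (LINT x|lborel. \<rho> x) = 1"

definition smooth_tempered_exp :: "'n::finite dens \<Rightarrow> bool" where
  "smooth_tempered_exp \<rho> \<longleftrightarrow> smooth_fun \<rho>
     \<and> (\<forall>is. \<exists>C>0. \<forall>x. \<bar>iter_pd is \<rho> x\<bar> \<le> C * \<rho> x)
     \<and> (\<exists>R>0. \<exists>\<kappa>0>0. \<forall>x. norm x \<ge> R \<longrightarrow> (\<Sum>i\<in>UNIV. iter_pd [i, i] \<rho> x) \<ge> \<kappa>0 * \<rho> x)"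

definition mh :: "'n::finite dens \<Rightarrow> real \<Rightarrow> 'n dens" where
  "mh \<rho> h x = (LINT y:ball x h|lborel. \<rho> y)"

definition Th :: "'n::finite dens \<Rightarrow> real \<Rightarrow> 'n dens \<Rightarrow> 'n dens" where
  "Th \<rho> h f x = (LINT y:ball x h|lborel. f y * \<rho> y) / mh \<rho> h x"

definition Zh :: "'n::finite dens \<Rightarrow> real \<Rightarrow> real" where
  "Zh \<rho> h = (LINT x|lborel. mh \<rho> h x * \<rho> x)"

definition nuh :: "'n::finite dens \<Rightarrow> real \<Rightarrow> (real^'n) measure" where
  "nuh \<rho> h = density lborel (\<lambda>x. ennreal (mh \<rho> h x * \<rho> x / Zh \<rho> h))"

definition kernel_n :: "'n::finite dens \<Rightarrow> real \<Rightarrow> nat \<Rightarrow> real^'n \<Rightarrow> (real^'n) set \<Rightarrow> real" where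
  "kernel_n \<rho> h n x A = ((Th \<rho> h) ^^ n) (indicator A) x"

definition tv_dist :: "'n::finite dens \<Rightarrow> real \<Rightarrow> nat \<Rightarrow> real^'n \<Rightarrow> real" where
  "tv_dist \<rho> h n x = (SUP A\<in>sets lborel. \<bar>kernel_n \<rho> h n x A - measure (nuh \<rho> h) A\<bar>)"

definition L2 :: "'a measure \<Rightarrow> ('a \<Rightarrow> real) set" where
  "L2 M = {f. f \<in> borel_measurable M \<and> integrable M (\<lambda>x. (f x)^2)}"

definition spectrum_Th :: "'n::finite dens \<Rightarrow> real \<Rightarrow> real set" where
  "spectrum_Th \<rho> h = {l. \<not> (
      (\<forall>f\<in>L2 (nuh \<rho> h). (AE x in nuh \<rho> h. Th \<rho> h f x - l * f x = 0)
                          \<longrightarrow> (AE x in nuh \<rho> h. f x = 0))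
    \<and> (\<forall>g\<in>L2 (nuh \<rho> h). \<exists>f\<in>L2 (nuh \<rho> h). AE x in nuh \<rho> h. Th \<rho> h f x - l * f x = g x))}"

definition lambda1 :: "'n::finite dens \<Rightarrow> real \<Rightarrow> real" where
  "lambda1 \<rho> h = Sup (spectrum_Th \<rho> h - {1})"

definition spectral_gap :: "'n::finite dens \<Rightarrow> real \<Rightarrow> real" where
  "spectral_gap \<rho> h = 1 - lambda1 \<rho> h"

end

theory Submission
  imports Defs "HOL-Library.Function_Algebras" "HOL-Probability.Probability_Measure"
begin

text \<open>
  The walk is an $L^2(\nu_h)$ contraction, so two facts suffice. First, $T_h^n$ decays like $\lambda_1^n$ on the
  orthogonal complement of the constants; this needs the spectral theorem only in the weak form
  $\langle Tf,f\rangle \le \lambda_1 |f|^2$, together with a lower bound $T_h \ge -1+\delta$ and the bound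
  $\lambda_1 \ge 1 - G h^2$ from a test function. Second, after a burn-in of $n_0$ steps with $n_0\, g(h)$
  bounded, the operator maps $L^2(\nu_h)$ to pointwise bounded functions with norm at most $C q(\tau,h)$.

  In the tempered case one step is enough. In the Gaussian case the product of the densities along a path
  telescopes, so that $\rho\, T_h^n f \le e^{n \alpha h^2} U_h^n (\rho |f|)$ for the uniform ball walk $U_h$ on Lebesgue
  measure; a Nash inequality shows that $U_h^n$ maps $L^2$ to $L^\infty$ with a norm that is bounded
  in $h$ once $n \ge D / h^2$, and those steps cost only a constant because $g(h) \le G h^2$.
\<close>

section \<open>Self-adjoint contractions with a spectral gap\<close>

text \<open>The spectrum is a set of reals at which bijectivity modulo null functions fails, and
  \<lambda>1 is merely its supremum away from 1. It is used through one implication: where T - l is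
  onto, T - l is bounded below. Invertibility on the open interval (\<lambda>1, 1) then yields <(T -
  a)(T - 1) f, f> \<ge> 0, which replaces spectral projections.

  All constants must be uniform in h. The bottom of the spectrum is harmless because \<delta>
  depends on the dimension only, while \<lambda>1 tends to 1: for small h one has \<lambda>1 \<ge> 1
  - \<delta>, so the negative part never dominates. If the gap is not positive, the claim reduces to
  the fact that a total variation distance is at most 1.

  The factor h^(-d/2) of the tempered q is the price of one step, since sqrt(Z)/m(x) is of order
  h^(-d/2)/\<rho>(x). The Gaussian q has no such factor; removing it takes of order h^(-2) steps, so
  each of them may lose only a factor exp(O(h^2)), uniformly in x. This is why the second-order
  lower bound for m is needed there.

  Functions are made a vector space so that the square-integrable ones form a subspace.\<close>

instantiation "fun" :: (type, real_vector) real_vector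
begin

definition scaleR_fun :: "real \<Rightarrow> ('a \<Rightarrow> 'b) \<Rightarrow> 'a \<Rightarrow> 'b" where
  "scaleR_fun a f = (\<lambda>x. a *\<^sub>R f x)"

instance
  by standard (auto simp: scaleR_fun_def fun_eq_iff scaleR_add_right scaleR_add_left)

end

text \<open>Square-integrable functions are kept as functions, so the inner product is only semi-definite and
  $|f| = 0$ plays the role of equality almost everywhere.\<close>

locale semi_inner =
  fixes H :: "'v::real_vector set" and ip :: "'v \<Rightarrow> 'v \<Rightarrow> real"
  assumes subspace_H: "subspace H"
    and ip_sym: "x \<in> H \<Longrightarrow> y \<in> H \<Longrightarrow> ip x y = ip y x"
    and ip_add: "x \<in> H \<Longrightarrow> y \<in> H \<Longrightarrow> z \<in> H \<Longrightarrow> ip (x + y) z = ip x z + ip y z"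
    and ip_scale: "x \<in> H \<Longrightarrow> z \<in> H \<Longrightarrow> ip (a *\<^sub>R x) z = a * ip x z"
    and ip_ge0: "x \<in> H \<Longrightarrow> ip x x \<ge> 0"
begin

lemma H_closed [simp, intro]:
  "0 \<in> H" "x \<in> H \<Longrightarrow> y \<in> H \<Longrightarrow> x + y \<in> H" "x \<in> H \<Longrightarrow> y \<in> H \<Longrightarrow> x - y \<in> H" "x \<in> H \<Longrightarrow> a *\<^sub>R x \<in> H" "x \<in> H \<Longrightarrow> - x \<in> H"
  using subspace_H by (auto simp: subspace_0 subspace_add subspace_diff subspace_scale subspace_neg)

lemma ip_add_right: "x \<in> H \<Longrightarrow> y \<in> H \<Longrightarrow> z \<in> H \<Longrightarrow> ip z (x + y) = ip z x + ip z y"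
  using ip_sym[of z x] ip_sym[of z y] ip_sym[of z "x + y"] by (simp add: ip_add)

lemma ip_scale_right: "x \<in> H \<Longrightarrow> z \<in> H \<Longrightarrow> ip z (a *\<^sub>R x) = a * ip z x"
  using ip_sym[of z x] ip_sym[of z "a *\<^sub>R x"] by (simp add: ip_scale)

lemma ip_minus: "x \<in> H \<Longrightarrow> z \<in> H \<Longrightarrow> ip (- x) z = - ip x z"
  using ip_scale[of x z "-1"] by simp

lemma ip_minus_right: "x \<in> H \<Longrightarrow> z \<in> H \<Longrightarrow> ip z (- x) = - ip z x"
  using ip_scale_right[of x z "-1"] by simp

lemma ip_diff: "x \<in> H \<Longrightarrow> y \<in> H \<Longrightarrow> z \<in> H \<Longrightarrow> ip (x - y) z = ip x z - ip y z"
  using ip_add[of x "-y" z] by (simp add: ip_minus)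

lemma ip_diff_right: "x \<in> H \<Longrightarrow> y \<in> H \<Longrightarrow> z \<in> H \<Longrightarrow> ip z (x - y) = ip z x - ip z y"
  using ip_add_right[of x "-y" z] by (simp add: ip_minus_right)

lemma ip_zero [simp]: "z \<in> H \<Longrightarrow> ip 0 z = 0" "z \<in> H \<Longrightarrow> ip z 0 = 0"
  using ip_scale[of 0 z 0] ip_scale_right[of 0 z 0] by auto

lemmas ip_simps = ip_add ip_add_right ip_scale ip_scale_right ip_minus ip_minus_right ip_diff ip_diff_right

text \<open>Semi-definiteness suffices, which matters because the inequality is also applied to the
  forms <((T - c)^2 - R) x, y> and <(1 - T) x, y>. If \<open>ip y y = 0\<close>, the quadratic in
  \<open>t\<close> is affine and can stay nonnegative only with zero slope.\<close>

lemma Cauchy_Schwarz: 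
  assumes "x \<in> H" "y \<in> H"
  shows "(ip x y)\<^sup>2 \<le> ip x x * ip y y"
proof -
  have q: "0 \<le> ip x x - 2 * t * ip x y + t\<^sup>2 * ip y y" for t
  proof -
    have "0 \<le> ip (x - t *\<^sub>R y) (x - t *\<^sub>R y)"
      by (rule ip_ge0) (use assms in auto)
    also have "\<dots> = ip x x - 2 * t * ip x y + t\<^sup>2 * ip y y"
      using assms by (simp add: ip_simps ip_sym[of y x] power2_eq_square algebra_simps)
    finally show ?thesis .
  qed
  show ?thesis
  proof (cases "ip y y = 0")
    case True
    have "ip x y = 0"
    proof (rule ccontr)
      assume n: "ip x y \<noteq> 0"
      \<comment> \<open>This \<open>t\<close> gives the affine function the value -1.\<close>
      have "0 \<le> ip x x - 2 * ((ip x x + 1) / (2 * ip x y)) * ip x y"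
        using q[of "(ip x x + 1) / (2 * ip x y)"] True by simp
      with n show False by simp
    qed
    then show ?thesis using True by simp
  next
    case False
    then have p: "ip y y > 0" using ip_ge0[OF assms(2)] by simp
    have "0 \<le> ip x x - 2 * (ip x y / ip y y) * ip x y + (ip x y / ip y y)\<^sup>2 * ip y y"
      by (rule q)
    also have "\<dots> = ip x x - (ip x y)\<^sup>2 / ip y y"
      using p by (simp add: power2_eq_square field_simps)
    finally show ?thesis using p by (simp add: field_simps)
  qed
qed

definition nm :: "'v \<Rightarrow> real" where "nm x = sqrt (ip x x)"

lemma nm_ge0 [simp]: "x \<in> H \<Longrightarrow> 0 \<le> nm x" by (simp add: nm_def ip_ge0)

lemma nm_sq: "x \<in> H \<Longrightarrow> (nm x)\<^sup>2 = ip x x" by (simp add: nm_def ip_ge0)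

lemma abs_ip_le: "x \<in> H \<Longrightarrow> y \<in> H \<Longrightarrow> \<bar>ip x y\<bar> \<le> nm x * nm y"
  using real_sqrt_le_mono[OF Cauchy_Schwarz[of x y]] unfolding nm_def real_sqrt_mult real_sqrt_abs by blast

lemma nm_triangle: "x \<in> H \<Longrightarrow> y \<in> H \<Longrightarrow> nm (x + y) \<le> nm x + nm y"
proof (rule power2_le_imp_le)
  assume a: "x \<in> H" "y \<in> H"
  have "(nm (x + y))\<^sup>2 = ip x x + 2 * ip x y + ip y y"
    using a by (simp add: nm_sq ip_simps ip_sym[of y x])
  also have "\<dots> \<le> (nm x)\<^sup>2 + 2 * (nm x * nm y) + (nm y)\<^sup>2"
    using abs_ip_le[OF a] a by (simp add: nm_sq)
  finally show "(nm (x + y))\<^sup>2 \<le> (nm x + nm y)\<^sup>2" by (simp add: power2_sum)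
qed auto

lemma nm_scale: "x \<in> H \<Longrightarrow> nm (a *\<^sub>R x) = \<bar>a\<bar> * nm x"
proof -
  assume "x \<in> H"
  then have "ip (a *\<^sub>R x) (a *\<^sub>R x) = a\<^sup>2 * ip x x"
    by (simp add: ip_scale ip_scale_right power2_eq_square)
  then show ?thesis unfolding nm_def by (simp add: real_sqrt_mult)
qed

lemma nm_minus: "x \<in> H \<Longrightarrow> nm (- x) = nm x"
  using nm_scale[of x "-1"] by simp

lemma nm_diff_commute: "x \<in> H \<Longrightarrow> y \<in> H \<Longrightarrow> nm (x - y) = nm (y - x)"
  using nm_minus[of "x - y"] by simp

lemma nm_0 [simp]: "nm 0 = 0" by (simp add: nm_def)

lemma nm_triangle_diff: "x \<in> H \<Longrightarrow> y \<in> H \<Longrightarrow> z \<in> H \<Longrightarrow> nm (x - z) \<le> nm (x - y) + nm (y - z)"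
  using nm_triangle[of "x - y" "y - z"] by simp

lemma nm_triangle_lower: "x \<in> H \<Longrightarrow> y \<in> H \<Longrightarrow> \<bar>nm x - nm y\<bar> \<le> nm (x - y)"
  using nm_triangle[of "x - y" y] nm_triangle[of "y - x" x] nm_diff_commute[of x y] H_closed(3)[of x y] H_closed(3)[of y x]
  by simp

end

section \<open>Self-adjoint contractions: surjectivity, bounds from below, quadratic form\<close>

locale sa_contraction = semi_inner H ip for H :: "'v::real_vector set" and ip +
  fixes T :: "'v \<Rightarrow> 'v"
  assumes complete: "\<And>X. (\<And>n. X n \<in> H) \<Longrightarrow> (\<And>e. e > 0 \<Longrightarrow> \<exists>N. \<forall>m\<ge>N. \<forall>n\<ge>N. nm (X m - X n) < e) \<Longrightarrow>
      \<exists>x\<in>H. (\<lambda>n. nm (X n - x)) \<longlonglongrightarrow> 0"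
    and T_H [simp, intro]: "x \<in> H \<Longrightarrow> T x \<in> H"
    and T_add: "x \<in> H \<Longrightarrow> y \<in> H \<Longrightarrow> T (x + y) = T x + T y"
    and T_scale: "x \<in> H \<Longrightarrow> T (a *\<^sub>R x) = a *\<^sub>R T x"
    and T_sym: "x \<in> H \<Longrightarrow> y \<in> H \<Longrightarrow> ip (T x) y = ip x (T y)"
    and T_contr: "x \<in> H \<Longrightarrow> nm (T x) \<le> nm x"
begin

lemma T_diff: "x \<in> H \<Longrightarrow> y \<in> H \<Longrightarrow> T (x - y) = T x - T y"
  using T_add[of x "- y"] T_scale[of y "-1"] by simp

lemma funpow_H [simp, intro]: "x \<in> H \<Longrightarrow> (T ^^ n) x \<in> H"
  by (induction n) auto

text \<open>Mirrors \<open>spectrum_Th\<close> with \<open>nm = 0\<close> in the role of equality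
  almost everywhere; \<open>spec_eq\<close> identifies the two. Only bijectivity is asked of T - l;
  a bounded inverse is a conclusion, drawn from \<open>surjective_imp_bounded_below\<close>.\<close>

definition spec :: "real set" where
  "spec = {l. \<not> ((\<forall>f\<in>H. nm (T f - l *\<^sub>R f) = 0 \<longrightarrow> nm f = 0) \<and>
      (\<forall>g\<in>H. \<exists>f\<in>H. nm (T f - l *\<^sub>R f - g) = 0))}"

text \<open>Completeness with a rate, as needed both for the series with chosen signs and for the
  iteration that inverts T - l when l > 1. In \<open>tail\<close> the exact partial sum of the
  geometric series is kept so that the induction closes.\<close>

lemma geometric_limit:
  assumes X: "\<And>n. X n \<in> H" and q: "0 \<le> q" "q < 1" and step: "\<And>n. nm (X (Suc n) - X n) \<le> C * q ^ n"
  shows "\<exists>x\<in>H. \<forall>n. nm (x - X n) \<le> C * q ^ n / (1 - q)"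
proof -
  have C: "C \<ge> 0"
    using order_trans[OF nm_ge0[OF H_closed(3)[OF X X]] step[of 0]] by simp
  have tail: "nm (X (n + k) - X n) \<le> C * q ^ n / (1 - q) - C * q ^ (n + k) / (1 - q)" for n k
  proof (induction k)
    case (Suc k)
    have "nm (X (n + Suc k) - X n) \<le> nm (X (Suc (n + k)) - X (n + k)) + nm (X (n + k) - X n)"
      using nm_triangle_diff[of "X (n + Suc k)" "X (n + k)" "X n"] X by simp
    also have "\<dots> \<le> C * q ^ (n + k) + (C * q ^ n / (1 - q) - C * q ^ (n + k) / (1 - q))"
      using Suc step[of "n + k"] by linarith
    also have "\<dots> = C * q ^ n / (1 - q) - C * q ^ (n + Suc k) / (1 - q)"
    proof -
      have "C * q ^ (n + k) / (1 - q) - C * q ^ (n + Suc k) / (1 - q) = (C * q ^ (n + k) - C * q ^ (n + Suc k)) / (1 - q)"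
        by (rule diff_divide_distrib[symmetric])
      also have "C * q ^ (n + k) - C * q ^ (n + Suc k) = C * q ^ (n + k) * (1 - q)"
        by (simp add: algebra_simps)
      finally show ?thesis using q by simp
    qed
    finally show ?case .
  qed simp
  have tail2: "nm (X m - X n) \<le> C * q ^ n / (1 - q)" if "m \<ge> n" for m n
  proof -
    have "0 \<le> C * q ^ m / (1 - q)" using C q by simp
    then show ?thesis using tail[of n "m - n"] that by simp
  qed
  have lim0: "(\<lambda>n. C * q ^ n / (1 - q)) \<longlonglongrightarrow> 0"
    using q by (auto intro!: tendsto_eq_intros LIMSEQ_power_zero)
  have "\<exists>x\<in>H. (\<lambda>n. nm (X n - x)) \<longlonglongrightarrow> 0"
  proof (rule complete)
    fix e :: real assume "e > 0"
    then obtain N where N: "\<And>n. n \<ge> N \<Longrightarrow> C * q ^ n / (1 - q) < e"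
      using order_tendstoD(2)[OF lim0, of e] by (auto simp: eventually_sequentially)
    have "nm (X m - X n) < e" if "m \<ge> N" "n \<ge> N" for m n
      using tail2[of n m] tail2[of m n] N[OF that(1)] N[OF that(2)] nm_diff_commute[of "X m" "X n"] X
      by (cases "m \<ge> n") auto
    then show "\<exists>N. \<forall>m\<ge>N. \<forall>n\<ge>N. nm (X m - X n) < e" by blast
  qed (rule X)
  then obtain x where x: "x \<in> H" and lim: "(\<lambda>n. nm (X n - x)) \<longlonglongrightarrow> 0" by blast
  have "nm (x - X n) \<le> C * q ^ n / (1 - q)" for n
  proof -
    have "(\<lambda>m. nm (X m - x) + C * q ^ n / (1 - q)) \<longlonglongrightarrow> 0 + C * q ^ n / (1 - q)"
      by (intro tendsto_intros lim)
    moreover have "\<forall>\<^sub>F m in sequentially. nm (x - X n) \<le> nm (X m - x) + C * q ^ n / (1 - q)"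
      using eventually_ge_at_top[of n]
    proof eventually_elim
      case (elim m)
      then show ?case
        using nm_triangle_diff[of x "X m" "X n"] nm_diff_commute[of x "X m"] tail2[OF elim] X x by simp
    qed
    ultimately show ?thesis
      using tendsto_lowerbound[OF _ _ trivial_limit_sequentially] by fastforce
  qed
  with x show ?thesis by blast
qed

text \<open>A gliding hump: were $T - l$ not bounded below, unit vectors $f_n$ with $|(T - l) f_n| < 9^{-n}$
  and suitable signs would make $\sum_n \pm 3^{-n} f_n$ miss the range.\<close>

lemma surjective_imp_bounded_below:
  assumes surj: "\<And>g. g \<in> H \<Longrightarrow> \<exists>f\<in>H. nm (T f - l *\<^sub>R f - g) = 0"
  shows "\<exists>r>0. \<forall>f\<in>H. r * nm f \<le> nm (T f - l *\<^sub>R f)"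
proof (rule ccontr)
  define S where "S f = T f - l *\<^sub>R f" for f
  have S_H: "f \<in> H \<Longrightarrow> S f \<in> H" for f by (simp add: S_def)
  have S_sym: "ip (S f) g = ip f (S g)" if "f \<in> H" "g \<in> H" for f g
    using that by (simp add: S_def ip_simps T_sym)
  assume "\<not> ?thesis"
  then have "\<exists>f\<in>H. nm (S f) < r * nm f" if "r > 0" for r
    using that by (force simp: S_def not_le)
  then have "\<forall>n. \<exists>f\<in>H. nm (S f) < (1/9) ^ n * nm f" by simp
  then obtain F0 where F0: "\<And>n. F0 n \<in> H" "\<And>n. nm (S (F0 n)) < (1/9) ^ n * nm (F0 n)" by metis
  have pos: "nm (F0 n) > 0" for n
  proof (rule ccontr)
    assume "\<not> ?thesis"
    then have "nm (F0 n) = 0" using nm_ge0[OF F0(1)[of n]] by linarith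
    then show False using F0(2)[of n] nm_ge0[OF S_H[OF F0(1)[of n]]] by simp
  qed
  define F where "F n = (1 / nm (F0 n)) *\<^sub>R F0 n" for n
  have F_H: "F n \<in> H" for n using F0 by (simp add: F_def)
  have nm_F: "nm (F n) = 1" for n using F0 pos[of n] by (simp add: F_def nm_scale)
  have nm_SF: "nm (S (F n)) \<le> (1/9) ^ n" for n
  proof -
    have "S (F n) = (1 / nm (F0 n)) *\<^sub>R S (F0 n)"
      using F0 by (simp add: F_def S_def T_scale scaleR_diff_right)
    then show ?thesis using F0(2)[of n] pos[of n] S_H[OF F0(1)[of n]]
      by (simp add: nm_scale field_simps)
  qed
  \<comment> \<open>The sign agrees with the current pairing, so the new term adds to its absolute
    value and never cancels against it.\<close>
  define sg where "sg t = (if t \<ge> 0 then 1 else -1 :: real)" for t :: real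
  have sg_abs: "0 \<le> p \<Longrightarrow> \<bar>t + sg t * p\<bar> = \<bar>t\<bar> + p" for p t :: real
    by (cases "t \<ge> 0") (simp_all add: sg_def)
  define X where "X = rec_nat 0 (\<lambda>n x. x + (sg (ip x (F n)) * (1/3) ^ n) *\<^sub>R F n)"
  have X_0: "X 0 = 0" and X_Suc: "\<And>n. X (Suc n) = X n + (sg (ip (X n) (F n)) * (1/3) ^ n) *\<^sub>R F n"
    by (simp_all add: X_def)
  have X_H: "X n \<in> H" for n by (induction n) (auto simp: X_0 X_Suc F_H)
  have "nm (X (Suc n) - X n) \<le> 1 * (1/3) ^ n" for n
    by (simp add: X_Suc nm_scale F_H nm_F abs_mult sg_def)
  from geometric_limit[OF X_H _ _ this] obtain x where x: "x \<in> H"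
    and tail: "\<And>n. nm (x - X n) \<le> 1 * (1/3) ^ n / (1 - 1/3)" by auto
  obtain f where f: "f \<in> H" and Sf: "nm (S f - x) = 0"
    using surj[OF x] by (auto simp: S_def)
  have key: "3 ^ n \<le> 2 * nm f" for n
  proof -
    have "ip (X (Suc n)) (F n) = ip (X n) (F n) + sg (ip (X n) (F n)) * (1/3) ^ n"
      using nm_F[of n] F_H[of n] X_H[of n] by (simp add: X_Suc ip_simps nm_sq[symmetric])
    then have "\<bar>ip (X (Suc n)) (F n)\<bar> = \<bar>ip (X n) (F n)\<bar> + (1/3) ^ n"
      using sg_abs[of "(1/3) ^ n"] by simp
    then have 1: "(1/3) ^ n \<le> \<bar>ip (X (Suc n)) (F n)\<bar>" by simp
    \<comment> \<open>All later terms together contribute at most 3^(-n)/2, half of what term n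
      guarantees; the pairing of x with \<open>F n\<close> keeps the other half.\<close>
    have "\<bar>ip (x - X (Suc n)) (F n)\<bar> \<le> nm (x - X (Suc n)) * nm (F n)"
      by (intro abs_ip_le) (auto simp: x X_H F_H)
    also have "\<dots> \<le> 1/2 * (1/3) ^ n" using tail[of "Suc n"] by (simp add: nm_F)
    finally have 2: "\<bar>ip x (F n) - ip (X (Suc n)) (F n)\<bar> \<le> 1/2 * (1/3) ^ n"
      by (simp add: ip_simps x X_H F_H)
    have 3: "1/2 * (1/3) ^ n \<le> \<bar>ip x (F n)\<bar>" using 1 2 by linarith
    have "\<bar>ip (S f - x) (F n)\<bar> \<le> nm (S f - x) * nm (F n)"
      by (intro abs_ip_le) (auto simp: x F_H S_H f)
    then have "ip x (F n) = ip (S f) (F n)" using Sf by (simp add: ip_simps S_H f x F_H)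
    \<comment> \<open>Symmetry puts the operator on \<open>F n\<close>, whose image has size at most
      9^(-n). Against the lower bound 3^(-n)/2 this forces \<open>nm f\<close> to be at least 3^n/2
      for every n.\<close>
    also have "\<dots> = ip f (S (F n))" by (simp add: S_sym f F_H)
    also have "\<bar>\<dots>\<bar> \<le> nm f * nm (S (F n))" by (intro abs_ip_le) (auto simp: f S_H F_H)
    also have "\<dots> \<le> nm f * (1/9) ^ n" by (intro mult_left_mono nm_SF) (simp add: f)
    finally have "1/2 * (1/3) ^ n \<le> nm f * (1/9) ^ n" using 3 by linarith
    then have "1/2 * (1/3) ^ n * 9 ^ n \<le> nm f * (1/9) ^ n * 9 ^ n" by (rule mult_right_mono) simp
    moreover have "1/2 * (1/3) ^ n * 9 ^ n = (1/2 :: real) * 3 ^ n"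
      unfolding mult.assoc power_mult_distrib[symmetric] by simp
    moreover have "nm f * (1/9) ^ n * 9 ^ n = nm f"
      unfolding mult.assoc power_mult_distrib[symmetric] by simp
    ultimately show ?thesis by linarith
  qed
  obtain n where "2 * nm f < 3 ^ n" using real_arch_pow[of 3 "2 * nm f"] by auto
  with key[of n] show False by linarith
qed

lemma not_spec_bounded_below:
  assumes "l \<notin> spec"
  shows "\<exists>r>0. \<forall>f\<in>H. r * nm f \<le> nm (T f - l *\<^sub>R f)"
proof (rule surjective_imp_bounded_below)
  fix g assume "g \<in> H"
  moreover have "\<forall>g\<in>H. \<exists>f\<in>H. nm (T f - l *\<^sub>R f - g) = 0"
    using assms unfolding spec_def mem_Collect_eq not_not by (rule conjunct2)
  ultimately show "\<exists>f\<in>H. nm (T f - l *\<^sub>R f - g) = 0" by (rule bspec[rotated])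
qed

text \<open>For l > 1 the map x \<mapsto> (T x - g)/l is a strict contraction: its iterates converge
  to a preimage of g, and the kernel of T - l is null. This makes the set whose \<open>Sup\<close>
  defines \<lambda>1 bounded above.\<close>

lemma spec_le_1:
  assumes l: "l \<in> spec"
  shows "l \<le> 1"
proof (rule ccontr)
  assume "\<not> l \<le> 1"
  then have l1: "l > 1" by simp
  have inj: "nm f = 0" if f: "f \<in> H" "nm (T f - l *\<^sub>R f) = 0" for f
  proof -
    have "\<bar>nm (T f) - nm (l *\<^sub>R f)\<bar> \<le> 0" using nm_triangle_lower[of "T f" "l *\<^sub>R f"] f by auto
    then have "l * nm f = nm (T f)" using l1 f by (simp add: nm_scale)
    then have "(l - 1) * nm f \<le> 0" using T_contr[OF f(1)] by (simp add: algebra_simps)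
    then show ?thesis using l1 nm_ge0[OF f(1)] by (simp add: mult_le_0_iff)
  qed
  have surj: "\<exists>f\<in>H. nm (T f - l *\<^sub>R f - g) = 0" if g: "g \<in> H" for g
  proof -
    define X where "X n = ((\<lambda>x. (1/l) *\<^sub>R (T x - g)) ^^ n) 0" for n
    have X_Suc: "X (Suc n) = (1/l) *\<^sub>R (T (X n) - g)" for n by (simp add: X_def)
    have X_H: "X n \<in> H" for n
      by (induction n) (use g in \<open>auto simp: X_Suc\<close>, simp add: X_def)
    have step: "nm (X (Suc n) - X n) \<le> nm (X 1 - X 0) * (1/l) ^ n" for n
    proof (induction n)
      case (Suc n)
      have "X (Suc (Suc n)) - X (Suc n) = (1/l) *\<^sub>R T (X (Suc n) - X n)"
        unfolding X_Suc[of "Suc n"] X_Suc[of n] by (subst T_diff) (use X_H g in \<open>auto simp: X_Suc algebra_simps\<close>)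
      then have "nm (X (Suc (Suc n)) - X (Suc n)) = (1/l) * nm (T (X (Suc n) - X n))"
        using l1 X_H by (simp add: nm_scale)
      also have "\<dots> \<le> (1/l) * (nm (X 1 - X 0) * (1/l) ^ n)"
        using l1 T_contr[of "X (Suc n) - X n"] X_H Suc by (intro mult_left_mono) auto
      finally show ?case by (simp add: mult_ac)
    qed simp
    have q: "0 \<le> 1/l" "1/l < 1" using l1 by auto
    from geometric_limit[OF X_H q step] obtain x where x: "x \<in> H"
      and tail: "\<And>n. nm (x - X n) \<le> nm (X 1 - X 0) * (1/l) ^ n / (1 - 1/l)" by blast
    define D where "D = nm (X 1 - X 0) / (1 - 1/l)"
    have tail': "nm (x - X n) \<le> D * (1/l) ^ n" for n using tail[of n] by (simp add: D_def)
    have bd: "nm (T x - l *\<^sub>R x - g) \<le> (1 + l) * D * (1/l) ^ n" for n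
    proof -
      \<comment> \<open>By the recursion, g = T (X n) - l X (n+1), so the residual at x is expressed
        through the errors of two consecutive iterates.\<close>
      have eq: "T x - l *\<^sub>R x - g = T (x - X n) - l *\<^sub>R (x - X (Suc n))"
        using l1 x X_H by (simp add: X_Suc T_diff algebra_simps)
      have "nm (T x - l *\<^sub>R x - g) \<le> nm (T (x - X n)) + l * nm (x - X (Suc n))"
        unfolding eq using nm_triangle[of "T (x - X n)" "- (l *\<^sub>R (x - X (Suc n)))"] x X_H l1
        by (simp add: nm_minus nm_scale)
      also have "\<dots> \<le> D * (1/l) ^ n + l * (D * (1/l) ^ Suc n)"
        using T_contr[of "x - X n"] tail'[of n] tail'[of "Suc n"] x X_H l1
        by (intro add_mono mult_left_mono) auto
      also have "\<dots> = D * (1/l) ^ n + D * (1/l) ^ n" using l1 by simp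
      also have "\<dots> \<le> (1 + l) * D * (1/l) ^ n"
      proof -
        have "0 \<le> D * (1/l) ^ n" using tail'[of n] nm_ge0[of "x - X n"] x X_H by (meson H_closed order_trans)
        then have "0 \<le> (l - 1) * (D * (1/l) ^ n)" using l1 by simp
        then show ?thesis by (simp add: algebra_simps)
      qed
      finally show ?thesis .
    qed
    have "(\<lambda>n. (1 + l) * D * (1/l) ^ n) \<longlonglongrightarrow> 0"
      using q by (auto intro!: tendsto_eq_intros LIMSEQ_power_zero)
    then have "nm (T x - l *\<^sub>R x - g) \<le> 0"
      using bd by (intro tendsto_lowerbound[OF _ _ trivial_limit_sequentially]) auto
    moreover have "0 \<le> nm (T x - l *\<^sub>R x - g)" using x g by simp
    ultimately have "nm (T x - l *\<^sub>R x - g) = 0" by linarith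
    then show ?thesis using x by (rule bexI)
  qed
  have "l \<notin> spec" unfolding spec_def mem_Collect_eq not_not
  proof (intro conjI ballI impI)
    fix f assume "f \<in> H" "nm (T f - l *\<^sub>R f) = 0"
    then show "nm f = 0" by (rule inj)
  next
    fix g assume "g \<in> H"
    then show "\<exists>f\<in>H. nm (T f - l *\<^sub>R f - g) = 0" by (rule surj)
  qed
  with l show False by contradiction
qed

text \<open>Let $c$ be the midpoint of $(a, 1)$ and $r = \inf |(T - c) f|$ over unit vectors. As $(T-c)^2 - r^2 \ge 0$
  is nearly annihilated by minimizing vectors and factors as $(T - c - r)(T - c + r)$, one of $c \pm r$ is
  spectral, hence $r \ge (1-a)/2$.\<close>

lemma spectral_gap_form:
  assumes gap: "\<And>l. a < l \<Longrightarrow> l < 1 \<Longrightarrow> l \<notin> spec" and a: "a < 1" and f: "f \<in> H"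
  shows "0 \<le> ip (T f - a *\<^sub>R f) (T f - f)"
proof -
  define c where "c = (a + 1) / 2"
  define e where "e = (1 - a) / 2"
  define S where "S f = T f - c *\<^sub>R f" for f
  have S_H [simp, intro]: "f \<in> H \<Longrightarrow> S f \<in> H" for f by (simp add: S_def)
  have S_add: "S (x + y) = S x + S y" and S_scale: "S (t *\<^sub>R x) = t *\<^sub>R S x"
    if "x \<in> H" "y \<in> H" for x y t
    using that by (simp_all add: S_def T_add T_scale algebra_simps)
  have S_sym: "ip (S x) y = ip x (S y)" if "x \<in> H" "y \<in> H" for x y
    using that by (simp add: S_def ip_simps T_sym)
  define K where "K = 1 + \<bar>c\<bar>"
  have K: "K > 0" by (simp add: K_def add_pos_nonneg)
  have S_bound: "nm (S x) \<le> K * nm x" if "x \<in> H" for x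
    using nm_triangle[of "T x" "- (c *\<^sub>R x)"] T_contr[OF that] that
    by (simp add: S_def nm_minus nm_scale K_def algebra_simps)
  have main: "e * nm g \<le> nm (S g)" if g: "g \<in> H" for g
  proof (rule ccontr)
    assume n: "\<not> ?thesis"
    then have g0: "nm g > 0" using nm_ge0[OF g] nm_ge0[OF S_H[OF g]] by (cases "nm g = 0") auto
    define U where "U = {x \<in> H. nm x = 1}"
    define g' where "g' = (1 / nm g) *\<^sub>R g"
    have g'_U: "g' \<in> U" using g g0 by (simp add: U_def g'_def nm_scale)
    have "nm (S g') < e"
      using g g0 n S_scale[OF g g, of "1 / nm g"] by (simp add: g'_def nm_scale field_simps)
    then have g'_lt: "(nm (S g'))\<^sup>2 < e\<^sup>2"
      using g'_U by (intro power_strict_mono) (auto simp: U_def)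
    define R where "R = Inf ((\<lambda>x. (nm (S x))\<^sup>2) ` U)"
    have bdd: "bdd_below ((\<lambda>x. (nm (S x))\<^sup>2) ` U)" by (rule bdd_belowI[of _ 0]) auto
    have R_le: "R \<le> (nm (S x))\<^sup>2" if "x \<in> U" for x
      unfolding R_def using that bdd by (intro cInf_lower) auto
    have R0: "R \<ge> 0" unfolding R_def using g'_U by (intro cInf_greatest) auto
    have R_e: "R < e\<^sup>2" using R_le[OF g'_U] g'_lt by linarith
    define r where "r = sqrt R"
    have r: "0 \<le> r" "r\<^sup>2 = R" using R0 by (auto simp: r_def)
    have "\<bar>e\<bar> = e" using a by (simp add: e_def)
    then have r_e: "r < e" using R_e real_sqrt_less_mono[OF R_e] by (simp add: r_def)
    \<comment> \<open>The form of S^2 - R, with S = T - c; it is nonnegative exactly because R is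
      the infimum of |S x|^2 over unit vectors.\<close>
    define b where "b x y = ip (S x) (S y) - R * ip x y" for x y
    have form: "semi_inner H b"
    proof
      fix x y z :: 'v and t :: real
      assume x: "x \<in> H"
      show "b x x \<ge> 0"
      proof (cases "nm x = 0")
        case True
        then have "ip x x = 0" using nm_sq[OF x] by simp
        then show ?thesis using ip_ge0[OF S_H[OF x]] by (simp add: b_def)
      next
        case False
        then have p: "nm x > 0" using nm_ge0[OF x] by simp
        have "R \<le> (nm (S ((1 / nm x) *\<^sub>R x)))\<^sup>2"
          using x p by (intro R_le) (simp add: U_def nm_scale)
        also have "\<dots> = (nm (S x))\<^sup>2 / (nm x)\<^sup>2"
          using x p by (simp add: S_scale nm_scale power_divide)
        finally have "R * (nm x)\<^sup>2 \<le> (nm (S x))\<^sup>2" using p by (simp add: field_simps)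
        then show ?thesis using x by (simp add: b_def nm_sq)
      qed
      assume z: "z \<in> H"
      show "b (t *\<^sub>R x) z = t * b x z" using x z
        by (simp add: b_def S_scale ip_simps algebra_simps)
      show "b x z = b z x" using x z by (simp add: b_def ip_sym[of x z] ip_sym[of "S x" "S z"])
    next
      fix x y z :: 'v assume "x \<in> H" "y \<in> H" "z \<in> H"
      then show "b (x + y) z = b x z + b y z"
        by (simp add: b_def S_add ip_simps algebra_simps)
    qed (rule subspace_H)
    have "a < c - r" "c - r < 1" "a < c + r" "c + r < 1"
      using r(1) r_e a by (simp_all add: c_def e_def field_simps)
    then have "c - r \<notin> spec" "c + r \<notin> spec" using gap by blast+
    then obtain r1 r2 where r1: "r1 > 0" "\<And>x. x \<in> H \<Longrightarrow> r1 * nm x \<le> nm (T x - (c + r) *\<^sub>R x)"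
      and r2: "r2 > 0" "\<And>x. x \<in> H \<Longrightarrow> r2 * nm x \<le> nm (T x - (c - r) *\<^sub>R x)"
      by (meson not_spec_bounded_below)
    \<comment> \<open>Cauchy-Schwarz for \<open>b\<close> at x and y = (S^2 - R) x gives |y|^4 \<le>
      \<open>b x x\<close> K^2 |y|^2. Hence \<open>b x x\<close> < \<epsilon> forces |y| < r1 r2,
      whereas the two bounds from below give |y| \<ge> r1 r2.\<close>
    define \<epsilon> where "\<epsilon> = (r1 * r2)\<^sup>2 / K\<^sup>2"
    have "\<epsilon> > 0" using r1 r2 K by (simp add: \<epsilon>_def)
    then obtain x where xU: "x \<in> U" and x_lt: "(nm (S x))\<^sup>2 < R + \<epsilon>"
      using cInf_lessD[of "(\<lambda>x. (nm (S x))\<^sup>2) ` U" "R + \<epsilon>"] g'_U by (auto simp: R_def)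
    from xU have x: "x \<in> H" and x1: "nm x = 1" by (auto simp: U_def)
    have bxx: "b x x < \<epsilon>" using x_lt nm_sq[OF x] x1 x by (simp add: b_def nm_sq)
    define y where "y = S (S x) - R *\<^sub>R x"
    have y: "y \<in> H" using x by (simp add: y_def)
    have bxy: "b x y = (nm y)\<^sup>2"
    proof -
      have "b x y = ip (S (S x)) y - R * ip x y"
        unfolding b_def using S_sym[of "S x" y] x y by simp
      also have "\<dots> = ip y y"
        using x y ip_diff[of "S (S x)" "R *\<^sub>R x" y] by (simp add: y_def[symmetric] ip_scale)
      finally show ?thesis using y by (simp add: nm_sq)
    qed
    have byy: "b y y \<le> K\<^sup>2 * (nm y)\<^sup>2"
    proof -
      have "(nm (S y))\<^sup>2 \<le> (K * nm y)\<^sup>2" using S_bound[OF y] y by (intro power_mono) auto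
      moreover have "0 \<le> R * ip y y" using R0 ip_ge0[OF y] by simp
      ultimately show ?thesis using y by (simp add: b_def nm_sq power_mult_distrib)
    qed
    define z where "z = T x - (c - r) *\<^sub>R x"
    have z: "z \<in> H" using x by (simp add: z_def)
    \<comment> \<open>With R = r^2, S^2 - R = (S - r)(S + r): here z = (S + r) x and y = (S - r)
      z.\<close>
    have y_z: "y = T z - (c + r) *\<^sub>R z"
    proof -
      have "y = T (T x) - c *\<^sub>R T x - c *\<^sub>R (T x - c *\<^sub>R x) - (r * r) *\<^sub>R x"
        using x r(2) by (simp add: y_def S_def T_diff T_scale power2_eq_square)
      also have "\<dots> = (T (T x) - (c - r) *\<^sub>R T x) - (c + r) *\<^sub>R (T x - (c - r) *\<^sub>R x)"
        by (simp add: scaleR_diff_left scaleR_add_left scaleR_diff_right scaleR_add_right algebra_simps)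
      also have "\<dots> = T z - (c + r) *\<^sub>R z" using x by (simp add: z_def T_diff T_scale)
      finally show ?thesis .
    qed
    have "r1 * (r2 * 1) \<le> r1 * nm z" using r2(2)[OF x] r1(1) x1 by (intro mult_left_mono) (simp_all add: z_def)
    also have "\<dots> \<le> nm y" using r1(2)[OF z] by (simp add: y_z)
    finally have lower: "r1 * r2 \<le> nm y" by simp
    have "r1 * r2 > 0" using r1(1) r2(1) by simp
    then have ny: "nm y > 0" using lower by linarith
    have "((nm y)\<^sup>2)\<^sup>2 \<le> b x x * b y y"
      using semi_inner.Cauchy_Schwarz[OF form x y] bxy by simp
    also have "\<dots> \<le> b x x * (K\<^sup>2 * (nm y)\<^sup>2)"
      using byy semi_inner.ip_ge0[OF form x] by (rule mult_left_mono)
    also have "\<dots> < \<epsilon> * (K\<^sup>2 * (nm y)\<^sup>2)"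
      using bxx ny K by (intro mult_strict_right_mono) simp_all
    also have "\<dots> = (r1 * r2)\<^sup>2 * (nm y)\<^sup>2" using K by (simp add: \<epsilon>_def)
    finally have "(nm y)\<^sup>2 * (nm y)\<^sup>2 < (r1 * r2)\<^sup>2 * (nm y)\<^sup>2" by (simp only: power2_eq_square)
    then have "(nm y)\<^sup>2 < (r1 * r2)\<^sup>2" by (rule mult_right_less_imp_less) simp
    moreover have "(r1 * r2)\<^sup>2 \<le> (nm y)\<^sup>2"
      using lower \<open>r1 * r2 > 0\<close> by (intro power_mono) simp_all
    ultimately show False by simp
  qed
  \<comment> \<open>The conclusion is the squared bound |S f|^2 \<ge> e^2 |f|^2 rewritten by (t -
    c)^2 - e^2 = (t - a)(t - 1).\<close>
  have "(e * nm f)\<^sup>2 \<le> (nm (S f))\<^sup>2"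
    using main[OF f] a f by (intro power_mono) (auto simp: e_def)
  then have "e\<^sup>2 * ip f f \<le> ip (S f) (S f)"
    using f by (simp add: power_mult_distrib nm_sq)
  moreover have "ip (S f) (S f) = ip (T f) (T f) - 2 * c * ip (T f) f + c * c * ip f f"
    using f T_sym[OF f f] by (simp add: S_def ip_simps algebra_simps)
  moreover have "ip (T f - a *\<^sub>R f) (T f - f) = ip (T f) (T f) - (1 + a) * ip (T f) f + a * ip f f"
    using f T_sym[OF f f] by (simp add: ip_simps algebra_simps)
  moreover have "(1 + a) * ip (T f) f = 2 * c * ip (T f) f" by (simp add: c_def)
  moreover have "a * ip f f = c * c * ip f f - e\<^sup>2 * ip f f"
  proof -
    have "a = c * c - e\<^sup>2" by (simp add: c_def e_def power2_eq_square field_simps)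
    then show ?thesis by (simp only: left_diff_distrib)
  qed
  ultimately show ?thesis by linarith
qed

section \<open>From the quadratic form to the decay of powers\<close>

lemma power_bound: "x \<in> H \<Longrightarrow> nm ((T ^^ n) x) \<le> nm x"
  by (induction n) (auto intro: order_trans[OF T_contr])

lemma ip_T_le: "x \<in> H \<Longrightarrow> \<bar>ip (T x) x\<bar> \<le> ip x x"
  using abs_ip_le[of "T x" x] mult_right_mono[OF T_contr[of x], of "nm x"]
  by (simp add: nm_sq[symmetric] power2_eq_square)

lemma ip_funpow:
  assumes "x \<in> H" "y \<in> H"
  shows "ip ((T ^^ (m + k)) x) y = ip ((T ^^ m) x) ((T ^^ k) y)"
  using assms(1)
proof (induction k arbitrary: x)
  case (Suc k)
  have "ip ((T ^^ (m + Suc k)) x) y = ip ((T ^^ (m + k)) (T x)) y"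
    by (simp add: funpow_swap1)
  also have "\<dots> = ip ((T ^^ m) (T x)) ((T ^^ k) y)" using Suc by simp
  also have "\<dots> = ip (T ((T ^^ m) x)) ((T ^^ k) y)" by (simp add: funpow_swap1)
  also have "\<dots> = ip ((T ^^ m) x) (T ((T ^^ k) y))" using Suc assms by (intro T_sym) auto
  finally show ?case by simp
qed simp

text \<open>With s(n) = |T^n g|^2, symmetry gives |T^(2k) g - T^(2l) g|^2 = s(2k) + s(2l) - 2
  s(k+l), and s is nonincreasing, hence convergent. For even exponents the mixed inner product is
  itself a value of s; the full sequence could oscillate because of the eigenvalue -1.\<close>

lemma even_powers_converge:
  assumes g: "g \<in> H"
  shows "\<exists>x\<in>H. (\<lambda>k. nm ((T ^^ (2 * k)) g - x)) \<longlonglongrightarrow> 0"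
proof (rule complete)
  show "(T ^^ (2 * k)) g \<in> H" for k using g by simp
  define s where "s n = (nm ((T ^^ n) g))\<^sup>2" for n
  have "decseq s"
    unfolding decseq_Suc_iff s_def using g by (auto intro!: power_mono T_contr)
  moreover have "s n \<ge> 0" for n by (simp add: s_def)
  ultimately obtain L where L: "s \<longlonglongrightarrow> L" "\<And>n. L \<le> s n"
    by (metis decseq_convergent)
  have dist: "(nm ((T ^^ (2 * k)) g - (T ^^ (2 * l)) g))\<^sup>2 = s (2 * k) + s (2 * l) - 2 * s (k + l)" for k l
  proof -
    have e1: "ip ((T ^^ (2 * k)) g) ((T ^^ (2 * l)) g) = ip ((T ^^ (k + l)) g) ((T ^^ (k + l)) g)"
    proof -
      have "2 * k + 2 * l = (k + l) + (k + l)" by simp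
      then show ?thesis using g ip_funpow[of g g "2 * k" "2 * l"] ip_funpow[of g g "k + l" "k + l"] by metis
    qed
    have e2: "ip ((T ^^ (2 * l)) g) ((T ^^ (2 * k)) g) = ip ((T ^^ (k + l)) g) ((T ^^ (k + l)) g)"
      using ip_sym[of "(T ^^ (2 * l)) g" "(T ^^ (2 * k)) g"] g e1 by simp
    show ?thesis using g by (simp add: s_def nm_sq ip_diff ip_diff_right e1 e2)
  qed
  fix e :: real assume e: "e > 0"
  then obtain N where N: "\<And>n. n \<ge> N \<Longrightarrow> s n < L + e\<^sup>2 / 2"
    using order_tendstoD(2)[OF L(1), of "L + e\<^sup>2 / 2"] by (auto simp: eventually_sequentially)
  have "nm ((T ^^ (2 * m)) g - (T ^^ (2 * n)) g) < e" if "m \<ge> N" "n \<ge> N" for m n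
  proof (rule power2_less_imp_less)
    show "(nm ((T ^^ (2 * m)) g - (T ^^ (2 * n)) g))\<^sup>2 < e\<^sup>2"
      unfolding dist using N[of "2 * m"] N[of "2 * n"] L(2)[of "m + n"] that by simp
  qed (use e in simp)
  then show "\<exists>N. \<forall>m\<ge>N. \<forall>n\<ge>N. nm ((T ^^ (2 * m)) g - (T ^^ (2 * n)) g) < e" by blast
qed

text \<open>For $P = 1 - T$, the gap gives $(1-a) \langle Pf, f\rangle \le |Pf|^2$, which Cauchy--Schwarz for the form
  $\langle P\cdot,\cdot\rangle$ turns into $(1-a)|h|^2 \le \langle Ph,h\rangle$ on the range of $P$. The range contains
  all $g - T^{2k} g$, and $T^{2k} g \to 0$ since the limit is fixed by $T^2$.\<close>

lemma gap_bound:
  assumes gap: "\<And>l. a < l \<Longrightarrow> l < 1 \<Longrightarrow> l \<notin> spec" and a: "a < 1"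
    and u: "u \<in> H" "T u = u"
    and ergodic: "\<And>f. f \<in> H \<Longrightarrow> ip f u = 0 \<Longrightarrow> nm (T (T f) - f) = 0 \<Longrightarrow> nm f = 0"
    and g: "g \<in> H" "ip g u = 0"
  shows "ip (T g) g \<le> a * ip g g"
proof -
  define P where "P x = x - T x" for x
  have P_H [simp, intro]: "x \<in> H \<Longrightarrow> P x \<in> H" for x by (simp add: P_def)
  have P_sym: "ip (P x) y = ip x (P y)" if "x \<in> H" "y \<in> H" for x y
    using that by (simp add: P_def ip_simps T_sym)
  define b where "b x y = ip (P x) y" for x y
  have form: "semi_inner H b"
  proof
    fix x y z :: 'v and t :: real
    assume x: "x \<in> H"
    show "b x x \<ge> 0" using ip_T_le[OF x] x by (simp add: b_def P_def ip_diff)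
    assume z: "z \<in> H"
    show "b (t *\<^sub>R x) z = t * b x z"
      using x z by (simp add: b_def P_def T_scale ip_simps algebra_simps)
    have "b x z = ip x (P z)" using x z by (simp add: b_def P_sym)
    also have "\<dots> = b z x" unfolding b_def using x z by (intro ip_sym) auto
    finally show "b x z = b z x" .
  next
    fix x y z :: 'v assume "x \<in> H" "y \<in> H" "z \<in> H"
    then show "b (x + y) z = b x z + b y z"
      by (simp add: b_def P_def T_add ip_simps algebra_simps)
  qed (rule subspace_H)
  \<comment> \<open>With a1 = <Pf, f>, a2 = |Pf|^2 and a3 = <PPf, Pf>, the inequalities (1 - a) a1
    \<le> a2 and a2^2 \<le> a1 a3 combine to (1 - a) a2 \<le> a3; the case a2 = 0 is separate
    because a2 is divided out.\<close>
  have range_bound: "(1 - a) * ip (P f) (P f) \<le> ip (P (P f)) (P f)" if f: "f \<in> H" for f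
  proof -
    define a1 a2 a3 where "a1 = ip (P f) f" and "a2 = ip (P f) (P f)" and "a3 = ip (P (P f)) (P f)"
    have "T f - a *\<^sub>R f = (1 - a) *\<^sub>R f - P f" "T f - f = - P f"
      by (simp_all add: P_def algebra_simps)
    then have "0 \<le> ip ((1 - a) *\<^sub>R f - P f) (- P f)"
      using spectral_gap_form[OF gap a f] by simp
    also have "\<dots> = a2 - (1 - a) * a1"
      using f ip_sym[of f "P f"] by (simp add: ip_minus_right ip_diff ip_scale a1_def a2_def)
    finally have 1: "(1 - a) * a1 \<le> a2" by simp
    have 2: "a2\<^sup>2 \<le> a1 * a3"
      using semi_inner.Cauchy_Schwarz[OF form f P_H[OF f]] by (simp add: b_def a1_def a2_def a3_def)
    have 3: "a3 \<ge> 0" using semi_inner.ip_ge0[OF form P_H[OF f]] by (simp add: b_def a3_def)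
    have 4: "a2 \<ge> 0" using ip_ge0[OF P_H[OF f]] by (simp add: a2_def)
    have "(1 - a) * a2 \<le> a3"
    proof (cases "a2 = 0")
      case False
      have "(1 - a) * a2\<^sup>2 \<le> (1 - a) * (a1 * a3)" using 2 a by (intro mult_left_mono) auto
      also have "\<dots> = ((1 - a) * a1) * a3" by simp
      also have "\<dots> \<le> a2 * a3" using 1 3 by (rule mult_right_mono)
      finally have "a2 * ((1 - a) * a2) \<le> a2 * a3" by (simp add: power2_eq_square mult_ac)
      then show ?thesis using False 4 by simp
    qed (use 3 in simp)
    then show ?thesis by (simp add: a2_def a3_def)
  qed
  \<comment> \<open>The preimage is the sum of T^j g over j < n, built up by the induction.\<close>
  have in_range: "\<exists>f\<in>H. g - (T ^^ n) g = P f" for n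
  proof (induction n)
    case 0
    then show ?case by (intro bexI[of _ 0]) (use T_scale[of 0 0] in \<open>auto simp: P_def\<close>)
  next
    case (Suc n)
    then obtain f where f: "f \<in> H" "g - (T ^^ n) g = P f" by blast
    have "g - (T ^^ Suc n) g = P f + P ((T ^^ n) g)" unfolding f(2)[symmetric] by (simp add: P_def)
    also have "\<dots> = P (f + (T ^^ n) g)" using f g by (simp add: P_def T_add)
    finally show ?case using f g by blast
  qed
  obtain x where x: "x \<in> H" and lim: "(\<lambda>k. nm ((T ^^ (2 * k)) g - x)) \<longlonglongrightarrow> 0"
    using even_powers_converge[OF g(1)] by blast
  have orth: "ip ((T ^^ n) g) u = 0" for n
    using g u by (induction n) (auto simp: T_sym)
  have "ip x u = 0"
  proof -
    have "\<bar>ip x u\<bar> \<le> nm ((T ^^ (2 * k)) g - x) * nm u" for k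
      using abs_ip_le[of "(T ^^ (2 * k)) g - x" u] g u x by (simp add: ip_diff orth)
    moreover have "(\<lambda>k. nm ((T ^^ (2 * k)) g - x) * nm u) \<longlonglongrightarrow> 0"
      by (rule tendsto_mult_left_zero[OF lim])
    ultimately have "\<bar>ip x u\<bar> \<le> 0" by (intro tendsto_lowerbound[OF _ _ trivial_limit_sequentially]) auto
    then show ?thesis by simp
  qed
  moreover have "nm (T (T x) - x) = 0"
  proof -
    \<comment> \<open>T^2 shifts the sequence of even powers by one index, so its limit is fixed by
      T^2 up to a null vector.\<close>
    have bd: "nm (T (T x) - x) \<le> nm ((T ^^ (2 * k)) g - x) + nm ((T ^^ (2 * Suc k)) g - x)" for k
    proof -
      let ?y = "(T ^^ (2 * k)) g"
      have "nm (T (T x) - x) \<le> nm (T (T x) - T (T ?y)) + nm (T (T ?y) - x)"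
        using x g by (intro nm_triangle_diff) auto
      also have "T (T x) - T (T ?y) = T (T (x - ?y))" using x g by (simp add: T_diff)
      also have "nm \<dots> \<le> nm (x - ?y)"
        using x g by (intro order_trans[OF T_contr T_contr]) auto
      finally show ?thesis using nm_diff_commute[of x ?y] x g by simp
    qed
    have "(\<lambda>k. nm ((T ^^ (2 * k)) g - x) + nm ((T ^^ (2 * Suc k)) g - x)) \<longlonglongrightarrow> 0 + 0"
      using lim LIMSEQ_Suc[OF lim] by (intro tendsto_add)
    then have "nm (T (T x) - x) \<le> 0 + 0"
      using bd by (intro tendsto_lowerbound[OF _ _ trivial_limit_sequentially]) auto
    moreover have "0 \<le> nm (T (T x) - x)" using x by simp
    ultimately show ?thesis by simp
  qed
  ultimately have x0: "nm x = 0" using ergodic[OF x] by blast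
  define G where "G k = (T ^^ (2 * k)) g" for k
  have G_H [simp]: "G k \<in> H" for k using g by (simp add: G_def)
  have limG: "(\<lambda>k. nm (G k)) \<longlonglongrightarrow> 0"
  proof -
    have "nm (G k) \<le> nm (G k - x)" for k using nm_triangle[of "G k - x" x] x x0 by simp
    then show ?thesis
      by (intro tendsto_sandwich[OF _ _ tendsto_const lim]) (auto simp: G_def[symmetric])
  qed
  have q_bound: "\<bar>ip (T y - a *\<^sub>R y) z\<bar> \<le> (1 + \<bar>a\<bar>) * nm y * nm z" if "y \<in> H" "z \<in> H" for y z
  proof -
    have "nm (T y - a *\<^sub>R y) \<le> (1 + \<bar>a\<bar>) * nm y"
      using nm_triangle[of "T y" "- (a *\<^sub>R y)"] T_contr[of y] that
      by (simp add: nm_minus nm_scale algebra_simps)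
    then have "nm (T y - a *\<^sub>R y) * nm z \<le> (1 + \<bar>a\<bar>) * nm y * nm z"
      by (rule mult_right_mono) (use that in simp)
    then show ?thesis using abs_ip_le[of "T y - a *\<^sub>R y" z] that by force
  qed
  \<comment> \<open>g itself is only a limit of elements h = g - T^(2k) g of the range. Passing from
    h to g costs two error terms, with |h| \<le> 2 |g| in one and |g| in the other, whence the
    factor 3.\<close>
  have "ip (T g - a *\<^sub>R g) g \<le> 3 * (1 + \<bar>a\<bar>) * nm g * nm (G k)" for k
  proof -
    define h where "h = g - G k"
    have h: "h \<in> H" using g by (simp add: h_def)
    obtain f where "f \<in> H" "h = P f" using in_range[of "2 * k"] by (auto simp: h_def G_def)
    then have "(1 - a) * ip h h \<le> ip (P h) h" using range_bound by simp
    then have 1: "ip (T h - a *\<^sub>R h) h \<le> 0" using h by (simp add: P_def ip_simps algebra_simps)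
    have nG: "nm (G k) \<le> nm g" using power_bound[OF g(1)] by (simp add: G_def)
    have nh: "nm h \<le> 2 * nm g"
      using nm_triangle[of g "- G k"] nG g by (simp add: h_def nm_minus)
    have "T g - a *\<^sub>R g = (T h - a *\<^sub>R h) + (T (G k) - a *\<^sub>R G k)"
      using g by (simp add: h_def T_diff algebra_simps)
    then have "ip (T g - a *\<^sub>R g) g = ip (T h - a *\<^sub>R h) g + ip (T (G k) - a *\<^sub>R G k) g"
      using g h by (simp add: ip_add)
    also have "ip (T h - a *\<^sub>R h) g = ip (T h - a *\<^sub>R h) h + ip (T h - a *\<^sub>R h) (G k)"
      using g h ip_add_right[of h "G k" "T h - a *\<^sub>R h"] by (simp add: h_def)
    also have "\<dots> + ip (T (G k) - a *\<^sub>R G k) g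
        \<le> 0 + (1 + \<bar>a\<bar>) * nm h * nm (G k) + (1 + \<bar>a\<bar>) * nm (G k) * nm g"
      using 1 q_bound[of h "G k"] q_bound[of "G k" g] h g by (intro add_mono) auto
    also have "\<dots> \<le> 0 + (1 + \<bar>a\<bar>) * (2 * nm g) * nm (G k) + (1 + \<bar>a\<bar>) * nm (G k) * nm g"
      using nh by (intro add_mono mult_left_mono mult_right_mono order_refl) auto
    also have "\<dots> = 3 * (1 + \<bar>a\<bar>) * nm g * nm (G k)" by (simp add: algebra_simps)
    finally show ?thesis .
  qed
  moreover have "(\<lambda>k. 3 * (1 + \<bar>a\<bar>) * nm g * nm (G k)) \<longlonglongrightarrow> 0"
    by (rule tendsto_mult_right_zero[OF limG])
  ultimately have "ip (T g - a *\<^sub>R g) g \<le> 0"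
    by (intro tendsto_lowerbound[OF _ _ trivial_limit_sequentially]) auto
  then show ?thesis using g by (simp add: ip_simps)
qed

text \<open>The supremum of an empty set of reals carries no information, so it must be shown that
  \<open>spec - {1}\<close> is nonempty as soon as some vector orthogonal to u has positive
  norm.\<close>

lemma form_le_Sup_spec:
  assumes L: "Sup (spec - {1}) < 1"
    and u: "u \<in> H" "T u = u"
    and ergodic: "\<And>f. f \<in> H \<Longrightarrow> ip f u = 0 \<Longrightarrow> nm (T (T f) - f) = 0 \<Longrightarrow> nm f = 0"
    and g: "g \<in> H" "ip g u = 0"
  shows "ip (T g) g \<le> Sup (spec - {1}) * ip g g"
proof (cases "nm g = 0")
  case True
  then have "ip g g = 0" using nm_sq[OF g(1)] by simp
  then show ?thesis using ip_T_le[OF g(1)] by simp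
next
  case False
  have "spec - {1} \<noteq> {}"
  proof
    assume "spec - {1} = {}"
    \<comment> \<open>With no spectral value other than 1, any a < 1 is admissible; a value below -1
      contradicts contractivity.\<close>
    then have "ip (T g) g \<le> (-2) * ip g g"
      by (intro gap_bound[OF _ _ u ergodic g]) auto
    moreover have "ip g g > 0" using False nm_ge0[OF g(1)] by (simp flip: nm_sq[OF g(1)])
    ultimately show False using ip_T_le[OF g(1)] by simp
  qed
  moreover have "bdd_above (spec - {1})" by (rule bdd_aboveI[of _ 1]) (use spec_le_1 in auto)
  ultimately have "l \<notin> spec" if "Sup (spec - {1}) < l" "l < 1" for l
    using that cSup_upper[of l "spec - {1}"] by auto
  then show ?thesis by (intro gap_bound[OF _ L u ergodic g]) auto
qed

text \<open>The norm of a symmetric operator equals its numerical radius. Polarization with f + k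
  and f - k uses the bound on the form from both sides; the complement of u is invariant, so the
  one-step estimate iterates.\<close>

lemma funpow_decay:
  assumes L: "0 < L"
    and u: "u \<in> H" "T u = u"
    and form: "\<And>f. f \<in> H \<Longrightarrow> ip f u = 0 \<Longrightarrow> \<bar>ip (T f) f\<bar> \<le> L * ip f f"
    and g: "g \<in> H" "ip g u = 0"
  shows "nm ((T ^^ n) g) \<le> L ^ n * nm g"
proof -
  have step: "nm (T f) \<le> L * nm f" if f: "f \<in> H" "ip f u = 0" for f
  proof -
    \<comment> \<open>The scaling balances the two norms in the parallelogram identity: 4 |Tf|^2/L
      \<le> 2 L |f|^2 + 2 |Tf|^2/L, which is |Tf|^2 \<le> L^2 |f|^2.\<close>
    define k where "k = (1 / L) *\<^sub>R T f"
    have k: "k \<in> H" "ip k u = 0" using f u by (auto simp: k_def ip_scale T_sym)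
    have "ip (T (f + k)) (f + k) \<le> L * ip (f + k) (f + k)"
      using form[of "f + k"] f k u by (simp add: ip_add)
    moreover have "- ip (T (f - k)) (f - k) \<le> L * ip (f - k) (f - k)"
      using form[of "f - k"] f k u by (simp add: ip_diff)
    moreover have "ip (T (f + k)) (f + k) - ip (T (f - k)) (f - k) = 4 * ip (T f) k"
      using f k ip_sym[of "T k" f] T_sym[of f k]
      by (simp add: T_add T_diff ip_add ip_add_right ip_diff ip_diff_right)
    moreover have "ip (f + k) (f + k) + ip (f - k) (f - k) = 2 * ip f f + 2 * ip k k"
      using f k by (simp add: ip_add ip_add_right ip_diff ip_diff_right)
    ultimately have "4 * ip (T f) k \<le> L * ip (f + k) (f + k) + L * ip (f - k) (f - k)"
      by linarith
    also have "\<dots> = L * (2 * ip f f + 2 * ip k k)"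
      using \<open>ip (f + k) (f + k) + ip (f - k) (f - k) = _\<close> by (simp only: distrib_left[symmetric])
    also have "ip (T f) k = ip (T f) (T f) / L" using f by (simp add: k_def ip_scale_right)
    also have "ip k k = ip (T f) (T f) / L\<^sup>2"
      using f by (simp add: k_def ip_scale ip_scale_right power2_eq_square)
    finally have "4 * (ip (T f) (T f) / L) \<le> 2 * (L * ip f f) + 2 * (L * (ip (T f) (T f) / L\<^sup>2))"
      by (simp only: distrib_left mult.left_commute[of L 2])
    moreover have "L * (ip (T f) (T f) / L\<^sup>2) = ip (T f) (T f) / L"
      using L by (simp add: power2_eq_square)
    ultimately have "ip (T f) (T f) / L \<le> L * ip f f" by linarith
    then have "ip (T f) (T f) \<le> L\<^sup>2 * ip f f"
      using L by (simp add: pos_divide_le_eq power2_eq_square mult_ac)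
    then have "(nm (T f))\<^sup>2 \<le> (L * nm f)\<^sup>2" using f by (simp add: nm_sq power_mult_distrib)
    then show ?thesis by (rule power2_le_imp_le) (use L f in simp)
  qed
  have orth: "ip ((T ^^ n) g) u = 0" for n
    using g u by (induction n) (auto simp: T_sym)
  show ?thesis
  proof (induction n)
    case (Suc n)
    have "nm ((T ^^ Suc n) g) \<le> L * nm ((T ^^ n) g)" using step[of "(T ^^ n) g"] orth g by simp
    also have "\<dots> \<le> L * (L ^ n * nm g)" using Suc L by (intro mult_left_mono) auto
    finally show ?case by (simp add: mult.assoc)
  qed simp
qed

end

section \<open>Completeness of $L^2$\<close>

lemma ball_borel [measurable]: "ball (x :: 'a::euclidean_space) r \<in> sets borel"
  by simp

lemma L2_mult_integrable:
  assumes "f \<in> L2 M" "g \<in> L2 M"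
  shows "integrable M (\<lambda>x. f x * g x)"
proof (rule Bochner_Integration.integrable_bound)
  show "integrable M (\<lambda>x. (f x)\<^sup>2 + (g x)\<^sup>2)"
    using assms by (auto simp: L2_def)
  show "(\<lambda>x. f x * g x) \<in> borel_measurable M" using assms by (auto simp: L2_def)
  show "AE x in M. norm (f x * g x) \<le> norm ((f x)\<^sup>2 + (g x)\<^sup>2)"
  proof (rule AE_I2)
    fix x
    have "2 * \<bar>f x\<bar> * \<bar>g x\<bar> \<le> \<bar>f x\<bar>\<^sup>2 + \<bar>g x\<bar>\<^sup>2" by (rule sum_squares_bound)
    moreover have "0 \<le> \<bar>f x\<bar> * \<bar>g x\<bar>" by simp
    ultimately have "\<bar>f x\<bar> * \<bar>g x\<bar> \<le> \<bar>f x\<bar>\<^sup>2 + \<bar>g x\<bar>\<^sup>2" by linarith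
    then show "norm (f x * g x) \<le> norm ((f x)\<^sup>2 + (g x)\<^sup>2)" by (simp add: abs_mult)
  qed
qed

lemma L2_add: "f \<in> L2 M \<Longrightarrow> g \<in> L2 M \<Longrightarrow> (\<lambda>x. f x + g x) \<in> L2 M"
  using L2_mult_integrable[of f M g]
  by (auto simp: L2_def power2_sum mult.assoc)

lemma L2_scale: "f \<in> L2 M \<Longrightarrow> (\<lambda>x. a * f x) \<in> L2 M"
  by (auto simp: L2_def power_mult_distrib)

lemma L2_diff: "f \<in> L2 M \<Longrightarrow> g \<in> L2 M \<Longrightarrow> (\<lambda>x. f x - g x) \<in> L2 M"
  using L2_add[of f M "\<lambda>x. (-1) * g x"] L2_scale[of g M "-1"] by simp

lemma semi_inner_L2: "semi_inner (L2 M) (\<lambda>f g. LINT x|M. f x * g x)"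
proof
  show "subspace (L2 M)"
    unfolding subspace_def
    by (auto simp: zero_fun_def plus_fun_def scaleR_fun_def L2_add L2_scale) (simp add: L2_def)
next
  fix f g h :: "'a \<Rightarrow> real" and a :: real
  assume f: "f \<in> L2 M"
  show "0 \<le> (LINT x|M. f x * f x)" by (simp add: integral_nonneg_AE)
  assume g: "g \<in> L2 M"
  show "(LINT x|M. f x * g x) = (LINT x|M. g x * f x)" by (simp add: mult.commute)
  show "(LINT x|M. (a *\<^sub>R f) x * g x) = a * (LINT x|M. f x * g x)"
    by (simp add: scaleR_fun_def mult.assoc)
  assume h: "h \<in> L2 M"
  show "(LINT x|M. (f + g) x * h x) = (LINT x|M. f x * h x) + (LINT x|M. g x * h x)"
    using L2_mult_integrable[OF f h] L2_mult_integrable[OF g h]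
    by (simp add: plus_fun_def distrib_right)
qed

text \<open>Riesz-Fischer: a subsequence with rapidly decreasing increments converges almost
  everywhere, and Fatou's lemma transfers the Cauchy estimates of the whole sequence to the
  pointwise limit.\<close>

lemma L2_complete:
  fixes X :: "nat \<Rightarrow> 'a \<Rightarrow> real"
  assumes X: "\<And>n. X n \<in> L2 M"
    and Cauchy: "\<And>e. e > 0 \<Longrightarrow> \<exists>N. \<forall>m\<ge>N. \<forall>n\<ge>N. sqrt (LINT x|M. (X m x - X n x)\<^sup>2) < e"
  shows "\<exists>f\<in>L2 M. (\<lambda>n. sqrt (LINT x|M. (X n x - f x)\<^sup>2)) \<longlonglongrightarrow> 0"
proof -
  have [measurable]: "X n \<in> borel_measurable M" for n using X[of n] by (simp add: L2_def)
  have int: "integrable M (\<lambda>x. (X m x - X n x)\<^sup>2)" for m n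
    using L2_diff[OF X[of m] X[of n]] by (simp add: L2_def)
  have nn: "(\<integral>\<^sup>+x. ennreal ((X m x - X n x)\<^sup>2) \<partial>M) = ennreal (LINT x|M. (X m x - X n x)\<^sup>2)" for m n
    by (intro nn_integral_eq_integral int) auto
  have small: "(LINT x|M. (X m x - X n x)\<^sup>2) < e\<^sup>2" if "sqrt (LINT x|M. (X m x - X n x)\<^sup>2) < e" "e > 0" for m n e
    using that real_less_rsqrt real_sqrt_less_iff[of "LINT x|M. (X m x - X n x)\<^sup>2" "e\<^sup>2"] by simp
  have "\<forall>k. \<exists>N. \<forall>m\<ge>N. \<forall>n\<ge>N. (LINT x|M. (X m x - X n x)\<^sup>2) < (1/4) ^ k"
  proof
    fix k
    obtain N where "\<forall>m\<ge>N. \<forall>n\<ge>N. sqrt (LINT x|M. (X m x - X n x)\<^sup>2) < (1/2) ^ k"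
      using Cauchy[of "(1/2) ^ k"] by auto
    then have "\<forall>m\<ge>N. \<forall>n\<ge>N. (LINT x|M. (X m x - X n x)\<^sup>2) < ((1/2) ^ k)\<^sup>2"
      by (auto intro!: small)
    moreover have "((1/2) ^ k)\<^sup>2 = (1/4 :: real) ^ k"
      unfolding power2_eq_square power_mult_distrib[symmetric] by simp
    ultimately show "\<exists>N. \<forall>m\<ge>N. \<forall>n\<ge>N. (LINT x|M. (X m x - X n x)\<^sup>2) < (1/4) ^ k" by auto
  qed
  then obtain N where N: "\<And>k m n. m \<ge> N k \<Longrightarrow> n \<ge> N k \<Longrightarrow> (LINT x|M. (X m x - X n x)\<^sup>2) < (1/4) ^ k"
    by metis
  \<comment> \<open>Summing the thresholds makes r monotone and at least \<open>N k\<close>; the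
    added k makes it tend to infinity.\<close>
  define r where "r k = (\<Sum>j\<le>k. N j) + k" for k
  have r_N: "N k \<le> r k" for k unfolding r_def by (simp add: member_le_sum trans_le_add1)
  have r_mono: "r k \<le> r (Suc k)" for k by (simp add: r_def)
  define D where "D k x = (X (r (Suc k)) x - X (r k) x)\<^sup>2" for k x
  \<comment> \<open>The weight 2^k leaves integrals that are still summable, while finiteness of the
    weighted sum at x bounds the increments there by a geometric sequence of ratio
    sqrt(1/2).\<close>
  have D_int: "(\<integral>\<^sup>+x. ennreal (2 ^ k * D k x) \<partial>M) \<le> ennreal ((1/2) ^ k)" for k
  proof -
    have "(LINT x|M. D k x) \<le> (1/4) ^ k"
      unfolding D_def using r_N[of k] r_mono[of k] by (intro less_imp_le[OF N]) auto
    have "(\<integral>\<^sup>+x. ennreal (2 ^ k * D k x) \<partial>M) = ennreal (2 ^ k * (LINT x|M. D k x))"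
      unfolding D_def by (subst nn_integral_eq_integral) (auto intro!: integrable_mult_right int)
    also have "\<dots> \<le> ennreal (2 ^ k * (1/4) ^ k)"
      using \<open>(LINT x|M. D k x) \<le> (1/4) ^ k\<close> by (intro ennreal_leI mult_left_mono) auto
    also have "2 ^ k * (1/4) ^ k = (1/2 :: real) ^ k" unfolding power_mult_distrib[symmetric] by simp
    finally show ?thesis .
  qed
  have "(\<integral>\<^sup>+x. (\<Sum>k. ennreal (2 ^ k * D k x)) \<partial>M) = (\<Sum>k. \<integral>\<^sup>+x. ennreal (2 ^ k * D k x) \<partial>M)"
    by (intro nn_integral_suminf) (simp add: D_def)
  also have "\<dots> \<le> (\<Sum>k. ennreal ((1/2) ^ k))" by (intro suminf_le D_int) auto
  also have "\<dots> = ennreal (\<Sum>k. (1/2) ^ k)" by (intro suminf_ennreal2) auto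
  also have "\<dots> < \<infinity>" by simp
  finally have "AE x in M. (\<Sum>k. ennreal (2 ^ k * D k x)) \<noteq> \<infinity>"
    by (intro nn_integral_PInf_AE) (auto simp: D_def)
  then have conv: "AE x in M. convergent (\<lambda>k. X (r k) x)"
  proof eventually_elim
    case (elim x)
    define S where "S = enn2real (\<Sum>k. ennreal (2 ^ k * D k x))"
    have le: "\<bar>X (r (Suc k)) x - X (r k) x\<bar> \<le> sqrt S * sqrt (1/2) ^ k" for k
    proof -
      have "ennreal (2 ^ k * D k x) \<le> (\<Sum>k. ennreal (2 ^ k * D k x))"
        using sum_le_suminf[of "\<lambda>k. ennreal (2 ^ k * D k x)" "{k}"] by simp
      also have "\<dots> = ennreal S" using elim by (simp add: S_def less_top)
      finally have "2 ^ k * D k x \<le> S" by (simp add: S_def ennreal_le_iff)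
      then have "D k x \<le> S * (1/2) ^ k" by (simp add: field_simps power_one_over)
      then have "sqrt (D k x) \<le> sqrt (S * (1/2) ^ k)" by (rule real_sqrt_le_mono)
      then show ?thesis unfolding D_def real_sqrt_mult real_sqrt_abs unfolding real_sqrt_power .
    qed
    have "summable (\<lambda>k. sqrt S * sqrt (1/2) ^ k)"
      by (intro summable_mult summable_geometric) simp
    then have "summable (\<lambda>k. X (r (Suc k)) x - X (r k) x)"
      by (rule summable_comparison_test') (use le in auto)
    then have "convergent (\<lambda>n. X (r n) x - X (r 0) x)"
      unfolding summable_iff_convergent sum_lessThan_telescope[of "\<lambda>k. X (r k) x"] .
    then show ?case by (simp only: convergent_diff_const_right_iff)
  qed
  define f where "f x = lim (\<lambda>k. X (r k) x)" for x
  have f_meas [measurable]: "f \<in> borel_measurable M"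
    unfolding f_def by (intro borel_measurable_lim_metric) simp
  have Fatou: "(\<integral>\<^sup>+x. ennreal ((X n x - f x)\<^sup>2) \<partial>M) \<le> ennreal e"
    if e: "\<And>m. m \<ge> K \<Longrightarrow> (LINT x|M. (X n x - X m x)\<^sup>2) \<le> e" "e \<ge> 0" for n K e
  proof -
    have "(\<integral>\<^sup>+x. ennreal ((X n x - f x)\<^sup>2) \<partial>M) = (\<integral>\<^sup>+x. liminf (\<lambda>k. ennreal ((X n x - X (r k) x)\<^sup>2)) \<partial>M)"
    proof (rule nn_integral_cong_AE)
      show "AE x in M. ennreal ((X n x - f x)\<^sup>2) = liminf (\<lambda>k. ennreal ((X n x - X (r k) x)\<^sup>2))"
        using conv
      proof eventually_elim
        case (elim x)
        then have "(\<lambda>k. X (r k) x) \<longlonglongrightarrow> f x" by (simp add: f_def convergent_LIMSEQ_iff)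
        then have "(\<lambda>k. ennreal ((X n x - X (r k) x)\<^sup>2)) \<longlonglongrightarrow> ennreal ((X n x - f x)\<^sup>2)"
          by (intro tendsto_intros tendsto_ennrealI)
        then show ?case using lim_imp_Liminf[OF trivial_limit_sequentially] by metis
      qed
    qed
    also have "\<dots> \<le> liminf (\<lambda>k. \<integral>\<^sup>+x. ennreal ((X n x - X (r k) x)\<^sup>2) \<partial>M)"
      by (intro nn_integral_liminf) simp
    also have "\<dots> \<le> ennreal e"
    proof (rule Liminf_le)
      show "\<forall>\<^sub>F k in sequentially. (\<integral>\<^sup>+x. ennreal ((X n x - X (r k) x)\<^sup>2) \<partial>M) \<le> ennreal e"
        using eventually_ge_at_top[of K]
      proof eventually_elim
        case (elim k)
        then have "r k \<ge> K" by (simp add: r_def)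
        then show ?case unfolding nn by (intro ennreal_leI e)
      qed
    qed simp
    finally show ?thesis .
  qed
  have int_f: "integrable M (\<lambda>x. (X n x - f x)\<^sup>2) \<and> (LINT x|M. (X n x - f x)\<^sup>2) \<le> e"
    if e: "\<And>m. m \<ge> K \<Longrightarrow> (LINT x|M. (X n x - X m x)\<^sup>2) \<le> e" "e \<ge> 0" for n K e
  proof
    have "(\<integral>\<^sup>+x. ennreal ((X n x - f x)\<^sup>2) \<partial>M) < \<infinity>"
      using le_less_trans[OF Fatou[of K n e, OF e] ennreal_less_top] by simp
    then show i: "integrable M (\<lambda>x. (X n x - f x)\<^sup>2)" by (intro integrableI_nonneg) auto
    have "ennreal (LINT x|M. (X n x - f x)\<^sup>2) \<le> ennreal e"
      using Fatou[of K n e, OF e] nn_integral_eq_integral[OF i] by simp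
    then show "(LINT x|M. (X n x - f x)\<^sup>2) \<le> e" using e(2) by (simp add: ennreal_le_iff)
  qed
  have "(\<lambda>x. X (N 0) x - f x) \<in> L2 M"
    using int_f[of "N 0" "N 0" 1] N[of 0 "N 0"] by (auto simp: L2_def less_imp_le)
  from L2_diff[OF X[of "N 0"] this] have "f \<in> L2 M" by simp
  moreover have "(\<lambda>n. sqrt (LINT x|M. (X n x - f x)\<^sup>2)) \<longlonglongrightarrow> 0"
  proof (rule LIMSEQ_I)
    fix e :: real assume e: "e > 0"
    then obtain K where K: "\<forall>m\<ge>K. \<forall>n\<ge>K. sqrt (LINT x|M. (X m x - X n x)\<^sup>2) < e / 2"
      using Cauchy[of "e / 2"] by auto
    have "norm (sqrt (LINT x|M. (X n x - f x)\<^sup>2) - 0) < e" if "n \<ge> K" for n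
    proof -
      have "(LINT x|M. (X n x - f x)\<^sup>2) \<le> (e / 2)\<^sup>2"
        by (rule int_f[of K n, THEN conjunct2]) (use K that e in \<open>auto intro!: less_imp_le small\<close>)
      then have "sqrt (LINT x|M. (X n x - f x)\<^sup>2) \<le> e / 2" using e by (intro real_le_lsqrt) auto
      then show ?thesis using e by simp
    qed
    then show "\<exists>no. \<forall>n\<ge>no. norm (sqrt (LINT x|M. (X n x - f x)\<^sup>2) - 0) < e" by blast
  qed
  ultimately show ?thesis by blast
qed

section \<open>The ball walk as an operator on $L^2$\<close>

lemma unit_ball_cover: "\<exists>C. finite C \<and> ball (0 :: 'a::euclidean_space) 1 \<subseteq> (\<Union>c\<in>C. ball c (1/4))"
proof -
  have "compact (cball (0 :: 'a) 1)" by simp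
  then obtain C where "finite C" "cball (0 :: 'a) 1 \<subseteq> (\<Union>c\<in>C. ball c (1/4))"
    using compact_eq_totally_bounded[of "cball (0 :: 'a) 1"] by (metis divide_pos_pos zero_less_numeral zero_less_one)
  then show ?thesis using ball_subset_cball by blast
qed

text \<open>One covering is fixed once and rescaled, so the number of balls depends neither on the
  centre nor on h nor on the density. With a quarter of the radius, two points of one small ball are
  at distance less than h/2 and hence are neighbours for the walk.\<close>

definition cover_centers :: "'a::euclidean_space set" where
  "cover_centers = (SOME C. finite C \<and> ball 0 1 \<subseteq> (\<Union>c\<in>C. ball c (1/4)))"

lemma cover_centers:
  shows finite_cover_centers: "finite (cover_centers :: 'a::euclidean_space set)"
    and unit_ball_subset: "ball (0 :: 'a) 1 \<subseteq> (\<Union>c\<in>cover_centers. ball c (1/4))"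
  using someI_ex[OF unit_ball_cover] unfolding cover_centers_def by blast+

lemma ball_subset_cover:
  fixes x :: "'a::euclidean_space"
  assumes h: "h > 0"
  shows "ball x h \<subseteq> (\<Union>c\<in>cover_centers. ball (x + h *\<^sub>R c) (h / 4))"
proof
  fix y assume y: "y \<in> ball x h"
  define z where "z = (1 / h) *\<^sub>R (y - x)"
  have "z \<in> ball 0 1" using y h by (simp add: z_def dist_norm norm_minus_commute)
  then obtain c where c: "c \<in> cover_centers" "dist c z < 1/4"
    using unit_ball_subset by fastforce
  have "x + h *\<^sub>R c - y = h *\<^sub>R (c - z)" using h by (simp add: z_def algebra_simps)
  then have "dist (x + h *\<^sub>R c) y = h * dist c z" using h by (simp add: dist_norm)
  also have "\<dots> < h / 4" using c h by simp
  finally show "y \<in> (\<Union>c\<in>cover_centers. ball (x + h *\<^sub>R c) (h / 4))" using c by auto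
qed

lemma card_cover_centers_pos: "card (cover_centers :: 'a::euclidean_space set) > 0"
  using unit_ball_subset[where 'a='a] finite_cover_centers[where 'a='a]
  by (auto simp: card_gt_0_iff)

text \<open>\<open>N\<close> is a parameter because its type does not mention the dimension.\<close>

locale ball_walk =
  fixes \<rho> :: "real^'n::finite \<Rightarrow> real" and h N :: real
  assumes adm: "admissible_density \<rho>" and h: "h > 0"
    and N_def: "N = real (card (cover_centers :: (real^'n) set))"
begin

abbreviation "m \<equiv> mh \<rho> h"
abbreviation "Z \<equiv> Zh \<rho> h"
abbreviation "nu \<equiv> nuh \<rho> h"
abbreviation "T \<equiv> Th \<rho> h"

text \<open>Relative to this probability measure one step has density \<open>k x y / m x\<close>
  with \<open>k\<close> symmetric, and \<open>nu\<close> has density \<open>m / Z\<close>.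
  Reversibility becomes the symmetry of \<open>k\<close>, and Fubini applies to two copies of
  \<open>mu\<close>.\<close>

definition mu :: "(real^'n) measure" where "mu = density lborel (\<lambda>x. ennreal (\<rho> x))"

definition k :: "real^'n \<Rightarrow> real^'n \<Rightarrow> real" where "k x y = (if dist x y < h then 1 else 0)"

lemma indicator_ball: "indicator (ball x h) y = k x y"
  by (simp add: k_def indicator_def)

lemma k_sym: "k x y = k y x" by (simp add: k_def dist_commute)

lemma k_bounds [simp]: "0 \<le> k x y" "k x y \<le> 1" by (auto simp: k_def)

lemma k_meas [measurable]: "(\<lambda>p. k (f p) (g p)) \<in> borel_measurable M" if "f \<in> borel_measurable M" "g \<in> borel_measurable M"
  using that unfolding k_def by measurable

lemma rho_pos: "\<rho> x > 0" using adm by (simp add: admissible_density_def)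

lemma rho_continuous: "continuous_on UNIV \<rho>"
  using adm unfolding admissible_density_def C1_fun_def
  by (meson continuous_at_imp_continuous_on differentiable_imp_continuous_within)

lemma rho_meas [measurable]: "\<rho> \<in> borel_measurable borel"
  using rho_continuous by (rule borel_measurable_continuous_onI)

lemma sets_mu [simp, measurable_cong]: "sets mu = sets borel" by (simp add: mu_def)

lemma space_mu [simp]: "space mu = UNIV" by (simp add: mu_def)

lemma prob_space_mu: "prob_space mu"
proof
  have "emeasure mu (space mu) = (\<integral>\<^sup>+x. ennreal (\<rho> x) \<partial>lborel)"
    by (simp add: mu_def emeasure_density)
  also have "\<dots> = 1"
    using adm nn_integral_eq_integral[of lborel \<rho>] rho_pos
    by (simp add: admissible_density_def less_imp_le)
  finally show "emeasure mu (space mu) = 1" .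
qed

sublocale mu: prob_space mu by (rule prob_space_mu)

sublocale mu2: pair_prob_space mu mu ..

lemma integral_mu: "f \<in> borel_measurable borel \<Longrightarrow> (LINT x|mu. f x) = (LINT x|lborel. f x * \<rho> x)"
  unfolding mu_def by (subst integral_density) (auto simp: rho_pos less_imp_le mult.commute)

lemma ball_mass_pos:
  assumes "r > 0"
  shows "measure mu (ball x r) > 0"
proof -
  have "emeasure mu (ball x r) \<noteq> 0"
  proof
    assume "emeasure mu (ball x r) = 0"
    then have "(\<integral>\<^sup>+y. ennreal (\<rho> y) * indicator (ball x r) y \<partial>lborel) = 0"
      by (simp add: mu_def emeasure_density)
    then have "AE y in lborel. ennreal (\<rho> y) * indicator (ball x r) y = 0"
      by (subst (asm) nn_integral_0_iff_AE) measurable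
    then have "AE y in lborel. y \<notin> ball x r"
    proof eventually_elim
      case (elim y)
      have "ennreal (\<rho> y) \<noteq> 0" using rho_pos[of y] by simp
      with elim show ?case by (auto simp: indicator_def split: if_splits)
    qed
    then have "emeasure lborel (ball x r) = 0"
      by (subst (asm) AE_iff_measurable[of "ball x r"]) auto
    then show False using assms content_ball_pos[of r x] by (simp add: measure_def)
  qed
  then show ?thesis by (simp add: mu.emeasure_eq_measure zero_less_measure_iff)
qed

lemma m_eq: "m x = measure mu (ball x h)"
proof -
  have "m x = (LINT y|lborel. indicator (ball x h) y * \<rho> y)"
    by (simp add: mh_def set_lebesgue_integral_def)
  also have "\<dots> = (LINT y|mu. indicator (ball x h) y)" by (rule integral_mu[symmetric]) measurable
  finally show ?thesis by simp
qed

lemma m_pos: "m x > 0" by (simp add: m_eq ball_mass_pos h)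

lemma m_le_1: "m x \<le> 1" by (simp add: m_eq)

lemma m_nn: "ennreal (m x) = (\<integral>\<^sup>+y. ennreal (k x y) \<partial>mu)"
proof -
  have "(\<integral>\<^sup>+y. ennreal (k x y) \<partial>mu) = (\<integral>\<^sup>+y. indicator (ball x h) y \<partial>mu)"
    by (intro nn_integral_cong) (simp add: k_def indicator_def)
  then show ?thesis by (simp add: m_eq mu.emeasure_eq_measure)
qed

lemma m_meas [measurable]: "m \<in> borel_measurable borel"
proof -
  have "m = (\<lambda>x. LINT y|mu. k x y)"
    by (rule ext) (simp add: m_eq flip: indicator_ball)
  also have "\<dots> \<in> borel_measurable borel" by measurable
  finally show ?thesis .
qed

lemma m_integrable: "integrable mu m"
  by (rule mu.integrable_const_bound[of _ 1]) (auto simp: m_le_1 less_imp_le[OF m_pos])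

lemma Z_eq: "Z = (LINT x|mu. m x)"
  by (simp add: Zh_def integral_mu)

lemma Z_pos: "Z > 0"
  unfolding Z_eq by (rule mu.integral_less_AE_space[of "\<lambda>x. 0" m, simplified])
     (auto simp: m_integrable m_pos mu.emeasure_space_1[simplified])

lemma Z_nn: "ennreal Z = (\<integral>\<^sup>+x. ennreal (m x) \<partial>mu)"
  unfolding Z_eq by (intro nn_integral_eq_integral[symmetric] m_integrable) (auto simp: less_imp_le[OF m_pos])

lemma nu_eq: "nu = density mu (\<lambda>x. ennreal (m x / Z))"
  unfolding nuh_def mu_def
  by (subst density_density_eq)
     (auto intro!: density_cong simp: ennreal_mult[symmetric] less_imp_le[OF m_pos] less_imp_le[OF rho_pos] less_imp_le[OF Z_pos] mult_ac)

lemma sets_nu [simp, measurable_cong]: "sets nu = sets borel" by (simp add: nu_eq)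

lemma space_nu [simp]: "space nu = UNIV" by (simp add: nu_eq)

lemma nn_integral_nu:
  "f \<in> borel_measurable borel \<Longrightarrow> (\<integral>\<^sup>+x. f x \<partial>nu) = (\<integral>\<^sup>+x. ennreal (m x / Z) * f x \<partial>mu)"
  unfolding nu_eq by (subst nn_integral_density) auto

lemma integral_nu:
  fixes f :: "real^'n \<Rightarrow> real"
  assumes "f \<in> borel_measurable borel"
  shows "(LINT x|nu. f x) = (LINT x|mu. m x * f x) / Z"
  unfolding nu_eq using assms Z_pos m_pos
  by (subst integral_density) (auto simp: less_imp_le)

lemma integrable_nu:
  fixes f :: "real^'n \<Rightarrow> real"
  assumes "f \<in> borel_measurable borel"
  shows "integrable nu f \<longleftrightarrow> integrable mu (\<lambda>x. m x * f x)"
proof -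
  have "integrable nu f \<longleftrightarrow> integrable mu (\<lambda>x. (1 / Z) * (m x * f x))"
    unfolding nu_eq using assms Z_pos m_pos
    by (subst integrable_density) (auto simp: less_imp_le)
  also have "\<dots> \<longleftrightarrow> integrable mu (\<lambda>x. m x * f x)"
    using Z_pos by (subst integrable_mult_left_iff) simp
  finally show ?thesis .
qed

lemma prob_space_nu: "prob_space nu"
proof
  have "emeasure nu (space nu) = (\<integral>\<^sup>+x. 1 \<partial>nu)" by simp
  also have "\<dots> = (\<integral>\<^sup>+x. ennreal (1 / Z) * ennreal (m x) \<partial>mu)"
    by (subst nn_integral_nu) (auto simp: ennreal_mult[symmetric] less_imp_le[OF m_pos] less_imp_le[OF Z_pos])
  also have "\<dots> = ennreal (1 / Z) * ennreal Z"
    by (subst nn_integral_cmult) (auto simp: Z_nn)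
  also have "\<dots> = 1" using Z_pos by (simp add: ennreal_mult[symmetric])
  finally show "emeasure nu (space nu) = 1" .
qed

sublocale nu: prob_space nu by (rule prob_space_nu)

lemma AE_nu: "(AE x in nu. P x) \<longleftrightarrow> (AE x in lborel. P x)"
proof -
  have *: "0 < ennreal (m x * \<rho> x / Z)" for x using m_pos rho_pos Z_pos by simp
  show ?thesis unfolding nuh_def by (subst AE_density) (use * in \<open>auto simp del: ennreal_0\<close>)
qed

lemma AE_mu: "(AE x in mu. P x) \<longleftrightarrow> (AE x in lborel. P x)"
  unfolding mu_def by (subst AE_density) (auto simp: rho_pos)

lemma N_ge_1: "1 \<le> N" using card_cover_centers_pos[where 'a="real^'n"] by (simp add: N_def)

lemma ball_mass_le_m:
  assumes "y \<in> ball c (h / 4)"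
  shows "measure mu (ball c (h / 4)) \<le> m y"
proof -
  have "ball c (h / 4) \<subseteq> ball y h"
  proof
    fix z assume "z \<in> ball c (h / 4)"
    then show "z \<in> ball y h" using assms h dist_triangle[of y z c] by (simp add: dist_commute)
  qed
  then show ?thesis unfolding m_eq by (intro mu.finite_measure_mono) auto
qed

text \<open>A ball of radius $h/4$ lies in $B(y,h)$ for each of its points $y$, so it contributes at most $1$.\<close>

lemma inverse_m_bound: "(\<integral>\<^sup>+y. ennreal (k x y / m y) \<partial>mu) \<le> ennreal N"
proof -
  let ?B = "\<lambda>c. ball (x + h *\<^sub>R c) (h / 4)"
  have "(\<integral>\<^sup>+y. ennreal (k x y / m y) \<partial>mu)
      \<le> (\<integral>\<^sup>+y. (\<Sum>c\<in>cover_centers. ennreal (1 / measure mu (?B c)) * indicator (?B c) y) \<partial>mu)"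
  proof (rule nn_integral_mono)
    fix y
    show "ennreal (k x y / m y) \<le> (\<Sum>c\<in>cover_centers. ennreal (1 / measure mu (?B c)) * indicator (?B c) y)"
    proof (cases "dist x y < h")
      case True
      then obtain c where c: "c \<in> cover_centers" "y \<in> ?B c"
        using ball_subset_cover[OF h, of x] by auto
      have "ennreal (k x y / m y) \<le> ennreal (1 / measure mu (?B c)) * indicator (?B c) y"
        using c True ball_mass_le_m[OF c(2)] ball_mass_pos[of "h / 4" "x + h *\<^sub>R c"] h m_pos[of y]
        by (auto simp: k_def intro!: ennreal_leI divide_left_mono)
      also have "\<dots> \<le> (\<Sum>c\<in>cover_centers. ennreal (1 / measure mu (?B c)) * indicator (?B c) y)"
        by (rule member_le_sum[of c _ "\<lambda>c. ennreal (1 / measure mu (?B c)) * indicator (?B c) y"])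
           (use c finite_cover_centers in auto)
      finally show ?thesis .
    qed (simp add: k_def)
  qed
  also have "\<dots> = (\<Sum>c\<in>cover_centers. ennreal (1 / measure mu (?B c)) * emeasure mu (?B c))"
    by (subst nn_integral_sum) (auto simp: nn_integral_cmult)
  also have "\<dots> = (\<Sum>c\<in>(cover_centers :: (real^'n) set). 1)"
  proof (rule sum.cong)
    fix c :: "real^'n"
    show "ennreal (1 / measure mu (?B c)) * emeasure mu (?B c) = 1"
      using ball_mass_pos[of "h / 4" "x + h *\<^sub>R c"] h
      by (simp add: mu.emeasure_eq_measure ennreal_mult[symmetric])
  qed simp
  finally show ?thesis by (simp add: N_def ennreal_of_nat_eq_real_of_nat)
qed

text \<open>Pigeonhole: one of the N pieces of the covering carries at least m(x)/N of the mass of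
  the ball around x, and any two of its points are neighbours of each other. So triangles through x
  have mass comparable with m(x)^2.\<close>

lemma close_pairs_bound:
  "ennreal ((m x / N)\<^sup>2) \<le> (\<integral>\<^sup>+y. \<integral>\<^sup>+z. ennreal (k x y * k x z * k y z) \<partial>mu \<partial>mu)"
proof -
  let ?A = "\<lambda>c. ball (x + h *\<^sub>R c) (h / 4) \<inter> ball x h"
  have "\<exists>c\<in>cover_centers. m x / N \<le> measure mu (?A c)"
  proof (rule ccontr)
    assume n: "\<not> ?thesis"
    have "m x \<le> measure mu (\<Union>c\<in>cover_centers. ?A c)"
      unfolding m_eq using ball_subset_cover[OF h, of x] finite_cover_centers
      by (intro mu.finite_measure_mono) (blast, auto intro!: borel_open open_Int)
    also have "\<dots> \<le> (\<Sum>c\<in>cover_centers. measure mu (?A c))"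
      using finite_cover_centers by (intro mu.finite_measure_subadditive_finite) auto
    also have "\<dots> < (\<Sum>c\<in>(cover_centers :: (real^'n) set). m x / N)"
      using n finite_cover_centers card_cover_centers_pos[where 'a="real^'n"]
      by (intro sum_strict_mono) (auto simp: not_le)
    also have "\<dots> = m x" using N_ge_1 by (simp add: N_def)
    finally show False by simp
  qed
  then obtain c where c: "m x / N \<le> measure mu (?A c)" by blast
  have "ennreal ((m x / N)\<^sup>2) \<le> ennreal ((measure mu (?A c))\<^sup>2)"
    using c m_pos[of x] N_ge_1 by (intro ennreal_leI power_mono) auto
  also have "\<dots> = emeasure mu (?A c) * emeasure mu (?A c)"
    by (simp add: mu.emeasure_eq_measure power2_eq_square ennreal_mult)
  also have "\<dots> = (\<integral>\<^sup>+y. \<integral>\<^sup>+z. indicator (?A c) y * indicator (?A c) z \<partial>mu \<partial>mu)"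
    by (simp add: nn_integral_cmult nn_integral_multc)
  also have "\<dots> \<le> (\<integral>\<^sup>+y. \<integral>\<^sup>+z. ennreal (k x y * k x z * k y z) \<partial>mu \<partial>mu)"
  proof (intro nn_integral_mono)
    fix y z
    show "indicator (?A c) y * indicator (?A c) z \<le> ennreal (k x y * k x z * k y z)"
    proof (cases "y \<in> ?A c \<and> z \<in> ?A c")
      case True
      then have "dist y z < h" using h dist_triangle[of y z "x + h *\<^sub>R c"] by (simp add: dist_commute)
      with True show ?thesis by (simp add: k_def)
    qed (auto simp: indicator_def)
  qed
  finally show ?thesis .
qed

text \<open>For f in L2(nu) this is 2 Z <(1 + T) f, f>, as \<open>form_lower\<close> makes explicit;
  in \<open>ennreal\<close> it makes sense for every measurable f.\<close>

definition plus_form :: "(real^'n \<Rightarrow> real) \<Rightarrow> ennreal" where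
  "plus_form f = (\<integral>\<^sup>+x. \<integral>\<^sup>+y. ennreal (k x y * (f x + f y)\<^sup>2) \<partial>mu \<partial>mu)"

lemma k_idem: "k x y * k x y = k x y" by (simp add: k_def)

text \<open>Periodicity is excluded by triangles: $2 f(x) = (f(x)+f(y)) - (f(y)+f(z)) + (f(z)+f(x))$.\<close>

lemma triangle_bound:
  assumes [measurable]: "f \<in> borel_measurable borel"
  shows "ennreal (4 / N\<^sup>2) * (\<integral>\<^sup>+x. ennreal (m x * (f x)\<^sup>2) \<partial>mu) \<le> ennreal (3 * (2 + N)) * plus_form f"
proof -
  \<comment> \<open>The weight 1/m(x) turns the mass m(x)^2 of triangles at x into the weight m(x)
    of the stationary measure, and it is the normalization of one step of the walk.\<close>
  define w where "w x y z = k x y * k x z * k y z / m x" for x y z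
  have w0: "0 \<le> w x y z" for x y z using m_pos[of x] by (simp add: w_def)
  have [measurable]: "(\<lambda>p. w (a p) (b p) (c p)) \<in> borel_measurable M"
    if "a \<in> borel_measurable M" "b \<in> borel_measurable M" "c \<in> borel_measurable M" for a b c and M :: "'z measure"
    using that unfolding w_def by measurable
  have one: "(\<integral>\<^sup>+z. ennreal (k x z / m x) \<partial>mu) = 1" for x
  proof -
    have "(\<integral>\<^sup>+z. ennreal (k x z / m x) \<partial>mu) = (\<integral>\<^sup>+z. ennreal (1 / m x) * ennreal (k x z) \<partial>mu)"
      using m_pos[of x] by (intro nn_integral_cong) (simp add: ennreal_mult[symmetric] less_imp_le)
    also have "\<dots> = ennreal (1 / m x) * ennreal (m x)" by (subst nn_integral_cmult) (auto simp: m_nn)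
    also have "\<dots> = 1" using m_pos[of x] by (simp add: ennreal_mult[symmetric])
    finally show ?thesis .
  qed
  have lower: "ennreal (4 / N\<^sup>2) * (\<integral>\<^sup>+x. ennreal (m x * (f x)\<^sup>2) \<partial>mu)
      \<le> (\<integral>\<^sup>+x. \<integral>\<^sup>+y. \<integral>\<^sup>+z. ennreal (w x y z * (4 * (f x)\<^sup>2)) \<partial>mu \<partial>mu \<partial>mu)"
  proof -
    have "ennreal (4 / N\<^sup>2) * (\<integral>\<^sup>+x. ennreal (m x * (f x)\<^sup>2) \<partial>mu) = (\<integral>\<^sup>+x. ennreal (4 * (f x)\<^sup>2 / m x) * ennreal ((m x / N)\<^sup>2) \<partial>mu)"
    proof (subst nn_integral_cmult[symmetric], measurable, rule nn_integral_cong)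
      fix x
      have "4 / N\<^sup>2 * (m x * (f x)\<^sup>2) = 4 * (f x)\<^sup>2 / m x * (m x / N)\<^sup>2"
        using m_pos[of x] N_ge_1 by (simp add: power2_eq_square field_simps)
      moreover have "0 \<le> 4 / N\<^sup>2" "0 \<le> 4 * (f x)\<^sup>2 / m x" using m_pos[of x] by auto
      ultimately show "ennreal (4 / N\<^sup>2) * ennreal (m x * (f x)\<^sup>2) = ennreal (4 * (f x)\<^sup>2 / m x) * ennreal ((m x / N)\<^sup>2)"
        by (metis ennreal_mult')
    qed
    also have "\<dots> \<le> (\<integral>\<^sup>+x. ennreal (4 * (f x)\<^sup>2 / m x) * (\<integral>\<^sup>+y. \<integral>\<^sup>+z. ennreal (k x y * k x z * k y z) \<partial>mu \<partial>mu) \<partial>mu)"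
      by (intro nn_integral_mono mult_left_mono close_pairs_bound) auto
    also have "\<dots> = (\<integral>\<^sup>+x. \<integral>\<^sup>+y. \<integral>\<^sup>+z. ennreal (4 * (f x)\<^sup>2 / m x) * ennreal (k x y * k x z * k y z) \<partial>mu \<partial>mu \<partial>mu)"
      by (simp add: nn_integral_cmult)
    also have "\<dots> = (\<integral>\<^sup>+x. \<integral>\<^sup>+y. \<integral>\<^sup>+z. ennreal (w x y z * (4 * (f x)\<^sup>2)) \<partial>mu \<partial>mu \<partial>mu)"
      using m_pos by (intro nn_integral_cong) (simp add: ennreal_mult[symmetric] less_imp_le w_def mult_ac)
    finally show ?thesis .
  qed
  have split: "ennreal (w x y z * (4 * (f x)\<^sup>2)) \<le> ennreal 3 *
      (ennreal (k x y * (f x + f y)\<^sup>2) * ennreal (k x z / m x)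
       + ennreal (k x y / m x) * ennreal (k y z * (f y + f z)\<^sup>2)
       + ennreal (k x y / m x) * ennreal (k x z * (f x + f z)\<^sup>2))" for x y z
  proof -
    have sq: "(2 * f x)\<^sup>2 \<le> 3 * ((f x + f y)\<^sup>2 + (f y + f z)\<^sup>2 + (f x + f z)\<^sup>2)"
    proof -
      have "3 * (A\<^sup>2 + B\<^sup>2 + C\<^sup>2) - (A - B + C)\<^sup>2 = (A + B)\<^sup>2 + (B + C)\<^sup>2 + (A - C)\<^sup>2" for A B C :: real
        by (simp add: power2_eq_square algebra_simps)
      then have "0 \<le> 3 * (A\<^sup>2 + B\<^sup>2 + C\<^sup>2) - (A - B + C)\<^sup>2" for A B C :: real by simp
      from this[of "f x + f y" "f y + f z" "f x + f z"] show ?thesis by simp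
    qed
    have "w x y z * (4 * (f x)\<^sup>2) \<le> w x y z * (3 * ((f x + f y)\<^sup>2 + (f y + f z)\<^sup>2 + (f x + f z)\<^sup>2))"
      using sq w0[of x y z] by (intro mult_left_mono) (auto simp: power_mult_distrib)
    also have "\<dots> \<le> 3 * ((k x y * (f x + f y)\<^sup>2) * (k x z / m x)
       + (k x y / m x) * (k y z * (f y + f z)\<^sup>2)
       + (k x y / m x) * (k x z * (f x + f z)\<^sup>2))"
      using m_pos[of x] by (auto simp: w_def k_def algebra_simps add_divide_distrib)
    finally have "w x y z * (4 * (f x)\<^sup>2) \<le> \<dots>" .
    then have "ennreal (w x y z * (4 * (f x)\<^sup>2)) \<le> ennreal (3 * ((k x y * (f x + f y)\<^sup>2) * (k x z / m x)
       + (k x y / m x) * (k y z * (f y + f z)\<^sup>2)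
       + (k x y / m x) * (k x z * (f x + f z)\<^sup>2)))" by (rule ennreal_leI)
    also have "\<dots> = ennreal 3 *
      (ennreal (k x y * (f x + f y)\<^sup>2) * ennreal (k x z / m x)
       + ennreal (k x y / m x) * ennreal (k y z * (f y + f z)\<^sup>2)
       + ennreal (k x y / m x) * ennreal (k x z * (f x + f z)\<^sup>2))"
    proof -
      have e: "ennreal (3 * (A * a + b * B + b * C)) = ennreal 3 * (ennreal A * ennreal a + ennreal b * ennreal B + ennreal b * ennreal C)"
        if "0 \<le> A" "0 \<le> B" "0 \<le> C" "0 \<le> a" "0 \<le> b" for A B C a b :: real
        using that by (simp add: ennreal_mult)
      show ?thesis using m_pos[of x] by (intro e) (auto simp: less_imp_le)
    qed
    finally show ?thesis .
  qed
  \<comment> \<open>For an edge containing x the other integration is over a step from x and gives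
    exactly 1. For the edge from y to z what remains is the integral of \<open>k x y / m x\<close>
    over x, bounded by N. Hence the total 3 (1 + N + 1).\<close>
  have A: "(\<integral>\<^sup>+x. \<integral>\<^sup>+y. \<integral>\<^sup>+z. ennreal (k x y * (f x + f y)\<^sup>2) * ennreal (k x z / m x) \<partial>mu \<partial>mu \<partial>mu) = plus_form f"
    by (simp add: nn_integral_cmult one plus_form_def)
  have C: "(\<integral>\<^sup>+x. \<integral>\<^sup>+y. \<integral>\<^sup>+z. ennreal (k x y / m x) * ennreal (k x z * (f x + f z)\<^sup>2) \<partial>mu \<partial>mu \<partial>mu) = plus_form f"
    by (simp add: nn_integral_cmult nn_integral_multc one plus_form_def)
  have "(\<integral>\<^sup>+x. \<integral>\<^sup>+y. \<integral>\<^sup>+z. ennreal (k x y / m x) * ennreal (k y z * (f y + f z)\<^sup>2) \<partial>mu \<partial>mu \<partial>mu)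
      = (\<integral>\<^sup>+x. \<integral>\<^sup>+y. ennreal (k x y / m x) * (\<integral>\<^sup>+z. ennreal (k y z * (f y + f z)\<^sup>2) \<partial>mu) \<partial>mu \<partial>mu)"
    by (simp add: nn_integral_cmult)
  also have "\<dots> = (\<integral>\<^sup>+y. \<integral>\<^sup>+x. ennreal (k x y / m x) * (\<integral>\<^sup>+z. ennreal (k y z * (f y + f z)\<^sup>2) \<partial>mu) \<partial>mu \<partial>mu)"
    by (rule mu2.Fubini') measurable
  also have "\<dots> = (\<integral>\<^sup>+y. (\<integral>\<^sup>+x. ennreal (k y x / m x) \<partial>mu) * (\<integral>\<^sup>+z. ennreal (k y z * (f y + f z)\<^sup>2) \<partial>mu) \<partial>mu)"
    by (simp add: nn_integral_multc k_sym)
  also have "\<dots> \<le> (\<integral>\<^sup>+y. ennreal N * (\<integral>\<^sup>+z. ennreal (k y z * (f y + f z)\<^sup>2) \<partial>mu) \<partial>mu)"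
    by (intro nn_integral_mono mult_right_mono inverse_m_bound) auto
  also have "\<dots> = ennreal N * plus_form f" by (simp add: nn_integral_cmult plus_form_def)
  finally have B: "(\<integral>\<^sup>+x. \<integral>\<^sup>+y. \<integral>\<^sup>+z. ennreal (k x y / m x) * ennreal (k y z * (f y + f z)\<^sup>2) \<partial>mu \<partial>mu \<partial>mu) \<le> ennreal N * plus_form f" .
  have "(\<integral>\<^sup>+x. \<integral>\<^sup>+y. \<integral>\<^sup>+z. ennreal (w x y z * (4 * (f x)\<^sup>2)) \<partial>mu \<partial>mu \<partial>mu) \<le>
      (\<integral>\<^sup>+x. \<integral>\<^sup>+y. \<integral>\<^sup>+z. ennreal 3 * (ennreal (k x y * (f x + f y)\<^sup>2) * ennreal (k x z / m x)
       + ennreal (k x y / m x) * ennreal (k y z * (f y + f z)\<^sup>2)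
       + ennreal (k x y / m x) * ennreal (k x z * (f x + f z)\<^sup>2)) \<partial>mu \<partial>mu \<partial>mu)"
    by (intro nn_integral_mono split)
  also have "\<dots> = ennreal 3 * (plus_form f +
      (\<integral>\<^sup>+x. \<integral>\<^sup>+y. \<integral>\<^sup>+z. ennreal (k x y / m x) * ennreal (k y z * (f y + f z)\<^sup>2) \<partial>mu \<partial>mu \<partial>mu) + plus_form f)"
    unfolding A[symmetric] by (subst C[unfolded A[symmetric], symmetric]) (simp add: nn_integral_cmult nn_integral_add)
  also have "\<dots> \<le> ennreal 3 * (plus_form f + ennreal N * plus_form f + plus_form f)"
    by (intro mult_left_mono add_mono B) auto
  also have "\<dots> = ennreal (3 * (2 + N)) * plus_form f"
  proof -
    have "plus_form f + ennreal N * plus_form f + plus_form f = (ennreal 1 + ennreal N + ennreal 1) * plus_form f"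
      by (simp add: distrib_right)
    also have "ennreal 1 + ennreal N + ennreal 1 = ennreal (1 + N + 1)"
    proof -
      have "ennreal (1 + N + 1) = ennreal (1 + N) + ennreal 1" using N_ge_1 by (intro ennreal_plus) auto
      also have "ennreal (1 + N) = ennreal 1 + ennreal N" using N_ge_1 by (intro ennreal_plus) auto
      finally show ?thesis by (rule sym)
    qed
    also have "1 + N + 1 = 2 + N" by simp
    finally have e: "plus_form f + ennreal N * plus_form f + plus_form f = ennreal (2 + N) * plus_form f" .
    have "ennreal (3 * (2 + N)) = ennreal 3 * ennreal (2 + N)" using N_ge_1 by (intro ennreal_mult) auto
    then show ?thesis unfolding e by (simp only: mult.assoc)
  qed
  finally show ?thesis using lower by (rule order_trans[rotated])
qed

section \<open>Contractivity and symmetry of the walk\<close>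

lemma Th_eq: "f \<in> borel_measurable borel \<Longrightarrow> T f x = (LINT y|mu. k x y * f y) / m x"
proof -
  assume [measurable]: "f \<in> borel_measurable borel"
  have "(LINT y|mu. k x y * f y) = (LINT y|lborel. k x y * f y * \<rho> y)"
    by (rule integral_mu) measurable
  then show ?thesis
    by (simp add: Th_def set_lebesgue_integral_def indicator_ball mult.assoc)
qed

lemma Th_meas [measurable (raw)]: "f \<in> borel_measurable borel \<Longrightarrow> T f \<in> borel_measurable borel"
proof -
  assume f [measurable]: "f \<in> borel_measurable borel"
  have "T f = (\<lambda>x. (LINT y|mu. k x y * f y) / m x)" by (rule ext) (rule Th_eq[OF f])
  also have "\<dots> \<in> borel_measurable borel" by measurable
  finally show ?thesis .
qed

lemma L2_nu_iff: "f \<in> L2 nu \<longleftrightarrow> f \<in> borel_measurable borel \<and> integrable mu (\<lambda>x. m x * (f x)\<^sup>2)"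
proof -
  have "f \<in> borel_measurable nu \<longleftrightarrow> f \<in> borel_measurable borel"
    by (rule arg_cong[where f="\<lambda>S. f \<in> S"]) (rule measurable_cong_sets, auto)
  then show ?thesis using integrable_nu[of "\<lambda>x. (f x)\<^sup>2"] by (auto simp: L2_def)
qed

lemma L2_meas: "f \<in> L2 nu \<Longrightarrow> f \<in> borel_measurable borel" by (simp add: L2_nu_iff)

text \<open>Z times the squared norm in L2(nu); the normalization stays out of the
  estimates.\<close>

definition sq :: "(real^'n \<Rightarrow> real) \<Rightarrow> real" where "sq f = (LINT x|mu. m x * (f x)\<^sup>2)"

lemma sq_nonneg [simp]: "0 \<le> sq f"
  unfolding sq_def by (intro integral_nonneg_AE AE_I2) (simp add: less_imp_le[OF m_pos])

lemma sq_nn: "f \<in> L2 nu \<Longrightarrow> (\<integral>\<^sup>+x. ennreal (m x * (f x)\<^sup>2) \<partial>mu) = ennreal (sq f)"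
  unfolding sq_def by (intro nn_integral_eq_integral) (auto simp: L2_nu_iff less_imp_le[OF m_pos])

text \<open>Write k |f| = (k / sqrt m)(sqrt m |f|): Cauchy-Schwarz and
  \<open>inverse_m_bound\<close> control the first factor, \<open>sq f\<close> the second. So T f is
  given by a convergent integral at every point, as pointwise bounds on the kernel require.\<close>

lemma local_integrable:
  assumes f: "f \<in> L2 nu"
  shows "integrable mu (\<lambda>y. k x y * f y)" and "(LINT y|mu. k x y * \<bar>f y\<bar>)\<^sup>2 \<le> N * sq f"
proof -
  note [measurable] = L2_meas[OF f]
  have "(\<integral>\<^sup>+y. ennreal (k x y * \<bar>f y\<bar>) \<partial>mu)\<^sup>2
      = (\<integral>\<^sup>+y. ennreal (k x y / sqrt (m y)) * ennreal (sqrt (m y) * \<bar>f y\<bar>) \<partial>mu)\<^sup>2"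
    using m_pos by (intro arg_cong[where f="\<lambda>t. t\<^sup>2"] nn_integral_cong) (simp add: ennreal_mult[symmetric] less_imp_le less_imp_neq[symmetric])
  also have "\<dots> \<le> (\<integral>\<^sup>+y. (ennreal (k x y / sqrt (m y)))\<^sup>2 \<partial>mu) * (\<integral>\<^sup>+y. (ennreal (sqrt (m y) * \<bar>f y\<bar>))\<^sup>2 \<partial>mu)"
    by (rule Cauchy_Schwarz_nn_integral) measurable
  also have "(\<integral>\<^sup>+y. (ennreal (k x y / sqrt (m y)))\<^sup>2 \<partial>mu) = (\<integral>\<^sup>+y. ennreal (k x y / m y) \<partial>mu)"
    using m_pos by (intro nn_integral_cong) (simp add: ennreal_power power_divide less_imp_le, simp add: power2_eq_square k_idem)
  also have "(\<integral>\<^sup>+y. (ennreal (sqrt (m y) * \<bar>f y\<bar>))\<^sup>2 \<partial>mu) = (\<integral>\<^sup>+y. ennreal (m y * (f y)\<^sup>2) \<partial>mu)"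
    using m_pos by (intro nn_integral_cong) (simp add: ennreal_power power_mult_distrib less_imp_le)
  also have "\<dots> = ennreal (sq f)" by (rule sq_nn[OF f])
  also have "(\<integral>\<^sup>+y. ennreal (k x y / m y) \<partial>mu) * ennreal (sq f) \<le> ennreal N * ennreal (sq f)"
    by (intro mult_right_mono inverse_m_bound) auto
  finally have "(\<integral>\<^sup>+y. ennreal (k x y * \<bar>f y\<bar>) \<partial>mu)\<^sup>2 \<le> ennreal N * ennreal (sq f)" .
  also have "ennreal N * ennreal (sq f) = ennreal (N * sq f)"
    using N_ge_1 by (intro ennreal_mult'[symmetric]) simp
  finally have bd: "(\<integral>\<^sup>+y. ennreal (k x y * \<bar>f y\<bar>) \<partial>mu)\<^sup>2 \<le> ennreal (N * sq f)" .
  have "(\<integral>\<^sup>+y. ennreal (k x y * \<bar>f y\<bar>) \<partial>mu)\<^sup>2 < \<infinity>" using le_less_trans[OF bd] by simp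
  then have fin: "(\<integral>\<^sup>+y. ennreal (k x y * \<bar>f y\<bar>) \<partial>mu) < \<infinity>"
    by (auto simp: power2_eq_square ennreal_mult_less_top less_top[symmetric] top_unique)
  have int: "integrable mu (\<lambda>y. k x y * \<bar>f y\<bar>)"
    by (rule integrableI_nonneg) (use fin in auto)
  then show "integrable mu (\<lambda>y. k x y * f y)"
    by (rule Bochner_Integration.integrable_bound) (measurable, auto simp: abs_mult)
  have "ennreal ((LINT y|mu. k x y * \<bar>f y\<bar>)\<^sup>2) = (\<integral>\<^sup>+y. ennreal (k x y * \<bar>f y\<bar>) \<partial>mu)\<^sup>2"
    using nn_integral_eq_integral[OF int] by (simp add: ennreal_power integral_nonneg_AE)
  then show "(LINT y|mu. k x y * \<bar>f y\<bar>)\<^sup>2 \<le> N * sq f"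
  proof -
    assume "ennreal ((LINT y|mu. k x y * \<bar>f y\<bar>)\<^sup>2) = (\<integral>\<^sup>+y. ennreal (k x y * \<bar>f y\<bar>) \<partial>mu)\<^sup>2"
    then have "ennreal ((LINT y|mu. k x y * \<bar>f y\<bar>)\<^sup>2) \<le> ennreal (N * sq f)" using bd by simp
    moreover have "0 \<le> N * sq f" using N_ge_1 by simp
    ultimately show ?thesis by (simp only: ennreal_le_iff)
  qed
qed

lemma Th_pointwise_bound:
  assumes f: "f \<in> L2 nu"
  shows "\<bar>T f x\<bar> \<le> sqrt (N * sq f) / m x"
proof -
  have "\<bar>LINT y|mu. k x y * f y\<bar> \<le> (LINT y|mu. k x y * \<bar>f y\<bar>)"
    using integral_norm_bound[of mu "\<lambda>y. k x y * f y"] by (simp add: abs_mult)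
  also have "\<dots> \<le> sqrt (N * sq f)"
    by (rule real_le_rsqrt) (rule local_integrable(2)[OF f])
  finally show ?thesis using m_pos[of x] by (simp add: Th_eq L2_meas[OF f] divide_right_mono less_imp_le)
qed

lemma Th_add:
  assumes f: "f \<in> L2 nu" and g: "g \<in> L2 nu"
  shows "T (f + g) = T f + T g"
proof
  fix x
  note [measurable] = L2_meas[OF f] L2_meas[OF g]
  have "T (\<lambda>x. f x + g x) x = (LINT y|mu. k x y * f y + k x y * g y) / m x"
    by (subst Th_eq) (measurable, simp add: distrib_left)
  also have "\<dots> = T f x + T g x"
    using local_integrable(1)[OF f] local_integrable(1)[OF g]
    by (simp add: Th_eq L2_meas[OF f] L2_meas[OF g] add_divide_distrib)
  finally show "T (f + g) x = (T f + T g) x" by (simp add: plus_fun_def)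
qed

lemma Th_scale:
  assumes f: "f \<in> L2 nu"
  shows "T (a *\<^sub>R f) = a *\<^sub>R T f"
proof
  fix x
  note [measurable] = L2_meas[OF f]
  have "T (\<lambda>x. a * f x) x = (LINT y|mu. a * (k x y * f y)) / m x"
    by (subst Th_eq) (measurable, simp add: mult.left_commute)
  also have "\<dots> = a * T f x" by (simp add: Th_eq L2_meas[OF f])
  finally show "T (a *\<^sub>R f) x = (a *\<^sub>R T f) x" by (simp add: scaleR_fun_def)
qed

text \<open>Pointwise Jensen, m(x) (T f x)^2 \<le> \<integral> k(x,y) f(y)^2 d\<open>mu\<close>(y),
  is integrated over x; by symmetry of \<open>k\<close> the right side becomes
  \<open>sq f\<close>.\<close>

lemma Th_sq_le:
  assumes f: "f \<in> L2 nu"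
  shows "T f \<in> L2 nu" and "sq (T f) \<le> sq f"
proof -
  note [measurable] = L2_meas[OF f]
  have pt: "ennreal (m x * (T f x)\<^sup>2) \<le> (\<integral>\<^sup>+y. ennreal (k x y * (f y)\<^sup>2) \<partial>mu)" for x
  proof -
    define I where "I = (LINT y|mu. k x y * \<bar>f y\<bar>)"
    have int: "integrable mu (\<lambda>y. k x y * \<bar>f y\<bar>)"
      using integrable_abs[OF local_integrable(1)[OF f, of x]] by (simp add: abs_mult)
    have I0: "0 \<le> I" unfolding I_def by (intro integral_nonneg_AE AE_I2) simp
    have "\<bar>LINT y|mu. k x y * f y\<bar> \<le> I"
      using integral_norm_bound[of mu "\<lambda>y. k x y * f y"] by (simp add: abs_mult I_def)
    then have "(LINT y|mu. k x y * f y)\<^sup>2 \<le> I\<^sup>2"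
      using I0 by (simp add: abs_le_square_iff[symmetric])
    then have "m x * (T f x)\<^sup>2 \<le> I\<^sup>2 / m x"
      using m_pos[of x] by (simp add: Th_eq power_divide power2_eq_square[of "m x"] divide_right_mono less_imp_le)
    then have "ennreal (m x * (T f x)\<^sup>2) \<le> ennreal (1 / m x) * ennreal I ^ 2"
      using m_pos[of x] I0 by (simp add: ennreal_power ennreal_mult[symmetric] ennreal_leI less_imp_le)
    \<comment> \<open>Since \<open>k\<close> takes the values 0 and 1, one copy can be split off;
      Cauchy-Schwarz then produces the factor m(x) that cancels the normalization.\<close>
    also have "ennreal I = (\<integral>\<^sup>+y. ennreal (k x y) * ennreal (k x y * \<bar>f y\<bar>) \<partial>mu)"
      unfolding I_def using nn_integral_eq_integral[OF int]
      by (simp add: ennreal_mult[symmetric] mult.assoc[symmetric] k_idem)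
    also have "\<dots>\<^sup>2 \<le> (\<integral>\<^sup>+y. (ennreal (k x y))\<^sup>2 \<partial>mu) * (\<integral>\<^sup>+y. (ennreal (k x y * \<bar>f y\<bar>))\<^sup>2 \<partial>mu)"
      by (rule Cauchy_Schwarz_nn_integral) measurable
    also have "(\<integral>\<^sup>+y. (ennreal (k x y))\<^sup>2 \<partial>mu) = ennreal (m x)"
      unfolding m_nn by (intro nn_integral_cong) (simp add: k_def)
    also have "(\<integral>\<^sup>+y. (ennreal (k x y * \<bar>f y\<bar>))\<^sup>2 \<partial>mu) = (\<integral>\<^sup>+y. ennreal (k x y * (f y)\<^sup>2) \<partial>mu)"
      by (intro nn_integral_cong) (simp add: ennreal_power power_mult_distrib, simp add: power2_eq_square k_idem)
    finally have "ennreal (m x * (T f x)\<^sup>2) \<le> ennreal (1 / m x) * (ennreal (m x) * (\<integral>\<^sup>+y. ennreal (k x y * (f y)\<^sup>2) \<partial>mu))"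
      by (simp add: mult_left_mono)
    also have "\<dots> = (\<integral>\<^sup>+y. ennreal (k x y * (f y)\<^sup>2) \<partial>mu)"
      using m_pos[of x] by (simp add: mult.assoc[symmetric] ennreal_mult[symmetric])
    finally show ?thesis .
  qed
  have "(\<integral>\<^sup>+x. ennreal (m x * (T f x)\<^sup>2) \<partial>mu) \<le> (\<integral>\<^sup>+x. \<integral>\<^sup>+y. ennreal (k x y * (f y)\<^sup>2) \<partial>mu \<partial>mu)"
    by (intro nn_integral_mono pt)
  also have "\<dots> = (\<integral>\<^sup>+y. \<integral>\<^sup>+x. ennreal (k x y * (f y)\<^sup>2) \<partial>mu \<partial>mu)"
    by (rule mu2.Fubini') measurable
  also have "\<dots> = (\<integral>\<^sup>+y. ennreal (m y * (f y)\<^sup>2) \<partial>mu)"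
  proof (rule nn_integral_cong)
    fix y
    have "(\<integral>\<^sup>+x. ennreal (k x y * (f y)\<^sup>2) \<partial>mu) = (\<integral>\<^sup>+x. ennreal (k y x) * ennreal ((f y)\<^sup>2) \<partial>mu)"
      by (intro nn_integral_cong) (simp add: ennreal_mult k_sym[of y])
    then show "(\<integral>\<^sup>+x. ennreal (k x y * (f y)\<^sup>2) \<partial>mu) = ennreal (m y * (f y)\<^sup>2)"
      by (simp add: nn_integral_multc m_nn[symmetric] ennreal_mult less_imp_le[OF m_pos])
  qed
  finally have le: "(\<integral>\<^sup>+x. ennreal (m x * (T f x)\<^sup>2) \<partial>mu) \<le> ennreal (sq f)" unfolding sq_nn[OF f] .
  have "integrable mu (\<lambda>x. m x * (T f x)\<^sup>2)"
    by (rule integrableI_nonneg) (use le_less_trans[OF le] in \<open>auto simp: less_imp_le[OF m_pos]\<close>)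
  then show L2: "T f \<in> L2 nu" by (simp add: L2_nu_iff)
  show "sq (T f) \<le> sq f" using le unfolding sq_nn[OF L2] by (simp add: ennreal_le_iff)
qed

lemma pair_integrable_sq:
  assumes f: "f \<in> L2 nu"
  shows "integrable (mu \<Otimes>\<^sub>M mu) (\<lambda>p. k (fst p) (snd p) * (f (fst p))\<^sup>2)"
    and "(LINT p|(mu \<Otimes>\<^sub>M mu). k (fst p) (snd p) * (f (fst p))\<^sup>2) = sq f"
proof -
  note [measurable] = L2_meas[OF f]
  have "(\<integral>\<^sup>+p. ennreal (k (fst p) (snd p) * (f (fst p))\<^sup>2) \<partial>(mu \<Otimes>\<^sub>M mu))
      = (\<integral>\<^sup>+x. \<integral>\<^sup>+y. ennreal (k x y * (f x)\<^sup>2) \<partial>mu \<partial>mu)"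
    by (subst mu.nn_integral_fst[symmetric]) auto
  also have "\<dots> = (\<integral>\<^sup>+x. ennreal (m x * (f x)\<^sup>2) \<partial>mu)"
    by (simp add: ennreal_mult nn_integral_multc m_nn less_imp_le[OF m_pos])
  also have "\<dots> = ennreal (sq f)" by (rule sq_nn[OF f])
  finally have nn: "(\<integral>\<^sup>+p. ennreal (k (fst p) (snd p) * (f (fst p))\<^sup>2) \<partial>(mu \<Otimes>\<^sub>M mu)) = ennreal (sq f)" .
  show i: "integrable (mu \<Otimes>\<^sub>M mu) (\<lambda>p. k (fst p) (snd p) * (f (fst p))\<^sup>2)"
    by (rule integrableI_nonneg) (use nn in auto)
  have "ennreal (LINT p|(mu \<Otimes>\<^sub>M mu). k (fst p) (snd p) * (f (fst p))\<^sup>2) = ennreal (sq f)"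
    unfolding nn[symmetric] by (rule nn_integral_eq_integral[OF i, symmetric]) simp
  moreover have "0 \<le> (LINT p|(mu \<Otimes>\<^sub>M mu). k (fst p) (snd p) * (f (fst p))\<^sup>2)"
    by (intro integral_nonneg_AE AE_I2) simp
  ultimately show "(LINT p|(mu \<Otimes>\<^sub>M mu). k (fst p) (snd p) * (f (fst p))\<^sup>2) = sq f" by simp
qed

lemma pair_swap:
  fixes F :: "(real^'n) \<times> (real^'n) \<Rightarrow> real"
  assumes [measurable]: "F \<in> borel_measurable (mu \<Otimes>\<^sub>M mu)"
  shows "integrable (mu \<Otimes>\<^sub>M mu) (\<lambda>p. F (snd p, fst p)) \<longleftrightarrow> integrable (mu \<Otimes>\<^sub>M mu) F"
    and "(LINT p|(mu \<Otimes>\<^sub>M mu). F (snd p, fst p)) = (LINT p|(mu \<Otimes>\<^sub>M mu). F p)"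
  using mu2.integrable_product_swap_iff[of F] mu2.integral_product_swap[of F] assms
  by (simp_all add: case_prod_beta')

lemma pair_integrable_sq2:
  assumes f: "f \<in> L2 nu"
  shows "integrable (mu \<Otimes>\<^sub>M mu) (\<lambda>p. k (fst p) (snd p) * (f (snd p))\<^sup>2)"
    and "(LINT p|(mu \<Otimes>\<^sub>M mu). k (fst p) (snd p) * (f (snd p))\<^sup>2) = sq f"
proof -
  note [measurable] = L2_meas[OF f]
  have [measurable]: "(\<lambda>p. k (fst p) (snd p) * (f (fst p))\<^sup>2) \<in> borel_measurable (mu \<Otimes>\<^sub>M mu)" by measurable
  show "integrable (mu \<Otimes>\<^sub>M mu) (\<lambda>p. k (fst p) (snd p) * (f (snd p))\<^sup>2)"
    using pair_swap(1)[of "\<lambda>p. k (fst p) (snd p) * (f (fst p))\<^sup>2"] pair_integrable_sq(1)[OF f]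
    by (simp add: k_def dist_commute)
  show "(LINT p|(mu \<Otimes>\<^sub>M mu). k (fst p) (snd p) * (f (snd p))\<^sup>2) = sq f"
    using pair_swap(2)[of "\<lambda>p. k (fst p) (snd p) * (f (fst p))\<^sup>2"] pair_integrable_sq(2)[OF f]
    by (simp add: k_def dist_commute)
qed

text \<open>Z <T f, g> written as an integral over pairs, where self-adjointness of T is invariance
  under exchanging the two points.\<close>

definition form :: "(real^'n \<Rightarrow> real) \<Rightarrow> (real^'n \<Rightarrow> real) \<Rightarrow> real" where
  "form f g = (LINT p|(mu \<Otimes>\<^sub>M mu). k (fst p) (snd p) * f (fst p) * g (snd p))"

lemma pair_integrable:
  assumes f: "f \<in> L2 nu" and g: "g \<in> L2 nu"
  shows "integrable (mu \<Otimes>\<^sub>M mu) (\<lambda>p. k (fst p) (snd p) * f (fst p) * g (snd p))"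
proof (rule Bochner_Integration.integrable_bound)
  note [measurable] = L2_meas[OF f] L2_meas[OF g]
  show "integrable (mu \<Otimes>\<^sub>M mu) (\<lambda>p. k (fst p) (snd p) * (f (fst p))\<^sup>2 + k (fst p) (snd p) * (g (snd p))\<^sup>2)"
    by (intro Bochner_Integration.integrable_add pair_integrable_sq(1)[OF f] pair_integrable_sq2(1)[OF g])
  show "(\<lambda>p. k (fst p) (snd p) * f (fst p) * g (snd p)) \<in> borel_measurable (mu \<Otimes>\<^sub>M mu)" by measurable
  have "\<bar>a * b\<bar> \<le> a\<^sup>2 + b\<^sup>2" for a b :: real
  proof -
    have "2 * \<bar>a\<bar> * \<bar>b\<bar> \<le> a\<^sup>2 + b\<^sup>2" using sum_squares_bound[of "\<bar>a\<bar>" "\<bar>b\<bar>"] by simp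
    moreover have "0 \<le> \<bar>a\<bar> * \<bar>b\<bar>" by simp
    ultimately show ?thesis unfolding abs_mult by linarith
  qed
  then show "AE p in mu \<Otimes>\<^sub>M mu. norm (k (fst p) (snd p) * f (fst p) * g (snd p))
      \<le> norm (k (fst p) (snd p) * (f (fst p))\<^sup>2 + k (fst p) (snd p) * (g (snd p))\<^sup>2)"
    by (intro AE_I2) (simp add: k_def abs_mult)
qed

lemma form_sym:
  assumes f: "f \<in> L2 nu" and g: "g \<in> L2 nu"
  shows "form f g = form g f"
proof -
  note [measurable] = L2_meas[OF f] L2_meas[OF g]
  have "form f g = (LINT p|(mu \<Otimes>\<^sub>M mu). k (snd p) (fst p) * f (snd p) * g (fst p))"
    unfolding form_def
    using pair_swap(2)[of "\<lambda>p. k (fst p) (snd p) * f (fst p) * g (snd p)"] by simp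
  also have "\<dots> = form g f"
    unfolding form_def by (intro Bochner_Integration.integral_cong refl) (simp add: k_def dist_commute)
  finally show ?thesis .
qed

lemma form_eq:
  assumes f: "f \<in> L2 nu" and g: "g \<in> L2 nu"
  shows "form f g = (LINT x|mu. m x * (f x * T g x))"
proof -
  have "form f g = (LINT x|mu. LINT y|mu. k x y * f x * g y)"
    unfolding form_def using mu2.integral_fst'[OF pair_integrable[OF f g]] by simp
  also have "\<dots> = (LINT x|mu. f x * (LINT y|mu. k x y * g y))"
    by (intro Bochner_Integration.integral_cong refl) (simp add: mult.assoc mult.left_commute)
  also have "\<dots> = (LINT x|mu. m x * (f x * T g x))"
    using m_pos by (intro Bochner_Integration.integral_cong refl) (simp add: Th_eq L2_meas[OF g] less_imp_neq[symmetric])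
  finally show ?thesis .
qed

text \<open>The parameter is used with c = -1, the Dirichlet form of 1 - T, and with c = 1, the
  corresponding form of 1 + T.\<close>

lemma square_form:
  assumes f: "f \<in> L2 nu"
  shows "integrable (mu \<Otimes>\<^sub>M mu) (\<lambda>p. k (fst p) (snd p) * (f (fst p) + c * f (snd p))\<^sup>2)" (is ?int)
    and "(LINT p|(mu \<Otimes>\<^sub>M mu). k (fst p) (snd p) * (f (fst p) + c * f (snd p))\<^sup>2) = (1 + c\<^sup>2) * sq f + 2 * c * form f f" (is ?val)
proof -
  let ?A = "\<lambda>p. k (fst p) (snd p) * (f (fst p))\<^sup>2" and ?B = "\<lambda>p. k (fst p) (snd p) * (f (snd p))\<^sup>2"
    and ?C = "\<lambda>p. k (fst p) (snd p) * f (fst p) * f (snd p)"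
  have e: "k (fst p) (snd p) * (f (fst p) + c * f (snd p))\<^sup>2 = ?A p + (c\<^sup>2 * ?B p + (2 * c) * ?C p)" for p
    by (simp add: power2_eq_square algebra_simps)
  have iB: "integrable (mu \<Otimes>\<^sub>M mu) (\<lambda>p. c\<^sup>2 * ?B p)" by (intro integrable_mult_right pair_integrable_sq2(1)[OF f])
  have iC: "integrable (mu \<Otimes>\<^sub>M mu) (\<lambda>p. (2 * c) * ?C p)" by (intro integrable_mult_right pair_integrable[OF f f])
  note iA = pair_integrable_sq(1)[OF f] and iBC = Bochner_Integration.integrable_add[OF iB iC]
  show ?int unfolding e by (rule Bochner_Integration.integrable_add[OF iA iBC])
  have "(LINT p|(mu \<Otimes>\<^sub>M mu). ?A p + (c\<^sup>2 * ?B p + (2 * c) * ?C p)) = sq f + (c\<^sup>2 * sq f + 2 * c * form f f)"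
    unfolding Bochner_Integration.integral_add[OF iA iBC] Bochner_Integration.integral_add[OF iB iC]
      integral_mult_right_zero pair_integrable_sq(2)[OF f] pair_integrable_sq2(2)[OF f] form_def ..
  then show ?val unfolding e by (simp add: distrib_right)
qed

end

section \<open>Ergodicity and decay on the complement of the constants\<close>

lemma open_AE_notin:
  fixes U :: "'a::euclidean_space set"
  assumes "open U" "AE y in lborel. y \<notin> U"
  shows "U = {}"
proof (rule ccontr)
  assume "U \<noteq> {}"
  then obtain x r where xr: "r > 0" "ball x r \<subseteq> U" using assms(1) open_contains_ball by blast
  have "AE y in lborel. y \<notin> ball x r" using assms(2) by (rule eventually_mono) (use xr(2) in blast)
  then have "emeasure lborel (ball x r) = 0"
    by (subst (asm) AE_iff_measurable[of "ball x r"]) auto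
  then show False using content_ball_pos[OF xr(1), of x] by (simp add: measure_def)
qed

text \<open>Every ball of radius h/2 contains a point p at which the hypothesis holds, and it lies
  in the ball of radius h around p; so f is almost everywhere constant on it. Constants of nearby
  centres agree on an overlap of positive measure, hence {c = c 0} is open and closed. A countable
  dense set of centres collects the null sets.\<close>

lemma AE_locally_constant:
  fixes f :: "'a::euclidean_space \<Rightarrow> real"
  assumes h: "h > 0" and loc: "AE x in lborel. AE y in lborel. dist x y < h \<longrightarrow> f x = f y"
  shows "\<exists>c. AE x in lborel. f x = c"
proof -
  have "\<exists>c. AE y in lborel. dist x y < h / 2 \<longrightarrow> f y = c" for x
  proof -
    have "\<exists>p. dist x p < h / 2 \<and> (AE y in lborel. dist p y < h \<longrightarrow> f p = f y)"
    proof (rule ccontr)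
      assume n: "\<not> ?thesis"
      have "AE p in lborel. p \<notin> ball x (h / 2)"
        using loc by eventually_elim (use n in auto)
      then have "ball x (h / 2) = {}" by (intro open_AE_notin) auto
      then show False using h by simp
    qed
    then obtain p where p: "dist x p < h / 2" "AE y in lborel. dist p y < h \<longrightarrow> f p = f y" by blast
    from p(2) have "AE y in lborel. dist x y < h / 2 \<longrightarrow> f y = f p"
    proof eventually_elim
      case (elim y)
      then show ?case using p(1) dist_triangle[of p y x] by (auto simp: dist_commute)
    qed
    then show ?thesis by blast
  qed
  then obtain c where c: "\<And>x. AE y in lborel. dist x y < h / 2 \<longrightarrow> f y = c x" by metis
  have loc_const: "c x = c x'" if "dist x x' < h / 2" for x x'
  proof (rule ccontr)
    assume n: "c x \<noteq> c x'"
    have "AE y in lborel. y \<notin> ball x (h / 2) \<inter> ball x' (h / 2)"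
      using c[of x] c[of x'] by eventually_elim (use n in auto)
    then have "ball x (h / 2) \<inter> ball x' (h / 2) = {}" by (intro open_AE_notin) auto
    moreover have "x' \<in> ball x (h / 2) \<inter> ball x' (h / 2)" using that h by simp
    ultimately show False by blast
  qed
  define U where "U = {x. c x = c 0}"
  have "open U" unfolding open_dist U_def
    using h loc_const by (auto intro!: exI[of _ "h / 2"]) 
  moreover have "open (- U)" unfolding open_dist U_def
    using h loc_const by (auto intro!: exI[of _ "h / 2"])
  ultimately have "U = {} \<or> U = UNIV" using clopen[of U] by (simp add: open_closed)
  then have "U = UNIV" by (auto simp: U_def)
  then have c0: "c x = c 0" for x by (auto simp: U_def)
  obtain D :: "'a set" where D: "countable D" "\<And>X. open X \<Longrightarrow> X \<noteq> {} \<Longrightarrow> \<exists>d\<in>D. d \<in> X"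
    using countable_dense_setE by blast
  have "AE y in lborel. \<forall>d\<in>D. dist d y < h / 2 \<longrightarrow> f y = c d"
    by (intro AE_ball_countable'[OF c D(1)])
  then have "AE y in lborel. f y = c 0"
  proof eventually_elim
    case (elim y)
    obtain d where "d \<in> D" "d \<in> ball y (h / 2)" using D(2)[of "ball y (h / 2)"] h by auto
    then show ?case using elim c0[of d] by (auto simp: dist_commute)
  qed
  then show ?thesis by blast
qed

context ball_walk begin

text \<open>The quotient of 4/N^2 and 6 (2 + N), the constants on the two sides of
  \<open>triangle_bound\<close> once \<open>plus_form\<close> is written as 2 (\<open>sq\<close> +
  \<open>form\<close>). It involves the dimension only, through N.\<close>

definition \<delta> :: real where "\<delta> = 2 / (3 * N\<^sup>2 * (2 + N))"

lemma delta_pos: "\<delta> > 0" using N_ge_1 by (simp add: \<delta>_def)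

lemma form_le_sq:
  assumes f: "f \<in> L2 nu"
  shows "form f f \<le> sq f" and "(LINT p|(mu \<Otimes>\<^sub>M mu). k (fst p) (snd p) * (f (fst p) - f (snd p))\<^sup>2) = 2 * (sq f - form f f)"
proof -
  show eq: "(LINT p|(mu \<Otimes>\<^sub>M mu). k (fst p) (snd p) * (f (fst p) - f (snd p))\<^sup>2) = 2 * (sq f - form f f)"
    using square_form(2)[OF f, of "-1"] by simp
  have "0 \<le> (LINT p|(mu \<Otimes>\<^sub>M mu). k (fst p) (snd p) * (f (fst p) - f (snd p))\<^sup>2)"
    by (intro integral_nonneg_AE AE_I2) simp
  then show "form f f \<le> sq f" unfolding eq by simp
qed

text \<open>\<open>square_form\<close> with c = 1 identifies \<open>plus_form\<close> with 2
  (\<open>sq f\<close> + \<open>form f f\<close>), so the triangle estimate reads \<delta>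
  \<open>sq f\<close> \<le> \<open>sq f\<close> + \<open>form f f\<close>: the spectrum stays away
  from -1, uniformly in h.\<close>

lemma form_lower:
  assumes f: "f \<in> L2 nu"
  shows "- (1 - \<delta>) * sq f \<le> form f f"
proof -
  note [measurable] = L2_meas[OF f]
  have "plus_form f = (\<integral>\<^sup>+p. ennreal (k (fst p) (snd p) * (f (fst p) + f (snd p))\<^sup>2) \<partial>(mu \<Otimes>\<^sub>M mu))"
    unfolding plus_form_def by (subst mu.nn_integral_fst[symmetric]) auto
  also have "\<dots> = ennreal (2 * (sq f + form f f))"
    using nn_integral_eq_integral[OF square_form(1)[OF f, of 1]] square_form(2)[OF f, of 1] by simp
  finally have pf: "plus_form f = ennreal (2 * (sq f + form f f))" .
  have "0 \<le> (LINT p|(mu \<Otimes>\<^sub>M mu). k (fst p) (snd p) * (f (fst p) + 1 * f (snd p))\<^sup>2)"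
    by (intro integral_nonneg_AE AE_I2) simp
  then have nn: "0 \<le> 2 * (sq f + form f f)" unfolding square_form(2)[OF f, of 1] by simp
  have "ennreal (4 / N\<^sup>2) * ennreal (sq f) \<le> ennreal (3 * (2 + N)) * ennreal (2 * (sq f + form f f))"
    using triangle_bound[of f] unfolding sq_nn[OF f] pf by simp
  also have "ennreal (3 * (2 + N)) * ennreal (2 * (sq f + form f f)) = ennreal (3 * (2 + N) * (2 * (sq f + form f f)))"
    using N_ge_1 nn by (intro ennreal_mult[symmetric]) auto
  finally have "ennreal (4 / N\<^sup>2 * sq f) \<le> ennreal (3 * (2 + N) * (2 * (sq f + form f f)))"
    using ennreal_mult[of "4 / N\<^sup>2" "sq f"] by simp
  then have "4 / N\<^sup>2 * sq f \<le> 3 * (2 + N) * (2 * (sq f + form f f))"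
    using N_ge_1 nn by (subst (asm) ennreal_le_iff) auto
  also have "\<dots> = (sq f + form f f) * (6 * (2 + N))" by (simp add: algebra_simps)
  finally have "4 / N\<^sup>2 * sq f / (6 * (2 + N)) \<le> sq f + form f f"
    using N_ge_1 by (subst pos_divide_le_eq) auto
  moreover have "4 / q * s / (6 * p) = 2 / (3 * q * p) * s" if "p > 0" "q > 0" for p q s :: real
    using that by (simp add: field_simps)
  from this[of "2 + N" "N\<^sup>2" "sq f"] have "4 / N\<^sup>2 * sq f / (6 * (2 + N)) = \<delta> * sq f"
    using N_ge_1 by (simp add: \<delta>_def)
  ultimately show ?thesis by (simp add: algebra_simps)
qed

definition ip :: "(real^'n \<Rightarrow> real) \<Rightarrow> (real^'n \<Rightarrow> real) \<Rightarrow> real" where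
  "ip f g = (LINT x|nu. f x * g x)"

lemma ip_eq: "f \<in> L2 nu \<Longrightarrow> g \<in> L2 nu \<Longrightarrow> ip f g = (LINT x|mu. m x * (f x * g x)) / Z"
  unfolding ip_def by (intro integral_nu borel_measurable_times L2_meas)

lemma ip_self: "f \<in> L2 nu \<Longrightarrow> ip f f = sq f / Z"
  by (simp add: ip_eq sq_def power2_eq_square)

lemma ip_Th: "f \<in> L2 nu \<Longrightarrow> g \<in> L2 nu \<Longrightarrow> ip (T f) g = form f g / Z"
  by (simp add: ip_eq Th_sq_le(1) form_eq[of g f] form_sym[of f g] mult.commute)

lemma semi_inner_ip: "semi_inner (L2 nu) ip"
  using semi_inner_L2[of nu] by (simp add: ip_def[abs_def])

lemma nm_ip: "f \<in> L2 nu \<Longrightarrow> semi_inner.nm ip f = sqrt (sq f / Z)"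
  by (simp add: semi_inner.nm_def[OF semi_inner_ip] ip_self)

sublocale Hilbert: sa_contraction "L2 nu" ip T
proof (rule sa_contraction.intro[OF semi_inner_ip], unfold_locales)
  fix X :: "nat \<Rightarrow> real^'n \<Rightarrow> real"
  assume X: "\<And>n. X n \<in> L2 nu"
    and C: "\<And>e. e > 0 \<Longrightarrow> \<exists>N. \<forall>m\<ge>N. \<forall>n\<ge>N. semi_inner.nm ip (X m - X n) < e"
  have nm: "semi_inner.nm ip (f - g) = sqrt (LINT x|nu. (f x - g x)\<^sup>2)" for f g
    by (simp add: semi_inner.nm_def[OF semi_inner_ip] ip_def power2_eq_square fun_diff_def)
  show "\<exists>x\<in>L2 nu. (\<lambda>n. semi_inner.nm ip (X n - x)) \<longlonglongrightarrow> 0"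
    using L2_complete[of X nu, OF X] C unfolding nm by blast
next
  fix f g :: "real^'n \<Rightarrow> real" and a :: real
  assume f: "f \<in> L2 nu"
  show "T f \<in> L2 nu" by (rule Th_sq_le(1)[OF f])
  show "T (a *\<^sub>R f) = a *\<^sub>R T f" by (rule Th_scale[OF f])
  show "semi_inner.nm ip (T f) \<le> semi_inner.nm ip f"
    using Th_sq_le[OF f] Z_pos f by (simp add: nm_ip divide_right_mono)
  assume g: "g \<in> L2 nu"
  show "T (f + g) = T f + T g" by (rule Th_add[OF f g])
  show "ip (T f) g = ip f (T g)"
    using ip_Th[OF f g] ip_Th[OF g f] form_sym[OF f g] by (simp add: ip_def mult.commute)
qed

lemma nm_zero_iff:
  assumes f: "f \<in> L2 nu"
  shows "Hilbert.nm f = 0 \<longleftrightarrow> (AE x in nu. f x = 0)"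
proof -
  have "Hilbert.nm f = 0 \<longleftrightarrow> (LINT x|nu. (f x)\<^sup>2) = 0"
    by (simp add: Hilbert.nm_def ip_def power2_eq_square)
  also have "\<dots> \<longleftrightarrow> (AE x in nu. (f x)\<^sup>2 = 0)"
    by (rule integral_nonneg_eq_0_iff_AE) (use f in \<open>auto simp: L2_def\<close>)
  finally show ?thesis by simp
qed

lemma spec_eq: "Hilbert.spec = spectrum_Th \<rho> h"
proof -
  have 1: "Hilbert.nm (T f - l *\<^sub>R f) = 0 \<longleftrightarrow> (AE x in nu. T f x - l * f x = 0)" if "f \<in> L2 nu" for f l
  proof -
    have "T f - l *\<^sub>R f \<in> L2 nu" using that by simp
    from nm_zero_iff[OF this] show ?thesis by (simp add: fun_diff_def scaleR_fun_def)
  qed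
  have 2: "Hilbert.nm (T f - l *\<^sub>R f - g) = 0 \<longleftrightarrow> (AE x in nu. T f x - l * f x = g x)" if "f \<in> L2 nu" "g \<in> L2 nu" for f g l
  proof -
    have "T f - l *\<^sub>R f - g \<in> L2 nu" using that by simp
    from nm_zero_iff[OF this] show ?thesis by (simp add: fun_diff_def scaleR_fun_def)
  qed
  have "l \<in> Hilbert.spec \<longleftrightarrow> l \<in> spectrum_Th \<rho> h" for l
    unfolding Hilbert.spec_def spectrum_Th_def mem_Collect_eq
    by (intro arg_cong[where f=Not] arg_cong2[where f="(\<and>)"] ball_cong bex_cong refl)
       (simp_all only: 1 2 nm_zero_iff)
  then show ?thesis by blast
qed

lemma const_L2: "(\<lambda>x. c) \<in> L2 nu" by (simp add: L2_def)

lemma Th_const: "T (\<lambda>x. c) = (\<lambda>x. c)"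
proof
  fix x
  have "(LINT y|mu. k x y) = m x" by (simp add: m_eq flip: indicator_ball)
  then show "T (\<lambda>x. c) x = c" using m_pos[of x] by (simp add: Th_eq)
qed

text \<open>For T^2 f = f the function g = f - T f satisfies T g = -g, and the lower bound on the
  form makes it null. Then T f = f, the Dirichlet form of f vanishes, f agrees almost everywhere on
  neighbouring points and is therefore constant; orthogonality to 1 leaves the constant 0.\<close>

lemma ergodic:
  assumes f: "f \<in> L2 nu" and orth: "ip f (\<lambda>x. 1) = 0" and fix2: "Hilbert.nm (T (T f) - f) = 0"
  shows "Hilbert.nm f = 0"
proof -
  define g where "g = f - T f"
  have g: "g \<in> L2 nu" using f by (simp add: g_def)
  have "T g + g = - (T (T f) - f)" using f by (simp add: g_def Hilbert.T_diff)
  then have n0: "Hilbert.nm (T g + g) = 0" using f fix2 Hilbert.nm_minus[of "T (T f) - f"] by simp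
  have "\<bar>ip (T g + g) g\<bar> \<le> 0" using Hilbert.abs_ip_le[of "T g + g" g] g n0 by simp
  then have "form g g + sq g = 0"
    using g Z_pos by (simp add: Hilbert.ip_add ip_Th ip_self divide_le_0_iff add_divide_distrib[symmetric])
  then have "\<delta> * sq g \<le> 0" using form_lower[OF g] by (simp add: algebra_simps)
  then have "sq g = 0" using delta_pos sq_nonneg[of g] by (simp add: mult_le_0_iff)
  then have g0: "Hilbert.nm g = 0" using g by (simp add: nm_ip)
  have "\<bar>ip g f\<bar> \<le> 0" using Hilbert.abs_ip_le[of g f] g f g0 by simp
  then have "sq f = form f f"
    using f Z_pos by (simp add: g_def Hilbert.ip_diff ip_Th ip_self divide_le_0_iff diff_divide_distrib[symmetric])
  then have "(LINT p|(mu \<Otimes>\<^sub>M mu). k (fst p) (snd p) * (f (fst p) - f (snd p))\<^sup>2) = 0"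
    using form_le_sq(2)[OF f] by simp
  then have "AE p in mu \<Otimes>\<^sub>M mu. k (fst p) (snd p) * (f (fst p) - f (snd p))\<^sup>2 = 0"
    by (subst (asm) integral_nonneg_eq_0_iff_AE) (use square_form(1)[OF f, of "-1"] in auto)
  then have "AE x in mu. AE y in mu. k x y * (f x - f y)\<^sup>2 = 0"
    using mu2.AE_pair[of "\<lambda>p. k (fst p) (snd p) * (f (fst p) - f (snd p))\<^sup>2 = 0"] by simp
  then have "AE x in lborel. AE y in lborel. dist x y < h \<longrightarrow> f x = f y"
    unfolding AE_mu by (elim eventually_mono) (auto simp: k_def)
  then obtain c where c: "AE x in lborel. f x = c" using AE_locally_constant[OF h] by blast
  have c': "AE x in nu. f x = c" using c by (simp add: AE_nu)
  have "ip f (\<lambda>x. 1) = (LINT x|nu. c)"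
    unfolding ip_def using c' f by (intro integral_cong_AE) (auto simp: L2_def)
  then have "c = 0" using orth nu.prob_space by simp
  then show ?thesis using c' f by (simp add: nm_zero_iff)
qed

lemma form_le_lambda1:
  assumes L: "lambda1 \<rho> h < 1" and f: "f \<in> L2 nu" "ip f (\<lambda>x. 1) = 0"
  shows "ip (T f) f \<le> lambda1 \<rho> h * ip f f"
  using L unfolding lambda1_def spec_eq[symmetric]
  by (intro Hilbert.form_le_Sup_spec[OF _ const_L2 Th_const ergodic f])

text \<open>Since \<lambda>1 \<ge> 1 - \<delta>, the lower bound -(1 - \<delta>) on the form is also
  a lower bound by -\<lambda>1, which is the two-sided control that \<open>funpow_decay\<close> asks
  for.\<close>

lemma decay:
  assumes L: "lambda1 \<rho> h < 1" "1 - \<delta> \<le> lambda1 \<rho> h" "0 < lambda1 \<rho> h"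
    and f: "f \<in> L2 nu" "ip f (\<lambda>x. 1) = 0"
  shows "Hilbert.nm ((T ^^ n) f) \<le> lambda1 \<rho> h ^ n * Hilbert.nm f"
proof (rule Hilbert.funpow_decay[OF L(3) const_L2 Th_const _ f])
  fix g assume g: "g \<in> L2 nu" "ip g (\<lambda>x. 1) = 0"
  have "(1 - \<delta>) * sq g \<le> lambda1 \<rho> h * sq g" using L(2) by (rule mult_right_mono) simp
  then have "- (lambda1 \<rho> h * sq g) \<le> form g g" using form_lower[OF g(1)] by (simp add: algebra_simps)
  then have "- (lambda1 \<rho> h * sq g) / Z \<le> form g g / Z" using Z_pos by (intro divide_right_mono) auto
  then have "- (lambda1 \<rho> h * ip g g) \<le> ip (T g) g" using g by (simp add: ip_self ip_Th)
  then show "\<bar>ip (T g) g\<bar> \<le> lambda1 \<rho> h * ip g g"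
    using form_le_lambda1[OF L(1) g] by (simp add: abs_le_iff)
qed

section \<open>Upper bound for the gap and convergence in total variation\<close>

definition v :: real where "v = measure lborel (ball (0::real^'n) h)"

lemma v_eq: "measure lborel (ball (x::real^'n) h) = v"
  unfolding v_def using h by (simp add: content_ball)

lemma v_pos: "v > 0" unfolding v_def using h by (rule content_ball_pos)

lemma ball_indicator_integrable: "integrable lborel (indicator (ball (x::real^'n) h) :: _ \<Rightarrow> real)"
  using emeasure_bounded_finite[of "ball x h"] by (intro integrable_real_indicator) auto

lemma ball_indicator_integral: "(LINT y|lborel. indicator (ball (x::real^'n) h) y) = v"
  by (simp add: v_eq)

lemma rho_integrable: "integrable lborel \<rho>" using adm by (simp add: admissible_density_def)

lemma m_lebesgue: "m x = (LINT y|lborel. indicator (ball x h) y * \<rho> y)"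
  by (simp add: mh_def set_lebesgue_integral_def)

lemma indicator_rho_integrable: "integrable lborel (\<lambda>y. indicator (ball x h) y * \<rho> y)"
  using integrable_mult_indicator[OF _ rho_integrable, of "ball x h"] by simp

lemma m_upper:
  assumes "\<And>y. \<rho> y \<le> M"
  shows "m x \<le> M * v"
proof -
  have "m x \<le> (LINT y|lborel. M * indicator (ball x h) y)"
    unfolding m_lebesgue using assms
    by (intro integral_mono indicator_rho_integrable integrable_mult_right ball_indicator_integrable)
       (auto simp: indicator_def)
  then show ?thesis using v_eq by simp
qed

lemma m_lower:
  assumes "\<And>y. y \<in> ball x h \<Longrightarrow> p \<le> \<rho> y"
  shows "p * v \<le> m x"
proof -
  have "(LINT y|lborel. p * indicator (ball x h) y) \<le> m x"
    unfolding m_lebesgue using assms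
    by (intro integral_mono indicator_rho_integrable integrable_mult_right ball_indicator_integrable)
       (auto simp: indicator_def)
  then show ?thesis using v_eq by simp
qed

lemma Z_upper:
  assumes "\<And>y. \<rho> y \<le> M"
  shows "Z \<le> M * v"
proof -
  have "Z \<le> (LINT x|mu. M * v)"
    unfolding Z_eq by (intro integral_mono m_integrable m_upper assms) auto
  then show ?thesis using mu.prob_space by simp
qed

text \<open>Test function: $\min(1,|x|)$.\<close>

lemma gap_le:
  assumes L: "lambda1 \<rho> h < 1" and h1: "h \<le> 1"
    and M: "\<And>y. \<rho> y \<le> M" and p: "p > 0" "\<And>y. y \<in> cball 0 3 \<Longrightarrow> p \<le> \<rho> y"
    and e: "norm e = 1"
    and b: "b > 0" "b \<le> measure mu (ball 0 (1/4))" "b \<le> measure mu (ball e (1/4))"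
  shows "1 - lambda1 \<rho> h \<le> 8 * M / (p * b) * h\<^sup>2"
proof -
  define \<phi> where "\<phi> x = min 1 (norm x)" for x :: "real^'n"
  have [measurable]: "\<phi> \<in> borel_measurable borel" by (simp add: \<phi>_def[abs_def])
  have \<phi>_bd: "0 \<le> \<phi> x" "\<phi> x \<le> 1" for x by (auto simp: \<phi>_def)
  have \<phi>_int: "integrable nu \<phi>"
    by (rule nu.integrable_const_bound[of _ 1]) (use \<phi>_bd in auto)
  define a where "a = (LINT x|nu. \<phi> x)"
  define f where "f x = \<phi> x - a" for x
  have f: "f \<in> L2 nu"
  proof -
    have "\<phi> \<in> L2 nu" unfolding L2_def
      by (auto intro!: nu.integrable_const_bound[of _ 1] simp: \<phi>_bd power_le_one)
    from L2_diff[OF this const_L2[of a]] show ?thesis by (simp add: f_def[abs_def])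
  qed
  note [measurable] = L2_meas[OF f]
  have orth: "ip f (\<lambda>x. 1) = 0"
    using \<phi>_int nu.prob_space by (simp add: ip_def f_def a_def)
  have "form f f / Z \<le> lambda1 \<rho> h * (sq f / Z)"
    using form_le_lambda1[OF L f orth] f by (simp add: ip_Th ip_self)
  then have "form f f \<le> lambda1 \<rho> h * sq f" using Z_pos by (simp add: divide_right_mono divide_le_cancel)
  then have "2 * ((1 - lambda1 \<rho> h) * sq f) \<le> 2 * (sq f - form f f)" by (simp add: algebra_simps)
  also have "\<dots> = (LINT p|(mu \<Otimes>\<^sub>M mu). k (fst p) (snd p) * (f (fst p) - f (snd p))\<^sup>2)"
    by (rule form_le_sq(2)[OF f, symmetric])
  \<comment> \<open>The test function is 1-Lipschitz, so over pairs at distance less than h the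
    squared difference is at most h^2, and the remaining integral is Z.\<close>
  also have "\<dots> \<le> (LINT p|(mu \<Otimes>\<^sub>M mu). h\<^sup>2 * (k (fst p) (snd p) * (1::real)\<^sup>2))"
  proof (rule integral_mono)
    show "integrable (mu \<Otimes>\<^sub>M mu) (\<lambda>p. k (fst p) (snd p) * (f (fst p) - f (snd p))\<^sup>2)"
      using square_form(1)[OF f, of "-1"] by simp
    show "integrable (mu \<Otimes>\<^sub>M mu) (\<lambda>p. h\<^sup>2 * (k (fst p) (snd p) * (1::real)\<^sup>2))"
      by (intro integrable_mult_right pair_integrable_sq(1)[OF const_L2])
    fix q :: "(real^'n) \<times> (real^'n)"
    show "k (fst q) (snd q) * (f (fst q) - f (snd q))\<^sup>2 \<le> h\<^sup>2 * (k (fst q) (snd q) * 1\<^sup>2)"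
    proof (cases "dist (fst q) (snd q) < h")
      case True
      have "\<bar>\<phi> x - \<phi> y\<bar> \<le> dist x y" for x y
        using norm_triangle_ineq3[of x y] by (auto simp: \<phi>_def dist_norm min_def)
      then have "\<bar>f (fst q) - f (snd q)\<bar> \<le> h" using True by (smt (verit) f_def)
      then have "(f (fst q) - f (snd q))\<^sup>2 \<le> h\<^sup>2" by (rule power2_le_iff_abs_le[THEN iffD2, rotated]) (use h in simp)
      then show ?thesis by (simp add: k_def)
    qed (simp add: k_def)
  qed
  also have "\<dots> = h\<^sup>2 * Z"
    using pair_integrable_sq(2)[OF const_L2[of 1]] by (simp add: sq_def Z_eq)
  also have "\<dots> \<le> h\<^sup>2 * (M * v)" by (intro mult_left_mono Z_upper M) auto
  finally have up: "2 * ((1 - lambda1 \<rho> h) * sq f) \<le> h\<^sup>2 * (M * v)" .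
  have low: "p * v * b / 16 \<le> sq f"
  proof -
    \<comment> \<open>The unknown mean a lies at distance at least 1/4 from the values of the test
      function near 0 (below 1/4) or from those near e (above 3/4); c is the centre for which this
      happens.\<close>
    define c :: "real^'n" where "c = (if a \<ge> 1/2 then 0 else e)"
    have cb: "b \<le> measure mu (ball c (1/4))" using b by (simp add: c_def)
    have far: "1/4 \<le> \<bar>f x\<bar>" if "x \<in> ball c (1/4)" for x
    proof (cases "a \<ge> 1/2")
      case True
      then have "norm x < 1/4" using that by (simp add: c_def)
      then show ?thesis using True by (auto simp: f_def \<phi>_def)
    next
      case False
      then have "dist e x < 1/4" using that by (simp add: c_def)
      then have "norm x > 3/4" using e norm_triangle_ineq2[of e x] by (simp add: dist_norm)
      then have "\<phi> x \<ge> 3/4" by (simp add: \<phi>_def)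
      then show ?thesis using False by (auto simp: f_def)
    qed
    \<comment> \<open>A neighbour of a point of this ball has norm below 1 + 1/4 + 1, inside the
      ball of radius 3 on which p bounds the density.\<close>
    have m_low: "p * v \<le> m x" if "x \<in> ball c (1/4)" for x
    proof (rule m_lower)
      fix y assume "y \<in> ball x h"
      then have "norm y \<le> norm c + dist c x + dist x y"
        using dist_triangle[of 0 y c] dist_triangle[of c y x] by simp
      then have "norm y \<le> 3" using that \<open>y \<in> ball x h\<close> h1 e by (auto simp: c_def split: if_splits)
      then show "p \<le> \<rho> y" using p(2) by simp
    qed
    have "p * v * b / 16 \<le> p * v / 16 * measure mu (ball c (1/4))"
      using cb p v_pos by simp
    also have "\<dots> = (LINT x|mu. p * v / 16 * indicator (ball c (1/4)) x)" by simp
    also have "\<dots> \<le> (LINT x|mu. m x * (f x)\<^sup>2)"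
    proof (rule integral_mono)
      show "integrable mu (\<lambda>x. m x * (f x)\<^sup>2)" using f by (simp add: L2_nu_iff)
      show "integrable mu (\<lambda>x. p * v / 16 * indicator (ball c (1/4)) x)"
        by (intro integrable_mult_right) (auto simp: mu.emeasure_eq_measure)
      fix x
      show "p * v / 16 * indicator (ball c (1/4)) x \<le> m x * (f x)\<^sup>2"
      proof (cases "x \<in> ball c (1/4)")
        case True
        have "(1/4)\<^sup>2 \<le> \<bar>f x\<bar>\<^sup>2" using far[OF True] by (intro power_mono) auto
        then have "1/16 \<le> (f x)\<^sup>2" by (simp add: power2_eq_square)
        then have "(p * v) * (1/16) \<le> m x * (f x)\<^sup>2"
          using m_low[OF True] m_pos[of x] by (intro mult_mono) (auto simp: less_imp_le)
        then show ?thesis using True by simp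
      qed (use m_pos[of x] in simp)
    qed
    finally show ?thesis by (simp add: sq_def)
  qed
  have "2 * ((1 - lambda1 \<rho> h) * (p * v * b / 16)) \<le> h\<^sup>2 * (M * v)"
  proof -
    have "(1 - lambda1 \<rho> h) * (p * v * b / 16) \<le> (1 - lambda1 \<rho> h) * sq f"
      by (rule mult_left_mono[OF low]) (use L in simp)
    then show ?thesis using up by linarith
  qed
  \<comment> \<open>Both the Dirichlet form and the variance carry the volume v, so it cancels and a
    constant independent of h remains in front of h^2.\<close>
  then have "v * ((1 - lambda1 \<rho> h) * (p * b)) \<le> v * (8 * M * h\<^sup>2)" by (simp add: algebra_simps)
  then have "(1 - lambda1 \<rho> h) * (p * b) \<le> 8 * M * h\<^sup>2" using v_pos by simp
  then show ?thesis using p b by (simp add: pos_le_divide_eq)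
qed

section \<open>From decay in L2 to total variation\<close>

lemma Th_bounded:
  assumes f: "f \<in> L2 nu" and B: "\<And>x. \<bar>f x\<bar> \<le> B"
  shows "\<bar>T f x\<bar> \<le> B"
proof -
  have "\<bar>LINT y|mu. k x y * f y\<bar> \<le> (LINT y|mu. \<bar>k x y * f y\<bar>)"
    using integral_norm_bound[of mu "\<lambda>y. k x y * f y"] by simp
  also have "\<dots> \<le> (LINT y|mu. k x y * B)"
    using B by (intro integral_mono integrable_abs local_integrable f const_L2) (simp add: abs_mult mult_left_mono)
  also have "\<dots> = m x * B" by (simp add: m_eq flip: indicator_ball)
  finally show ?thesis using m_pos[of x] by (simp add: Th_eq L2_meas[OF f] pos_divide_le_eq mult.commute)
qed

lemma funpow_bounded:
  assumes "f \<in> L2 nu" "\<And>x. \<bar>f x\<bar> \<le> B"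
  shows "\<bar>(T ^^ n) f x\<bar> \<le> B"
proof -
  have "\<forall>x. \<bar>(T ^^ n) f x\<bar> \<le> B"
  proof (induction n)
    case (Suc n)
    then show ?case using Th_bounded[OF Hilbert.funpow_H[OF assms(1)], of n] by simp
  qed (use assms in simp)
  then show ?thesis by blast
qed

text \<open>T fixes constants, so subtracting the stationary mass commutes with the iteration. The
  distance is thus governed by powers of T on mean-zero functions that are bounded by 1 pointwise
  and in norm.\<close>

lemma kernel_centered:
  assumes A: "A \<in> sets borel"
  defines "f \<equiv> \<lambda>x. indicator A x - measure nu A"
  shows "f \<in> L2 nu" "ip f (\<lambda>x. 1) = 0" "\<And>x. \<bar>f x\<bar> \<le> 1" "Hilbert.nm f \<le> 1"
    "kernel_n \<rho> h n x A - measure nu A = (T ^^ n) f x"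
proof -
  have ind: "indicator A \<in> L2 nu"
    unfolding L2_def using A by (auto intro!: nu.integrable_const_bound[of _ 1] simp: indicator_def)
  show f: "f \<in> L2 nu" unfolding f_def by (rule L2_diff[OF ind const_L2])
  show bd: "\<bar>f x\<bar> \<le> 1" for x
    using nu.prob_le_1[of A] by (auto simp: f_def indicator_def)
  show "ip f (\<lambda>x. 1) = 0"
    using A nu.prob_space by (simp add: ip_def f_def nu.emeasure_eq_measure)
  have "(f x)\<^sup>2 \<le> 1" for x using power_mono[OF bd[of x] abs_ge_zero, of 2] by simp
  then have "(LINT x|nu. (f x)\<^sup>2) \<le> (LINT x|nu. 1)"
    using f by (intro integral_mono) (auto simp: L2_def)
  then show "Hilbert.nm f \<le> 1"
    using nu.prob_space by (simp add: Hilbert.nm_def ip_def power2_eq_square)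
  have "(T ^^ n) f = (T ^^ n) (indicator A) - (\<lambda>x. measure nu A)"
  proof (induction n)
    case 0
    then show ?case by (simp add: f_def fun_diff_def)
  next
    case (Suc n)
    have "(T ^^ Suc n) f = T ((T ^^ n) (indicator A) - (\<lambda>x. measure nu A))"
      by (simp only: funpow.simps(2) comp_apply Suc.IH)
    also have "\<dots> = (T ^^ Suc n) (indicator A) - (\<lambda>x. measure nu A)"
      using Hilbert.T_diff[OF Hilbert.funpow_H[OF ind] const_L2, of n "measure nu A"] by (simp add: Th_const)
    finally show ?case .
  qed
  then show "kernel_n \<rho> h n x A - measure nu A = (T ^^ n) f x" by (simp add: kernel_n_def)
qed

lemma tv_le:
  assumes "\<And>A. A \<in> sets borel \<Longrightarrow> \<bar>kernel_n \<rho> h n x A - measure nu A\<bar> \<le> B"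
  shows "tv_dist \<rho> h n x \<le> B"
  unfolding tv_dist_def by (rule cSUP_least) (use assms in auto)

lemma tv_le_1: "tv_dist \<rho> h n x \<le> 1"
  by (rule tv_le) (use kernel_centered funpow_bounded in metis)

text \<open>The first i applications of T contract in L2, the last j convert the norm into a value
  at x. Smoothing is asked only for functions bounded by 1, a class preserved by T. The exponential
  comes from 1 - g \<le> exp(-g).\<close>

lemma tv_decay:
  assumes L: "lambda1 \<rho> h < 1" "1 - \<delta> \<le> lambda1 \<rho> h" "0 < lambda1 \<rho> h"
    and smooth: "\<And>f. f \<in> L2 nu \<Longrightarrow> (\<And>y. \<bar>f y\<bar> \<le> 1) \<Longrightarrow> \<bar>(T ^^ j) f x\<bar> \<le> B * Hilbert.nm f"
    and B: "0 \<le> B"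
  shows "tv_dist \<rho> h (i + j) x \<le> B * exp (- real i * spectral_gap \<rho> h)"
proof (rule tv_le)
  fix A :: "(real^'n) set" assume A: "A \<in> sets borel"
  define f where "f = (\<lambda>x. indicator A x - measure nu A)"
  have f: "f \<in> L2 nu" "ip f (\<lambda>x. 1) = 0" "\<And>x. \<bar>f x\<bar> \<le> 1" "Hilbert.nm f \<le> 1"
    "\<And>n x. kernel_n \<rho> h n x A - measure nu A = (T ^^ n) f x"
    using kernel_centered[OF A] by (simp_all add: f_def)
  have "kernel_n \<rho> h (i + j) x A - measure nu A = (T ^^ j) ((T ^^ i) f) x"
    by (simp add: f(5) add.commute[of i] funpow_add)
  also have "\<bar>\<dots>\<bar> \<le> B * Hilbert.nm ((T ^^ i) f)"
    by (rule smooth[OF Hilbert.funpow_H[OF f(1)] funpow_bounded[OF f(1) f(3)]])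
  also have "\<dots> \<le> B * (lambda1 \<rho> h ^ i * Hilbert.nm f)"
    by (intro mult_left_mono decay L f B)
  also have "\<dots> \<le> B * (lambda1 \<rho> h ^ i * 1)"
    using L B f(4) by (intro mult_left_mono) auto
  also have "\<dots> \<le> B * exp (- real i * spectral_gap \<rho> h)"
  proof (intro mult_left_mono B)
    have "lambda1 \<rho> h \<le> exp (- spectral_gap \<rho> h)"
      using exp_ge_add_one_self[of "- spectral_gap \<rho> h"] by (simp add: spectral_gap_def)
    then have "lambda1 \<rho> h ^ i \<le> exp (- spectral_gap \<rho> h) ^ i" using L by (intro power_mono) auto
    then show "lambda1 \<rho> h ^ i * 1 \<le> exp (- real i * spectral_gap \<rho> h)"
      by (simp add: exp_of_nat_mult[symmetric])
  qed
  finally show "\<bar>kernel_n \<rho> h (i + j) x A - measure nu A\<bar> \<le> B * exp (- real i * spectral_gap \<rho> h)" .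
qed

text \<open>Smoothing at the price sqrt(Z)/m(x), which is of order h^(-d/2)/\<rho>(x) when \<rho>
  varies by a bounded factor over the ball.\<close>

lemma one_step_smoothing:
  assumes f: "f \<in> L2 nu"
  shows "\<bar>(T ^^ 1) f x\<bar> \<le> sqrt (N * Z) / m x * Hilbert.nm f"
proof -
  have "\<bar>(T ^^ 1) f x\<bar> \<le> sqrt (N * sq f) / m x" using Th_pointwise_bound[OF f] by simp
  also have "sqrt (N * sq f) = sqrt (N * Z) * Hilbert.nm f"
    using Z_pos f by (simp add: nm_ip real_sqrt_mult[symmetric])
  finally show ?thesis by simp
qed

end

section \<open>Bounds on the gap that are uniform in h\<close>

abbreviation cover_number :: "'n::finite itself \<Rightarrow> real" where
  "cover_number _ \<equiv> real (card (cover_centers :: (real^'n) set))"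

lemma density_upper_bound:
  assumes "admissible_density \<rho>"
  obtains M where "M > 0" "\<And>y. \<rho> y \<le> M"
proof -
  obtain B where "\<And>y. \<bar>\<rho> y\<bar> \<le> B"
    using assms by (auto simp: admissible_density_def bounded_iff)
  then have "\<rho> y \<le> max B 1" for y by (meson abs_le_D1 max.coboundedI1)
  then show ?thesis using that[of "max B 1"] by auto
qed

lemma gap_le_square:
  fixes \<rho> :: "real^'n::finite \<Rightarrow> real"
  assumes adm: "admissible_density \<rho>"
  shows "\<exists>G>0. \<forall>h. 0 < h \<and> h \<le> 1 \<and> lambda1 \<rho> h < 1 \<longrightarrow> spectral_gap \<rho> h \<le> G * h\<^sup>2"
proof -
  let ?N = "cover_number TYPE('n)"
  have walk: "ball_walk \<rho> h ?N" if "h > 0" for h using adm that by unfold_locales auto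
  \<comment> \<open>The measure \<open>mu\<close> and the masses of fixed balls do not depend on h;
    taking them from the walk with h = 1 makes the constants visibly uniform.\<close>
  interpret one: ball_walk \<rho> 1 ?N by (rule walk) simp
  obtain M where M: "M > 0" "\<And>y. \<rho> y \<le> M" using density_upper_bound[OF adm] by blast
  obtain z where z: "z \<in> cball 0 3" "\<And>y. y \<in> cball 0 3 \<Longrightarrow> \<rho> z \<le> \<rho> y"
    using continuous_attains_inf[of "cball 0 3" \<rho>] continuous_on_subset[OF one.rho_continuous] by auto
  define e :: "real^'n" where "e = axis undefined 1"
  have e: "norm e = 1" by (simp add: e_def)
  define b where "b = min (measure one.mu (ball 0 (1/4))) (measure one.mu (ball e (1/4)))"
  have b: "b > 0" using one.ball_mass_pos[of "1/4"] by (simp add: b_def)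
  have "spectral_gap \<rho> h \<le> 8 * M / (\<rho> z * b) * h\<^sup>2" if "0 < h" "h \<le> 1" "lambda1 \<rho> h < 1" for h
  proof -
    interpret ball_walk \<rho> h ?N by (rule walk) (rule that)
    show ?thesis unfolding spectral_gap_def
      by (rule gap_le) (use that M z e b one.rho_pos[of z] in \<open>auto simp: b_def\<close>)
  qed
  moreover have "8 * M / (\<rho> z * b) > 0" using M b one.rho_pos[of z] by simp
  ultimately show ?thesis by blast
qed

text \<open>Either the gap is not positive and the distance bound is trivial, or h is small enough
  that O(h^2) is below both \<delta> and 1/2; the latter makes \<lambda>1 positive. Since h \<le> 1,
  the condition h \<le> c/G already gives G h^2 \<le> c.\<close>

lemma gap_alternatives:
  fixes \<rho> :: "real^'n::finite \<Rightarrow> real"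
  assumes adm: "admissible_density \<rho>"
  shows "\<exists>G>0. \<exists>h0>0. h0 \<le> 1 \<and> (\<forall>h. 0 < h \<and> h \<le> h0 \<longrightarrow> spectral_gap \<rho> h \<le> 0 \<or>
    (lambda1 \<rho> h < 1 \<and> 1 - ball_walk.\<delta> (cover_number TYPE('n)) \<le> lambda1 \<rho> h \<and> 0 < lambda1 \<rho> h
      \<and> spectral_gap \<rho> h \<le> G * h\<^sup>2))"
proof -
  obtain G where G: "G > 0" "\<And>h. 0 < h \<Longrightarrow> h \<le> 1 \<Longrightarrow> lambda1 \<rho> h < 1 \<Longrightarrow> spectral_gap \<rho> h \<le> G * h\<^sup>2"
    using gap_le_square[OF adm] by blast
  interpret one: ball_walk \<rho> 1 "cover_number TYPE('n)" using adm by unfold_locales auto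
  define c where "c = min one.\<delta> (1/2)"
  have c: "c > 0" using one.delta_pos by (simp add: c_def)
  define h0 where "h0 = min 1 (c / G)"
  have "spectral_gap \<rho> h \<le> 0 \<or>
    (lambda1 \<rho> h < 1 \<and> 1 - one.\<delta> \<le> lambda1 \<rho> h \<and> 0 < lambda1 \<rho> h \<and> spectral_gap \<rho> h \<le> G * h\<^sup>2)"
    if h: "0 < h" "h \<le> h0" for h
  proof (cases "lambda1 \<rho> h < 1")
    case True
    have h1: "h \<le> 1" "h \<le> c / G" using h by (auto simp: h0_def)
    have "h * h \<le> 1 * h" using h h1 by (intro mult_right_mono) auto
    then have "h\<^sup>2 \<le> c / G" using h1 by (simp add: power2_eq_square)
    then have "G * h\<^sup>2 \<le> c" using G(1) by (simp add: pos_le_divide_eq mult.commute)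
    moreover have "spectral_gap \<rho> h \<le> G * h\<^sup>2" using G(2) h h1 True by blast
    ultimately show ?thesis using True by (auto simp: spectral_gap_def c_def)
  qed (simp add: spectral_gap_def)
  moreover have "h0 > 0" "h0 \<le> 1" using c G by (auto simp: h0_def)
  ultimately show ?thesis using G(1) by blast
qed

section \<open>Tempered densities\<close>

text \<open>The first-order derivative bounds say that log \<rho> is Lipschitz: along a segment in
  direction w, \<rho> exp(\<Lambda> |w| t) has nonnegative derivative.\<close>

lemma tempered_Harnack:
  fixes \<rho> :: "real^'n::finite \<Rightarrow> real"
  assumes adm: "admissible_density \<rho>" and st: "smooth_tempered_exp \<rho>"
  shows "\<exists>\<Lambda>\<ge>0. \<forall>x y. \<rho> x * exp (- \<Lambda> * dist x y) \<le> \<rho> y"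
proof -
  have "\<forall>i. \<exists>C>0. \<forall>x. \<bar>iter_pd [i] \<rho> x\<bar> \<le> C * \<rho> x"
    using st unfolding smooth_tempered_exp_def by blast
  then obtain C where C: "\<And>i. C i > 0" "\<And>i x. \<bar>pd i \<rho> x\<bar> \<le> C i * \<rho> x"
    by (simp add: pd_def) metis
  have pos: "\<rho> x > 0" for x using adm by (simp add: admissible_density_def)
  have diff: "\<rho> differentiable (at x)" for x using adm by (simp add: admissible_density_def C1_fun_def)
  define \<Lambda> where "\<Lambda> = (\<Sum>i\<in>UNIV. C i)"
  have \<Lambda>: "\<Lambda> \<ge> 0" unfolding \<Lambda>_def using C(1) by (intro sum_nonneg) (simp add: less_imp_le)
  have grad: "\<bar>frechet_derivative \<rho> (at x) w\<bar> \<le> \<Lambda> * norm w * \<rho> x" for x w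
  proof -
    have lin: "linear (frechet_derivative \<rho> (at x))" using diff by (rule linear_frechet_derivative)
    have w: "w = (\<Sum>i\<in>UNIV. (w $ i) *\<^sub>R axis i 1)"
      using basis_expansion[of w] by (simp add: scalar_mult_eq_scaleR)
    have "frechet_derivative \<rho> (at x) w = (\<Sum>i\<in>UNIV. w $ i * pd i \<rho> x)"
      by (subst w) (simp add: linear_sum[OF lin] linear_scale[OF lin] pd_def)
    also have "\<bar>\<dots>\<bar> \<le> (\<Sum>i\<in>UNIV. norm w * (C i * \<rho> x))"
      by (rule order_trans[OF sum_abs], rule sum_mono)
         (simp only: abs_mult, intro mult_mono component_le_norm_cart C, auto)
    also have "\<dots> = \<Lambda> * norm w * \<rho> x" by (simp add: \<Lambda>_def sum_distrib_left sum_distrib_right mult_ac)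
    finally show ?thesis .
  qed
  have "\<rho> x * exp (- \<Lambda> * dist x y) \<le> \<rho> y" for x y
  proof -
    define w where "w = y - x"
    define g where "g t = \<rho> (x + t *\<^sub>R w) * exp (\<Lambda> * norm w * t)" for t
    define g' where "g' t = (frechet_derivative \<rho> (at (x + t *\<^sub>R w)) w + \<Lambda> * norm w * \<rho> (x + t *\<^sub>R w)) * exp (\<Lambda> * norm w * t)" for t
    have deriv: "(g has_real_derivative g' t) (at t)" for t
    proof -
      have outer: "(\<rho> has_derivative frechet_derivative \<rho> (at (x + t *\<^sub>R w))) (at (x + t *\<^sub>R w))"
        using diff frechet_derivative_works by blast
      have inner: "((\<lambda>t. x + t *\<^sub>R w) has_derivative (\<lambda>s. s *\<^sub>R w)) (at t)"
        by (auto intro!: derivative_eq_intros)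
      have "frechet_derivative \<rho> (at (x + t *\<^sub>R w)) (s *\<^sub>R w) = frechet_derivative \<rho> (at (x + t *\<^sub>R w)) w * s" for s
        using linear_scale[OF linear_frechet_derivative[OF diff]] by simp
      then have d1: "((\<lambda>t. \<rho> (x + t *\<^sub>R w)) has_real_derivative frechet_derivative \<rho> (at (x + t *\<^sub>R w)) w) (at t)"
        using has_derivative_compose[OF inner outer] by (simp add: has_field_derivative_def)
      have d2: "((\<lambda>t. exp (\<Lambda> * norm w * t)) has_real_derivative exp (\<Lambda> * norm w * t) * (\<Lambda> * norm w)) (at t)"
        by (auto intro!: derivative_eq_intros)
      show ?thesis unfolding g_def[abs_def]
        by (rule DERIV_cong[OF DERIV_mult[OF d1 d2]]) (simp add: g'_def algebra_simps)
    qed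
    have nonneg: "g' t \<ge> 0" for t
    proof -
      have "0 \<le> frechet_derivative \<rho> (at (x + t *\<^sub>R w)) w + \<Lambda> * norm w * \<rho> (x + t *\<^sub>R w)"
        using grad[of "x + t *\<^sub>R w" w] by linarith
      then show ?thesis unfolding g'_def by (rule mult_nonneg_nonneg) simp
    qed
    have "g 0 \<le> g 1"
      by (rule DERIV_nonneg_imp_nondecreasing[of 0 1 g]) (simp, use deriv nonneg in blast)
    then have "\<rho> x \<le> \<rho> y * exp (\<Lambda> * dist x y)" by (simp add: g_def w_def dist_norm norm_minus_commute)
    then have "\<rho> x * exp (- \<Lambda> * dist x y) \<le> (\<rho> y * exp (\<Lambda> * dist x y)) * exp (- \<Lambda> * dist x y)"
      by (rule mult_right_mono) simp
    also have "\<dots> = \<rho> y" by (simp add: mult.assoc exp_add[symmetric])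
    finally show ?thesis .
  qed
  with \<Lambda> show ?thesis by blast
qed

lemma powr_half_dim: "h > 0 \<Longrightarrow> h powr (- real d / 2) = 1 / sqrt (h ^ d)"
  by (simp add: powr_minus_divide powr_realpow[symmetric] powr_half_sqrt[symmetric] powr_powr)

text \<open>For h \<le> 1 the comparison of values gives m(x) \<ge> exp(-\<Lambda>) \<rho>(x) v,
  while Z \<le> M v. So one step of smoothing costs a constant times 1/(\<rho>(x) sqrt v), and v is
  a constant times h^d.\<close>

lemma tempered_tv_bound:
  fixes \<rho> :: "real^'n::finite \<Rightarrow> real"
  assumes adm: "admissible_density \<rho>" and st: "smooth_tempered_exp \<rho>"
  shows "\<exists>C>0. \<exists>h0>0. \<forall>n::nat. \<forall>h. \<forall>\<tau>::real. 0 < h \<and> h \<le> h0 \<and> \<tau> > 0 \<longrightarrow>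
         (\<forall>x. norm x < \<tau> \<longrightarrow>
            tv_dist \<rho> h n x \<le> C * (h powr (- real CARD('n) / 2) * (SUP y\<in>ball 0 \<tau>. 1 / \<rho> y))
                                 * exp (- real n * spectral_gap \<rho> h))"
proof -
  let ?N = "cover_number TYPE('n)"
  obtain G h0 where Gh: "G > 0" "h0 > 0" "h0 \<le> 1" and alt: "\<And>h. 0 < h \<Longrightarrow> h \<le> h0 \<Longrightarrow> spectral_gap \<rho> h \<le> 0 \<or>
    (lambda1 \<rho> h < 1 \<and> 1 - ball_walk.\<delta> ?N \<le> lambda1 \<rho> h \<and> 0 < lambda1 \<rho> h \<and> spectral_gap \<rho> h \<le> G * h\<^sup>2)"
    using gap_alternatives[OF adm] by blast
  obtain M where M: "M > 0" "\<And>y. \<rho> y \<le> M" using density_upper_bound[OF adm] by blast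
  obtain \<Lambda> where \<Lambda>: "\<Lambda> \<ge> 0" "\<And>x y. \<rho> x * exp (- \<Lambda> * dist x y) \<le> \<rho> y"
    using tempered_Harnack[OF adm st] by blast
  define u where "u = unit_ball_vol (real CARD('n))"
  have u: "u > 0" by (simp add: u_def)
  \<comment> \<open>The factor \<open>exp 1\<close> pays for the smoothing step, which gives no
    decay: the gap is below 1 because \<lambda>1 > 0.\<close>
  define C1 where "C1 = exp 1 * (sqrt (?N * M) * exp \<Lambda> / sqrt u)"
  have C1: "C1 \<ge> 0" using M u by (simp add: C1_def)
  have main: "tv_dist \<rho> h n x \<le> (M + C1) * (h powr (- real CARD('n) / 2) * (SUP y\<in>ball 0 \<tau>. 1 / \<rho> y))
      * exp (- real n * spectral_gap \<rho> h)"
    if hb: "0 < h" "h \<le> h0" and x: "norm x < \<tau>" for n h \<tau> x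
  proof -
    interpret ball_walk \<rho> h ?N using adm hb by unfold_locales auto
    define q where "q = (SUP y\<in>ball 0 \<tau>. 1 / \<rho> y)"
    define r where "r = h powr (- real CARD('n) / 2)"
    have r: "r = 1 / sqrt (h ^ CARD('n))" unfolding r_def by (rule powr_half_dim[OF hb(1)])
    have h1: "h \<le> 1" using hb Gh by simp
    have r1: "1 \<le> r" unfolding r using hb(1) h1 by (simp add: power_le_one)
    \<comment> \<open>Compactness makes the supremum over the ball a genuine one, so that it
      dominates the value at x.\<close>
    have "bdd_above ((\<lambda>y. 1 / \<rho> y) ` cball 0 \<tau>)"
    proof (intro bounded_imp_bdd_above compact_imp_bounded compact_continuous_image)
      show "continuous_on (cball 0 \<tau>) (\<lambda>y. 1 / \<rho> y)"
        using rho_pos by (intro continuous_intros continuous_on_subset[OF rho_continuous])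
           (auto simp: less_imp_neq[symmetric])
    qed simp
    then have "bdd_above ((\<lambda>y. 1 / \<rho> y) ` ball 0 \<tau>)"
      by (rule bdd_above_mono) (use ball_subset_cball in blast)
    then have q: "1 / \<rho> x \<le> q" unfolding q_def using x by (intro cSUP_upper) auto
    have q_M: "1 / M \<le> q"
      using q M rho_pos[of x] frac_le[of 1 1 "\<rho> x" M] by force
    then have q0: "q > 0" using M(1) by (smt (verit) divide_pos_pos)
    \<comment> \<open>Adding M to the constant makes the prefactor at least 1, as q \<ge> 1/M and r
      \<ge> 1; this covers n = 0 and a nonpositive gap, where only the bound 1 on the distance is
      used.\<close>
    have one: "1 \<le> (M + C1) * (r * q)"
    proof -
      have "1 = M * (1 * (1 / M))" using M by simp
      also have "\<dots> \<le> (M + C1) * (r * q)"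
        using M(1) C1 r1 q_M by (intro mult_mono) auto
      finally show ?thesis .
    qed
    have "tv_dist \<rho> h n x \<le> (M + C1) * (r * q) * exp (- real n * spectral_gap \<rho> h)"
    proof (cases "spectral_gap \<rho> h \<le> 0 \<or> n = 0")
      case True
      then have "1 \<le> exp (- real n * spectral_gap \<rho> h)" by (auto simp: mult_nonneg_nonpos)
      then have "1 * 1 \<le> (M + C1) * (r * q) * exp (- real n * spectral_gap \<rho> h)"
        using one by (intro mult_mono) auto
      then show ?thesis using tv_le_1[of n x] by simp
    next
      case False
      then obtain i where n: "n = i + 1" by (metis Suc_eq_plus1 not0_implies_Suc)
      have L: "lambda1 \<rho> h < 1" "1 - \<delta> \<le> lambda1 \<rho> h" "0 < lambda1 \<rho> h"
        using alt[OF hb] False by auto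
      have m_low: "\<rho> x * exp (- \<Lambda>) * v \<le> m x"
      proof (rule m_lower)
        fix y assume "y \<in> ball x h"
        then have "\<Lambda> * dist x y \<le> \<Lambda> * 1" using h1 \<Lambda>(1) by (intro mult_left_mono) auto
        then have "\<rho> x * exp (- \<Lambda>) \<le> \<rho> x * exp (- \<Lambda> * dist x y)"
          using rho_pos[of x] by (intro mult_left_mono) auto
        then show "\<rho> x * exp (- \<Lambda>) \<le> \<rho> y" using \<Lambda>(2)[of x y] by linarith
      qed
      have v_u: "v = u * h ^ CARD('n)" using hb(1) by (simp add: v_def u_def content_ball)
      have B: "sqrt (?N * Z) / m x \<le> sqrt (?N * M) * exp \<Lambda> / sqrt u * (r * q)"
      proof -
        have "sqrt (?N * Z) \<le> sqrt (?N * (M * v))"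
          using Z_upper[OF M(2)] by (intro real_sqrt_le_mono mult_left_mono) auto
        then have "sqrt (?N * Z) / m x \<le> sqrt (?N * (M * v)) / (\<rho> x * exp (- \<Lambda>) * v)"
          using m_low rho_pos[of x] v_pos Z_pos M(1) by (intro frac_le) auto
        also have "\<dots> = sqrt (?N * M) * exp \<Lambda> / sqrt u * (r * (1 / \<rho> x))"
        proof -
          have sv: "sqrt v = sqrt u * sqrt (h ^ CARD('n))" by (simp add: v_u real_sqrt_mult)
          have "sqrt (?N * (M * v)) = sqrt (?N * M) * sqrt v" by (simp add: real_sqrt_mult)
          moreover have "v = sqrt v * sqrt v" using v_pos by simp
          ultimately have "sqrt (?N * (M * v)) / (\<rho> x * exp (- \<Lambda>) * v) = sqrt (?N * M) / (\<rho> x * exp (- \<Lambda>) * sqrt v)"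
            using v_pos rho_pos[of x] by (simp add: divide_simps) 
          also have "\<dots> = sqrt (?N * M) * exp \<Lambda> / sqrt u * (r * (1 / \<rho> x))"
            by (simp add: sv r exp_minus divide_inverse mult_ac)
          finally show ?thesis .
        qed
        also have "\<dots> \<le> sqrt (?N * M) * exp \<Lambda> / sqrt u * (r * q)"
          using q r1 M u by (intro mult_left_mono) auto
        finally show ?thesis .
      qed
      have "tv_dist \<rho> h (i + 1) x \<le> sqrt (?N * Z) / m x * exp (- real i * spectral_gap \<rho> h)"
        using m_pos[of x] Z_pos by (intro tv_decay L one_step_smoothing) auto
      also have "\<dots> \<le> (sqrt (?N * M) * exp \<Lambda> / sqrt u * (r * q)) * exp (- real i * spectral_gap \<rho> h)"
        by (intro mult_right_mono B) auto
      also have "\<dots> \<le> (sqrt (?N * M) * exp \<Lambda> / sqrt u * (r * q)) * (exp 1 * exp (- real n * spectral_gap \<rho> h))"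
      proof (rule mult_left_mono)
        show "exp (- real i * spectral_gap \<rho> h) \<le> exp 1 * exp (- real n * spectral_gap \<rho> h)"
          using L(3) by (simp add: n exp_add[symmetric] algebra_simps spectral_gap_def)
        show "0 \<le> sqrt (?N * M) * exp \<Lambda> / sqrt u * (r * q)"
          using M(1) u r1 q0 by simp
      qed
      finally have "tv_dist \<rho> h n x \<le> \<dots>" by (simp only: n)
      also have "\<dots> = C1 * (r * q) * exp (- real n * spectral_gap \<rho> h)" by (simp add: C1_def mult_ac)
      also have "\<dots> \<le> (M + C1) * (r * q) * exp (- real n * spectral_gap \<rho> h)"
        using M(1) r1 q0 by (intro mult_right_mono) auto
      finally show ?thesis .
    qed
    then show ?thesis by (simp add: q_def r_def)
  qed
  moreover have "M + C1 > 0" using M C1 by simp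
  ultimately show ?thesis using Gh(2) by blast
qed

section \<open>Smoothing by the uniform ball walk\<close>

lemma nn_integral_lborel_shift:
  fixes g :: "'a::euclidean_space \<Rightarrow> ennreal"
  assumes [measurable]: "g \<in> borel_measurable borel" and c: "\<bar>c\<bar> = 1"
  shows "(\<integral>\<^sup>+x. g (w + c *\<^sub>R x) \<partial>lborel) = (\<integral>\<^sup>+x. g x \<partial>lborel)"
proof -
  have "c \<noteq> 0" using c by auto
  have "(\<integral>\<^sup>+x. g x \<partial>lborel) = (\<integral>\<^sup>+x. g x \<partial>density (distr lborel borel (\<lambda>x. w + c *\<^sub>R x)) (\<lambda>_. \<bar>c\<bar> ^ DIM('a)))"
    by (subst lborel_affine[OF \<open>c \<noteq> 0\<close>, of w]) (rule refl)
  also have "\<dots> = (\<integral>\<^sup>+x. g x \<partial>distr lborel borel (\<lambda>x. w + c *\<^sub>R x))"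
    by (subst nn_integral_density) (auto simp: c)
  also have "\<dots> = (\<integral>\<^sup>+x. g (w + c *\<^sub>R x) \<partial>lborel)" by (subst nn_integral_distr) auto
  finally show ?thesis ..
qed

lemma nn_integral_lborel_translate:
  fixes g :: "'a::euclidean_space \<Rightarrow> ennreal"
  assumes "g \<in> borel_measurable borel"
  shows "(\<integral>\<^sup>+x. g (x + w) \<partial>lborel) = (\<integral>\<^sup>+x. g x \<partial>lborel)"
  using nn_integral_lborel_shift[OF assms, of 1 w] by (simp add: add.commute)

text \<open>The squared L2 distance from f to its translate. Like the correlation and the energy it
  lives in \<open>ennreal\<close>, so integrals may be exchanged before anything is known to be
  finite.\<close>

definition diff2 :: "('a::euclidean_space \<Rightarrow> real) \<Rightarrow> 'a \<Rightarrow> ennreal" where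
  "diff2 f w = (\<integral>\<^sup>+x. ennreal ((f x - f (x + w))\<^sup>2) \<partial>lborel)"

definition corr :: "('a::euclidean_space \<Rightarrow> real) \<Rightarrow> 'a \<Rightarrow> ennreal" where
  "corr f w = (\<integral>\<^sup>+x. ennreal (f x * f (x + w)) \<partial>lborel)"

definition energy :: "('a::euclidean_space \<Rightarrow> real) \<Rightarrow> ennreal" where
  "energy f = (\<integral>\<^sup>+x. ennreal ((f x)\<^sup>2) \<partial>lborel)"

lemma diff2_measurable [measurable]:
  assumes [measurable]: "f \<in> borel_measurable borel" and [measurable]: "g \<in> borel_measurable M"
  shows "(\<lambda>z. diff2 f (g z)) \<in> borel_measurable M"
  unfolding diff2_def by measurable

lemma corr_measurable [measurable]:
  assumes [measurable]: "f \<in> borel_measurable borel" and [measurable]: "g \<in> borel_measurable M"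
  shows "(\<lambda>z. corr f (g z)) \<in> borel_measurable M"
  unfolding corr_def by measurable

text \<open>Polarization in additive form, since subtraction of possibly infinite terms must be
  avoided.\<close>

lemma diff2_corr:
  assumes [measurable]: "f \<in> borel_measurable borel" and f0: "\<And>x. 0 \<le> f x"
  shows "diff2 f w + 2 * corr f w = 2 * energy f"
proof -
  have "diff2 f w + 2 * corr f w = (\<integral>\<^sup>+x. ennreal ((f x - f (x + w))\<^sup>2) + 2 * ennreal (f x * f (x + w)) \<partial>lborel)"
    unfolding diff2_def corr_def by (subst nn_integral_add) (auto simp: nn_integral_cmult)
  also have "\<dots> = (\<integral>\<^sup>+x. ennreal ((f x)\<^sup>2) + ennreal ((f (x + w))\<^sup>2) \<partial>lborel)"
  proof (rule nn_integral_cong)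
    fix x
    have "ennreal ((f x - f (x + w))\<^sup>2) + 2 * ennreal (f x * f (x + w)) = ennreal ((f x - f (x + w))\<^sup>2 + 2 * (f x * f (x + w)))"
      using f0 by (simp add: ennreal_mult)
    also have "(f x - f (x + w))\<^sup>2 + 2 * (f x * f (x + w)) = (f x)\<^sup>2 + (f (x + w))\<^sup>2"
      by (simp add: power2_diff)
    finally show "ennreal ((f x - f (x + w))\<^sup>2) + 2 * ennreal (f x * f (x + w)) = ennreal ((f x)\<^sup>2) + ennreal ((f (x + w))\<^sup>2)"
      by simp
  qed
  also have "\<dots> = energy f + (\<integral>\<^sup>+x. ennreal ((f (x + w))\<^sup>2) \<partial>lborel)"
    unfolding energy_def by (rule nn_integral_add) auto
  also have "(\<integral>\<^sup>+x. ennreal ((f (x + w))\<^sup>2) \<partial>lborel) = energy f"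
    unfolding energy_def by (rule nn_integral_lborel_translate) auto
  finally show ?thesis by (simp add: mult_2)
qed

text \<open>A long translation is walked in k equal steps: Cauchy-Schwarz over the k increments
  gives one factor k, their number the other.\<close>

lemma diff2_sum:
  assumes [measurable]: "f \<in> borel_measurable borel"
  shows "diff2 f (real k *\<^sub>R w) \<le> ennreal (real k ^ 2) * diff2 f w"
proof -
  have "ennreal ((f x - f (x + real k *\<^sub>R w))\<^sup>2)
      \<le> ennreal (real k) * (\<Sum>j<k. ennreal ((f (x + real j *\<^sub>R w) - f (x + real j *\<^sub>R w + w))\<^sup>2))" for x
  proof -
    have "f x - f (x + real k *\<^sub>R w) = (\<Sum>j<k. f (x + real j *\<^sub>R w) - f (x + real (Suc j) *\<^sub>R w))"
      using sum_lessThan_telescope'[of "\<lambda>j. f (x + real j *\<^sub>R w)" k] by simp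
    also have "\<dots>\<^sup>2 \<le> (\<Sum>j<k. (f (x + real j *\<^sub>R w) - f (x + real (Suc j) *\<^sub>R w))\<^sup>2) * real (card {..<k})"
      by (rule sum_squared_le_sum_of_squares)
    finally have "(f x - f (x + real k *\<^sub>R w))\<^sup>2 \<le> real k * (\<Sum>j<k. (f (x + real j *\<^sub>R w) - f (x + real j *\<^sub>R w + w))\<^sup>2)"
      by (simp add: algebra_simps)
    then have "ennreal ((f x - f (x + real k *\<^sub>R w))\<^sup>2) \<le> ennreal (real k * (\<Sum>j<k. (f (x + real j *\<^sub>R w) - f (x + real j *\<^sub>R w + w))\<^sup>2))"
      by (rule ennreal_leI)
    also have "\<dots> = ennreal (real k) * ennreal (\<Sum>j<k. (f (x + real j *\<^sub>R w) - f (x + real j *\<^sub>R w + w))\<^sup>2)"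
      by (intro ennreal_mult sum_nonneg) auto
    also have "ennreal (\<Sum>j<k. (f (x + real j *\<^sub>R w) - f (x + real j *\<^sub>R w + w))\<^sup>2) = (\<Sum>j<k. ennreal ((f (x + real j *\<^sub>R w) - f (x + real j *\<^sub>R w + w))\<^sup>2))"
      by (rule sum_ennreal[symmetric]) simp
    finally show ?thesis .
  qed
  then have "diff2 f (real k *\<^sub>R w) \<le> (\<integral>\<^sup>+x. ennreal (real k) * (\<Sum>j<k. ennreal ((f (x + real j *\<^sub>R w) - f (x + real j *\<^sub>R w + w))\<^sup>2)) \<partial>lborel)"
    unfolding diff2_def by (intro nn_integral_mono)
  also have "\<dots> = ennreal (real k) * (\<Sum>j<k. \<integral>\<^sup>+x. ennreal ((f (x + real j *\<^sub>R w) - f (x + real j *\<^sub>R w + w))\<^sup>2) \<partial>lborel)"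
  proof -
    have sum: "(\<integral>\<^sup>+x. (\<Sum>j<k. ennreal ((f (x + real j *\<^sub>R w) - f (x + real j *\<^sub>R w + w))\<^sup>2)) \<partial>lborel)
        = (\<Sum>j<k. \<integral>\<^sup>+x. ennreal ((f (x + real j *\<^sub>R w) - f (x + real j *\<^sub>R w + w))\<^sup>2) \<partial>lborel)"
      by (rule nn_integral_sum) measurable
    show ?thesis unfolding sum[symmetric] by (rule nn_integral_cmult) measurable
  qed
  also have "(\<Sum>j<k. \<integral>\<^sup>+x. ennreal ((f (x + real j *\<^sub>R w) - f (x + real j *\<^sub>R w + w))\<^sup>2) \<partial>lborel) = (\<Sum>j<k. diff2 f w)"
    unfolding diff2_def
    by (intro sum.cong refl nn_integral_lborel_translate[of "\<lambda>x. ennreal ((f x - f (x + w))\<^sup>2)"]) measurable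
  also have "ennreal (real k) * \<dots> = ennreal (real k ^ 2) * diff2 f w"
    by (simp add: power2_eq_square ennreal_mult ennreal_of_nat_eq_real_of_nat mult.assoc)
  finally show ?thesis .
qed

text \<open>The difference between x and x + w is routed through x + y; the second leg is a
  translate of the difference for the shift y - w.\<close>

lemma diff2_triangle:
  assumes [measurable]: "f \<in> borel_measurable borel"
  shows "diff2 f w \<le> 2 * diff2 f y + 2 * diff2 f (y - w)"
proof -
  have "diff2 f w \<le> (\<integral>\<^sup>+x. 2 * ennreal ((f x - f (x + y))\<^sup>2) + 2 * ennreal ((f (x + w) - f (x + w + (y - w)))\<^sup>2) \<partial>lborel)"
    unfolding diff2_def
  proof (rule nn_integral_mono)
    fix x
    define a b where "a = f x - f (x + y)" and "b = f (x + w) - f (x + w + (y - w))"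
    have "f x - f (x + w) = a - b" by (simp add: a_def b_def)
    then have "(f x - f (x + w))\<^sup>2 \<le> 2 * a\<^sup>2 + 2 * b\<^sup>2"
    proof -
      assume e: "f x - f (x + w) = a - b"
      have "(a - b)\<^sup>2 = 2 * a\<^sup>2 + 2 * b\<^sup>2 - (a + b)\<^sup>2" by (simp add: power2_eq_square algebra_simps)
      then show ?thesis unfolding e using zero_le_power2[of "a + b"] by linarith
    qed
    then have "ennreal ((f x - f (x + w))\<^sup>2) \<le> ennreal (2 * a\<^sup>2 + 2 * b\<^sup>2)" by (rule ennreal_leI)
    also have "\<dots> = 2 * ennreal (a\<^sup>2) + 2 * ennreal (b\<^sup>2)" by (simp add: ennreal_mult)
    finally show "ennreal ((f x - f (x + w))\<^sup>2) \<le> 2 * ennreal ((f x - f (x + y))\<^sup>2) + 2 * ennreal ((f (x + w) - f (x + w + (y - w)))\<^sup>2)"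
      by (simp only: a_def b_def)
  qed
  also have "\<dots> = 2 * diff2 f y + 2 * (\<integral>\<^sup>+x. ennreal ((f (x + w) - f (x + w + (y - w)))\<^sup>2) \<partial>lborel)"
    unfolding diff2_def by (subst nn_integral_add) (auto simp: nn_integral_cmult)
  also have "(\<integral>\<^sup>+x. ennreal ((f (x + w) - f (x + w + (y - w)))\<^sup>2) \<partial>lborel) = diff2 f (y - w)"
    unfolding diff2_def
    by (rule nn_integral_lborel_translate[of "\<lambda>x. ennreal ((f x - f (x + (y - w)))\<^sup>2)"]) measurable
  finally show ?thesis .
qed

section \<open>Averaging over a ball: energy, dissipation and the Nash inequality\<close>

locale uniform_walk =
  fixes h :: real and E :: "'a::euclidean_space itself"
  assumes h: "h > 0"
begin

definition unif :: "'a measure" where "unif = uniform_measure lborel (ball 0 h)"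

lemma ball_emeasure: "r > 0 \<Longrightarrow> emeasure lborel (ball (x::'a) r) = ennreal (measure lborel (ball (0::'a) r))"
  by (simp add: emeasure_ball content_ball)

lemma sets_unif [simp, measurable_cong]: "sets unif = sets borel" by (simp add: unif_def)

lemma space_unif [simp]: "space unif = UNIV" by (simp add: unif_def)

lemma content_pos: "r > 0 \<Longrightarrow> measure lborel (ball (0::'a) r) > 0" by (rule content_ball_pos)

sublocale unif: prob_space unif
  unfolding unif_def using content_pos[OF h]
  by (intro prob_space_uniform_measure) (simp_all add: ball_emeasure[OF h])

sublocale pair: pair_sigma_finite "lborel :: 'a measure" unif ..

lemma nn_integral_unif:
  assumes "g \<in> borel_measurable borel"
  shows "(\<integral>\<^sup>+z. g z \<partial>unif) = (\<integral>\<^sup>+z. g z * indicator (ball 0 h) z \<partial>lborel) / ennreal (measure lborel (ball (0::'a) h))"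
  unfolding unif_def using assms by (subst nn_integral_uniform_measure) (auto simp: ball_emeasure[OF h])

definition avg :: "('a \<Rightarrow> real) \<Rightarrow> 'a \<Rightarrow> real" where "avg f x = (LINT z|unif. f (x + z))"

text \<open>On bounded nonnegative functions the Bochner average agrees with its nonnegative
  integral, and the class is stable under \<open>avg\<close>; mass and energy can be computed by
  exchanging integrals.\<close>

definition good :: "real \<Rightarrow> ('a \<Rightarrow> real) \<Rightarrow> bool" where
  "good B f \<longleftrightarrow> f \<in> borel_measurable borel \<and> (\<forall>x. 0 \<le> f x \<and> f x \<le> B)"

lemma goodD: "good B f \<Longrightarrow> f \<in> borel_measurable borel" "good B f \<Longrightarrow> 0 \<le> f x" "good B f \<Longrightarrow> f x \<le> B"
  by (auto simp: good_def)

lemma avg_integrable: "good B f \<Longrightarrow> integrable unif (\<lambda>z. f (x + z))"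
  by (rule unif.integrable_const_bound[of _ B]) (auto simp: good_def)

lemma avg_nn: "good B f \<Longrightarrow> ennreal (avg f x) = (\<integral>\<^sup>+z. ennreal (f (x + z)) \<partial>unif)"
  unfolding avg_def by (intro nn_integral_eq_integral[symmetric] avg_integrable) (auto simp: good_def)

lemma avg_good:
  assumes f: "good B f"
  shows "good B (avg f)"
proof -
  note [measurable] = goodD(1)[OF f]
  have "avg f \<in> borel_measurable borel" unfolding avg_def[abs_def] by measurable
  moreover have "0 \<le> avg f x" for x unfolding avg_def by (intro integral_nonneg_AE AE_I2 goodD[OF f])
  moreover have "avg f x \<le> B" for x
  proof -
    have "avg f x \<le> (LINT z|unif. B)"
      unfolding avg_def by (intro integral_mono avg_integrable[OF f] goodD[OF f]) auto
    then show ?thesis using unif.prob_space by simp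
  qed
  ultimately show ?thesis by (simp add: good_def)
qed

lemma avg_mass:
  assumes f: "good B f"
  shows "(\<integral>\<^sup>+x. ennreal (avg f x) \<partial>lborel) = (\<integral>\<^sup>+x. ennreal (f x) \<partial>lborel)"
proof -
  note [measurable] = goodD(1)[OF f]
  have "(\<integral>\<^sup>+x. ennreal (avg f x) \<partial>lborel) = (\<integral>\<^sup>+x. \<integral>\<^sup>+z. ennreal (f (x + z)) \<partial>unif \<partial>lborel)"
    by (simp add: avg_nn[OF f])
  also have "\<dots> = (\<integral>\<^sup>+z. \<integral>\<^sup>+x. ennreal (f (x + z)) \<partial>lborel \<partial>unif)"
    by (rule pair.Fubini'[symmetric]) measurable
  also have "\<dots> = (\<integral>\<^sup>+z. (\<integral>\<^sup>+x. ennreal (f x) \<partial>lborel) \<partial>unif)"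
    by (intro nn_integral_cong nn_integral_lborel_translate[of "\<lambda>x. ennreal (f x)"]) measurable
  also have "\<dots> = (\<integral>\<^sup>+x. ennreal (f x) \<partial>lborel)" using unif.emeasure_space_1 by simp
  finally show ?thesis .
qed

text \<open>The mean squared distance between two independently shifted copies of f; by
  \<open>energy_avg\<close> it is twice the energy lost in one averaging step, when energies are
  finite.\<close>

definition dissip :: "('a \<Rightarrow> real) \<Rightarrow> ennreal" where
  "dissip f = (\<integral>\<^sup>+z. \<integral>\<^sup>+z'. diff2 f (z' - z) \<partial>unif \<partial>unif)"

text \<open>Expanding the square of the average gives the mean of the correlations at shifts z' - z,
  to which \<open>diff2_corr\<close> applies pair by pair.\<close>

lemma energy_avg:
  assumes f: "good B f"
  shows "2 * energy (avg f) + dissip f = 2 * energy f"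
proof -
  note [measurable] = goodD(1)[OF f]
  have "energy (avg f) = (\<integral>\<^sup>+x. \<integral>\<^sup>+z. \<integral>\<^sup>+z'. ennreal (f (x + z)) * ennreal (f (x + z')) \<partial>unif \<partial>unif \<partial>lborel)"
    unfolding energy_def using goodD(2)[OF avg_good[OF f]]
    by (simp add: power2_eq_square ennreal_mult avg_nn[OF f] nn_integral_cmult nn_integral_multc)
  also have "\<dots> = (\<integral>\<^sup>+z. \<integral>\<^sup>+x. \<integral>\<^sup>+z'. ennreal (f (x + z)) * ennreal (f (x + z')) \<partial>unif \<partial>lborel \<partial>unif)"
    by (rule pair.Fubini'[symmetric]) measurable
  also have "\<dots> = (\<integral>\<^sup>+z. \<integral>\<^sup>+z'. \<integral>\<^sup>+x. ennreal (f (x + z)) * ennreal (f (x + z')) \<partial>lborel \<partial>unif \<partial>unif)"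
    by (intro nn_integral_cong pair.Fubini'[symmetric]) measurable
  also have "\<dots> = (\<integral>\<^sup>+z. \<integral>\<^sup>+z'. corr f (z' - z) \<partial>unif \<partial>unif)"
  proof (intro nn_integral_cong)
    fix z z'
    have "(\<integral>\<^sup>+x. ennreal (f (x + z)) * ennreal (f (x + z')) \<partial>lborel)
        = (\<integral>\<^sup>+x. ennreal (f (x + z) * f (x + z + (z' - z))) \<partial>lborel)"
      using goodD(2)[OF f] by (simp add: ennreal_mult)
    also have "\<dots> = corr f (z' - z)" unfolding corr_def
      by (rule nn_integral_lborel_translate[of "\<lambda>x. ennreal (f x * f (x + (z' - z)))"]) measurable
    finally show "(\<integral>\<^sup>+x. ennreal (f (x + z)) * ennreal (f (x + z')) \<partial>lborel) = corr f (z' - z)" .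
  qed
  finally have e: "energy (avg f) = (\<integral>\<^sup>+z. \<integral>\<^sup>+z'. corr f (z' - z) \<partial>unif \<partial>unif)" .
  have "2 * energy (avg f) + dissip f = (\<integral>\<^sup>+z. \<integral>\<^sup>+z'. diff2 f (z' - z) + 2 * corr f (z' - z) \<partial>unif \<partial>unif)"
    unfolding e dissip_def by (simp add: nn_integral_add nn_integral_cmult add.commute)
  also have "\<dots> = (\<integral>\<^sup>+z. \<integral>\<^sup>+z'. 2 * energy f \<partial>unif \<partial>unif)"
    using goodD[OF f] by (simp only: diff2_corr)
  also have "\<dots> = 2 * energy f" using unif.emeasure_space_1 by simp
  finally show ?thesis .
qed

definition vol :: "real \<Rightarrow> real" where "vol r = measure lborel (ball (0::'a) r)"

lemma vol_pos: "r > 0 \<Longrightarrow> vol r > 0" by (simp add: vol_def content_pos)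

lemma vol_eq: "r \<ge> 0 \<Longrightarrow> vol r = unit_ball_vol (real DIM('a)) * r ^ DIM('a)"
  by (simp add: vol_def content_ball)

lemma dissip_lborel:
  assumes [measurable]: "f \<in> borel_measurable borel"
  shows "(\<integral>\<^sup>+z. \<integral>\<^sup>+z'. indicator (ball 0 h) z * indicator (ball 0 h) z' * diff2 f (z' - z) \<partial>lborel \<partial>lborel)
    = ennreal ((vol h)\<^sup>2) * dissip f"
proof -
  have inv: "ennreal (vol h) * (x / ennreal (vol h)) = x" for x
    using vol_pos[OF h] by (simp add: divide_ennreal_def ennreal_mult_divide_eq mult.left_commute[of _ x] inverse_ennreal ennreal_mult[symmetric])
  have "ennreal ((vol h)\<^sup>2) * dissip f
      = ennreal (vol h) * (ennreal (vol h) * (\<integral>\<^sup>+z. \<integral>\<^sup>+z'. diff2 f (z' - z) \<partial>unif \<partial>unif))"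
    using vol_pos[OF h] by (simp add: dissip_def power2_eq_square ennreal_mult mult.assoc)
  also have "ennreal (vol h) * (\<integral>\<^sup>+z. \<integral>\<^sup>+z'. diff2 f (z' - z) \<partial>unif \<partial>unif)
      = (\<integral>\<^sup>+z. (\<integral>\<^sup>+z'. diff2 f (z' - z) \<partial>unif) * indicator (ball 0 h) z \<partial>lborel)"
    by (subst nn_integral_unif) (measurable, simp add: inv[unfolded vol_def] vol_def)
  also have "ennreal (vol h) * \<dots> = (\<integral>\<^sup>+z. ennreal (vol h) * ((\<integral>\<^sup>+z'. diff2 f (z' - z) \<partial>unif) * indicator (ball 0 h) z) \<partial>lborel)"
    by (rule nn_integral_cmult[symmetric]) measurable
  also have "\<dots> = (\<integral>\<^sup>+z. (\<integral>\<^sup>+z'. diff2 f (z' - z) * indicator (ball 0 h) z' \<partial>lborel) * indicator (ball 0 h) z \<partial>lborel)"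
  proof (rule nn_integral_cong)
    fix z
    have "ennreal (vol h) * (\<integral>\<^sup>+z'. diff2 f (z' - z) \<partial>unif) = (\<integral>\<^sup>+z'. diff2 f (z' - z) * indicator (ball 0 h) z' \<partial>lborel)"
      by (subst nn_integral_unif) (measurable, simp add: inv[unfolded vol_def] vol_def)
    then show "ennreal (vol h) * ((\<integral>\<^sup>+z'. diff2 f (z' - z) \<partial>unif) * indicator (ball 0 h) z)
        = (\<integral>\<^sup>+z'. diff2 f (z' - z) * indicator (ball 0 h) z' \<partial>lborel) * indicator (ball 0 h) z"
      by (simp add: mult.assoc[symmetric])
  qed
  also have "\<dots> = (\<integral>\<^sup>+z. \<integral>\<^sup>+z'. indicator (ball 0 h) z * indicator (ball 0 h) z' * diff2 f (z' - z) \<partial>lborel \<partial>lborel)"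
    by (intro nn_integral_cong, subst nn_integral_multc[symmetric]) (measurable, simp add: mult_ac)
  finally show ?thesis ..
qed

text \<open>\<open>diff2_triangle\<close> with y = z' - z is averaged over z, z' in the ball of
  radius h/2: then y - w = z' - (z + w), and z, z' and z + w all lie in the ball of radius h. The
  factor 4 is 2 + 2, and 4^d is the squared volume ratio of the two balls.\<close>

lemma diff2_le_dissip:
  assumes [measurable]: "f \<in> borel_measurable borel" and w: "norm w \<le> h / 2"
  shows "diff2 f w \<le> ennreal (4 * 4 ^ DIM('a)) * dissip f"
proof -
  let ?b = "\<lambda>z::'a. indicator (ball 0 (h / 2)) z :: ennreal" and ?B = "\<lambda>z::'a. indicator (ball 0 h) z :: ennreal"
  define I where "I = ennreal ((vol h)\<^sup>2) * dissip f"
  note I = dissip_lborel[OF assms(1), folded I_def]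
  have bc: "(\<integral>\<^sup>+z. ?b z * c \<partial>lborel) = ennreal (vol (h / 2)) * c" for c
  proof -
    have "(\<integral>\<^sup>+z. ?b z * c \<partial>lborel) = (\<integral>\<^sup>+z. ?b z \<partial>lborel) * c" by (rule nn_integral_multc) measurable
    also have "(\<integral>\<^sup>+z. ?b z \<partial>lborel) = ennreal (vol (h / 2))"
      using h by (simp add: ball_emeasure vol_def)
    finally show ?thesis .
  qed
  have "ennreal ((vol (h / 2))\<^sup>2) * diff2 f w = (\<integral>\<^sup>+z. \<integral>\<^sup>+z'. ?b z * ?b z' * diff2 f w \<partial>lborel \<partial>lborel)"
  proof -
    have "(\<integral>\<^sup>+z'. ?b z * ?b z' * diff2 f w \<partial>lborel) = ?b z * (ennreal (vol (h / 2)) * diff2 f w)" for z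
      unfolding mult.assoc bc[symmetric] by (rule nn_integral_cmult) measurable
    then show ?thesis
      using vol_pos[of "h / 2"] h by (simp only: bc) (simp add: power2_eq_square ennreal_mult mult.assoc)
  qed
  also have "\<dots> \<le> (\<integral>\<^sup>+z. \<integral>\<^sup>+z'. 2 * (?B z * ?B z' * diff2 f (z' - z)) + 2 * (?B (z + w) * ?B z' * diff2 f (z' - (z + w))) \<partial>lborel \<partial>lborel)"
  proof (intro nn_integral_mono)
    fix z z' :: 'a
    show "?b z * ?b z' * diff2 f w \<le> 2 * (?B z * ?B z' * diff2 f (z' - z)) + 2 * (?B (z + w) * ?B z' * diff2 f (z' - (z + w)))"
    proof (cases "norm z < h / 2 \<and> norm z' < h / 2")
      case True
      then have "norm z < h" "norm z' < h" "norm (z + w) < h"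
        using w h norm_triangle_ineq[of z w] by linarith+
      then show ?thesis using True diff2_triangle[of f w "z' - z"] by (simp add: diff_diff_eq)
    qed auto
  qed
  also have "\<dots> = 2 * I + 2 * (\<integral>\<^sup>+z. \<integral>\<^sup>+z'. ?B (z + w) * ?B z' * diff2 f (z' - (z + w)) \<partial>lborel \<partial>lborel)"
    unfolding I[symmetric] by (simp add: nn_integral_add nn_integral_cmult)
  also have "(\<integral>\<^sup>+z. \<integral>\<^sup>+z'. ?B (z + w) * ?B z' * diff2 f (z' - (z + w)) \<partial>lborel \<partial>lborel) = I"
    unfolding I[symmetric]
    by (rule nn_integral_lborel_translate[of "\<lambda>z. \<integral>\<^sup>+z'. ?B z * ?B z' * diff2 f (z' - z) \<partial>lborel"]) measurable
  also have "2 * I + 2 * I = 4 * I" by (simp flip: distrib_right)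
  also have "(vol (h / 2))\<^sup>2 = (vol h)\<^sup>2 / 4 ^ DIM('a)"
    using h by (simp add: vol_eq power_mult_distrib power_divide power2_eq_square flip: power_mult_distrib)
  finally have le: "ennreal ((vol h)\<^sup>2 / 4 ^ DIM('a)) * diff2 f w \<le> 4 * (ennreal ((vol h)\<^sup>2) * dissip f)"
    by (simp add: I_def)
  define c where "c = 4 ^ DIM('a) / (vol h)\<^sup>2"
  have c: "c > 0" using vol_pos[OF h] by (simp add: c_def)
  have "ennreal c * (ennreal ((vol h)\<^sup>2 / 4 ^ DIM('a)) * diff2 f w) \<le> ennreal c * (4 * (ennreal ((vol h)\<^sup>2) * dissip f))"
    using le by (rule mult_left_mono) simp
  also have "ennreal c * (ennreal ((vol h)\<^sup>2 / 4 ^ DIM('a)) * diff2 f w) = ennreal (c * ((vol h)\<^sup>2 / 4 ^ DIM('a))) * diff2 f w"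
    unfolding mult.assoc[symmetric] by (subst ennreal_mult) (use c in auto)
  also have "c * ((vol h)\<^sup>2 / 4 ^ DIM('a)) = 1" using vol_pos[OF h] by (simp add: c_def)
  also have "ennreal c * (4 * (ennreal ((vol h)\<^sup>2) * dissip f)) = ennreal (c * (4 * (vol h)\<^sup>2)) * dissip f"
  proof -
    have "ennreal (c * (4 * (vol h)\<^sup>2)) = ennreal c * (ennreal 4 * ennreal ((vol h)\<^sup>2))"
      using c by (simp only: ennreal_mult less_imp_le zero_le_power2 zero_le_numeral mult_nonneg_nonneg)
    then show ?thesis by (simp add: mult.assoc)
  qed
  also have "c * (4 * (vol h)\<^sup>2) = 4 * 4 ^ DIM('a)" using vol_pos[OF h] by (simp add: c_def)
  finally show ?thesis by simp
qed

text \<open>Averaging $|f|^2 = \langle f, f(\cdot + y)\rangle + \frac12 |f - f(\cdot+y)|^2$ over $|y| < kh/2$ gives a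
  Nash inequality at scale $kh$.\<close>

lemma Nash:
  assumes f: "good B f" and k: "k \<ge> 1"
  shows "2 * (ennreal (vol (real k * h / 2)) * energy f)
    \<le> 2 * (\<integral>\<^sup>+x. ennreal (f x) \<partial>lborel)\<^sup>2
      + ennreal (vol (real k * h / 2)) * (ennreal (real k ^ 2 * (4 * 4 ^ DIM('a))) * dissip f)"
proof -
  note [measurable] = goodD(1)[OF f]
  define r where "r = real k * h / 2"
  have r: "r > 0" using h k by (simp add: r_def)
  let ?b = "\<lambda>y::'a. indicator (ball 0 r) y :: ennreal"
  have bc: "(\<integral>\<^sup>+z. ?b z * c \<partial>lborel) = ennreal (vol r) * c" for c
  proof -
    have "(\<integral>\<^sup>+z. ?b z * c \<partial>lborel) = (\<integral>\<^sup>+z. ?b z \<partial>lborel) * c" by (rule nn_integral_multc) measurable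
    also have "(\<integral>\<^sup>+z. ?b z \<partial>lborel) = ennreal (vol r)"
      using r by (simp add: ball_emeasure vol_def)
    finally show ?thesis .
  qed
  \<comment> \<open>A shift within radius k h/2 is k shifts of length at most h/2, each controlled
    by the dissipation.\<close>
  have D: "diff2 f y \<le> ennreal (real k ^ 2 * (4 * 4 ^ DIM('a))) * dissip f" if "y \<in> ball 0 r" for y
  proof -
    define w where "w = (1 / real k) *\<^sub>R y"
    have y: "y = real k *\<^sub>R w" using k by (simp add: w_def)
    have "norm w \<le> h / 2" using that k by (simp add: w_def r_def field_simps)
    then have "diff2 f w \<le> ennreal (4 * 4 ^ DIM('a)) * dissip f" by (intro diff2_le_dissip) auto
    then have "ennreal (real k ^ 2) * diff2 f w \<le> ennreal (real k ^ 2) * (ennreal (4 * 4 ^ DIM('a)) * dissip f)"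
      by (rule mult_left_mono) simp
    then show ?thesis unfolding y using diff2_sum[of f k w]
      by (simp add: ennreal_mult mult.assoc)
  qed
  have "2 * (ennreal (vol r) * energy f) = (\<integral>\<^sup>+y. ?b y * (2 * energy f) \<partial>lborel)"
    unfolding bc by (rule mult.left_commute)
  also have "\<dots> = (\<integral>\<^sup>+y. ?b y * (diff2 f y + 2 * corr f y) \<partial>lborel)"
    using goodD[OF f] by (simp only: diff2_corr)
  also have "\<dots> \<le> (\<integral>\<^sup>+y. ?b y * (ennreal (real k ^ 2 * (4 * 4 ^ DIM('a))) * dissip f) + 2 * corr f y \<partial>lborel)"
    using D by (intro nn_integral_mono) (auto simp: indicator_def intro!: add_right_mono)
  also have "\<dots> = ennreal (vol r) * (ennreal (real k ^ 2 * (4 * 4 ^ DIM('a))) * dissip f) + 2 * (\<integral>\<^sup>+y. corr f y \<partial>lborel)"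
    by (subst nn_integral_add) (measurable, simp add: bc nn_integral_cmult)
  also have "(\<integral>\<^sup>+y. corr f y \<partial>lborel) = (\<integral>\<^sup>+x. ennreal (f x) \<partial>lborel)\<^sup>2"
  proof -
    have "(\<integral>\<^sup>+y. corr f y \<partial>lborel) = (\<integral>\<^sup>+x. \<integral>\<^sup>+y. ennreal (f x * f (x + y)) \<partial>lborel \<partial>lborel)"
      unfolding corr_def by (rule lborel_pair.Fubini'[symmetric]) measurable
    also have "\<dots> = (\<integral>\<^sup>+x. ennreal (f x) * (\<integral>\<^sup>+y. ennreal (f (y + x)) \<partial>lborel) \<partial>lborel)"
      using goodD(2)[OF f] by (simp add: ennreal_mult nn_integral_cmult add.commute)
    also have "\<dots> = (\<integral>\<^sup>+x. ennreal (f x) * (\<integral>\<^sup>+y. ennreal (f y) \<partial>lborel) \<partial>lborel)"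
      by (subst nn_integral_lborel_translate[of "\<lambda>y. ennreal (f y)"]) auto
    also have "\<dots> = (\<integral>\<^sup>+x. ennreal (f x) \<partial>lborel)\<^sup>2"
      by (subst nn_integral_multc) (auto simp: power2_eq_square)
    finally show ?thesis .
  qed
  finally show ?thesis by (simp add: r_def add.commute)
qed

end

section \<open>Iterating the Nash inequality over dyadic scales\<close>

lemma geometric_decay:
  fixes t :: "nat \<Rightarrow> real"
  assumes "\<And>j. t (Suc j) \<le> a * t j" "0 \<le> a"
  shows "t (n + j) \<le> a ^ j * t n"
proof (induction j)
  case (Suc j)
  have "t (n + Suc j) \<le> a * t (n + j)" using assms(1)[of "n + j"] by simp
  also have "\<dots> \<le> a * (a ^ j * t n)" using Suc assms(2) by (rule mult_left_mono)
  finally show ?case by (simp add: mult.assoc)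
qed simp

text \<open>The energy bound is improved scale by scale: $O(4^i)$ further steps gain a factor $2^{-d}$ at the
  dyadic scale $2^i h$.\<close>

lemma Nash_sequence:
  fixes s :: "nat \<Rightarrow> real"
  assumes h: "0 < h" "h \<le> 1" and K: "1 \<le> Ka" "0 < Kb"
    and s0: "\<And>j. 0 \<le> s j" and dec: "\<And>j. s (Suc j) \<le> s j"
    and step: "\<And>k j. k \<ge> 1 \<Longrightarrow> s j \<le> Ka * (real k)\<^sup>2 * (s j - s (Suc j)) + Kb / (real k * h) ^ d"
    and init: "s 0 \<le> B / h ^ d" and B: "2 * Kb \<le> B"
    and e: "Ka * ln (2 ^ (d + 1)) \<le> real e" and j: "8 * real e / h\<^sup>2 \<le> real j"
  shows "s j \<le> B"
proof -
  have B0: "B > 0" using B K by simp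
  have mono: "s n \<le> s m" if "m \<le> n" for m n
    using that by (rule lift_Suc_antimono_le[of s, OF dec])
  have P: "s (2 * e * 4 ^ i) \<le> B / (2 ^ i * h) ^ d" for i
  proof (induction i)
    case 0
    have "s (2 * e) \<le> s 0" by (rule mono) simp
    then show ?case using init by simp
  next
    case (Suc i)
    define q where "q = (2 ^ Suc i * h) ^ d"
    have q: "q > 0" using h by (simp add: q_def)
    \<comment> \<open>With k = 2^(i+1) the hypothesis reads \<epsilon> t(n) \<le> t(n) - t(n+1) once
      the floor Kb/q is subtracted: geometric decay at rate \<epsilon>.\<close>
    define \<epsilon> where "\<epsilon> = 1 / (Ka * 4 ^ Suc i)"
    have "1 * 1 \<le> Ka * 4 ^ Suc i" using K by (intro mult_mono) (auto simp: one_le_power simp del: power_Suc)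
    then have \<epsilon>: "0 < \<epsilon>" "\<epsilon> \<le> 1" using K by (auto simp: \<epsilon>_def simp del: power_Suc)
    define t where "t n = s n - Kb / q" for n
    have t_step: "t (Suc n) \<le> (1 - \<epsilon>) * t n" for n
    proof -
      have sq: "(real (2 ^ Suc i))\<^sup>2 = 4 ^ Suc i"
        by (simp add: power2_eq_square flip: power_mult_distrib)
      have "s n \<le> Ka * (real (2 ^ Suc i))\<^sup>2 * (s n - s (Suc n)) + Kb / (real (2 ^ Suc i) * h) ^ d"
        by (rule step) (simp del: power_Suc)
      then have "s n \<le> Ka * 4 ^ Suc i * (s n - s (Suc n)) + Kb / q"
        unfolding sq q_def by (simp del: power_Suc)
      then have "t n \<le> Ka * 4 ^ Suc i * (t n - t (Suc n))" by (simp add: t_def)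
      then have "\<epsilon> * t n \<le> \<epsilon> * (Ka * 4 ^ Suc i * (t n - t (Suc n)))" using \<epsilon> by (intro mult_left_mono) auto
      also have "\<dots> = t n - t (Suc n)" using K by (simp add: \<epsilon>_def)
      finally show ?thesis by (simp add: algebra_simps)
    qed
    \<comment> \<open>Start time and number of steps at this scale: n + J = 6 e 4^i, within the
      allotted 2 e 4^(i+1).\<close>
    define n J where "n = 2 * e * 4 ^ i" and "J = e * 4 ^ Suc i"
    \<comment> \<open>Of the factor 2^(-(d+1)), the part 2^(-d) moves the bound to the next scale;
      the remaining 1/2 makes room for the floor, as Kb \<le> B/2.\<close>
    have pw: "(1 - \<epsilon>) ^ J \<le> 1 / 2 ^ (d + 1)"
    proof -
      have "(1 - \<epsilon>) ^ J \<le> exp (- \<epsilon>) ^ J"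
        using \<epsilon> exp_ge_add_one_self[of "- \<epsilon>"] by (intro power_mono) auto
      also have "\<dots> = exp (- (real J * \<epsilon>))" by (simp add: exp_of_nat_mult[symmetric])
      also have "real J * \<epsilon> = real e / Ka" using K by (simp add: J_def \<epsilon>_def)
      also have "exp (- (real e / Ka)) \<le> exp (- ln (2 ^ (d + 1)))"
        using e K by (simp add: pos_le_divide_eq mult.commute)
      also have "\<dots> = 1 / 2 ^ (d + 1)" by (simp add: exp_minus inverse_eq_divide)
      finally show ?thesis .
    qed
    have "s (2 * e * 4 ^ Suc i) \<le> s (n + J)"
      by (rule mono) (simp add: n_def J_def)
    also have "\<dots> = Kb / q + t (n + J)" by (simp add: t_def)
    also have "t (n + J) \<le> (1 - \<epsilon>) ^ J * t n" using t_step \<epsilon> by (intro geometric_decay) auto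
    also have "\<dots> \<le> (1 - \<epsilon>) ^ J * (B / (2 ^ i * h) ^ d)"
      using Suc K q \<epsilon> by (intro mult_left_mono) (auto simp: t_def n_def intro: order_trans[rotated])
    also have "\<dots> \<le> 1 / 2 ^ (d + 1) * (B / (2 ^ i * h) ^ d)"
      using pw B0 h by (intro mult_right_mono) auto
    also have "\<dots> = (B / 2) / q"
      by (simp add: q_def power_mult_distrib)
    finally have "s (2 * e * 4 ^ Suc i) \<le> (Kb + B / 2) / q" by (simp add: add_divide_distrib)
    also have "\<dots> \<le> B / q" using B q by (intro divide_right_mono) auto
    finally show ?case by (simp only: q_def)
  qed
  obtain i0 where "1 / h < 2 ^ i0" using real_arch_pow[of 2 "1 / h"] by auto
  then have ex: "1 \<le> 2 ^ i0 * h" using h by (simp add: field_simps)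
  \<comment> \<open>The first scale with 2^i h \<ge> 1. By minimality it is at most 2, so the time
    used, 2 e 4^i, is at most 8 e/h^2.\<close>
  define i where "i = (LEAST i. 1 \<le> (2::real) ^ i * h)"
  have i: "1 \<le> 2 ^ i * h" unfolding i_def by (rule LeastI[of _ i0]) (rule ex)
  have i2: "2 ^ i * h \<le> 2"
  proof (cases i)
    case (Suc l)
    then have "\<not> 1 \<le> 2 ^ l * h" unfolding i_def by (intro not_less_Least) simp
    then show ?thesis by (simp add: Suc)
  qed (use h in simp)
  have "2 * real e * 4 ^ i * h\<^sup>2 = 2 * real e * (2 ^ i * h)\<^sup>2"
    by (simp add: power_mult_distrib power2_eq_square flip: power_mult_distrib)
  also have "\<dots> \<le> 2 * real e * 2\<^sup>2" using i i2 by (intro mult_left_mono power_mono) auto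
  finally have "2 * real e * 4 ^ i \<le> 8 * real e / h\<^sup>2" using h by (simp add: pos_le_divide_eq)
  then have "real (2 * e * 4 ^ i) \<le> real j" using j by simp
  then have "s j \<le> s (2 * e * 4 ^ i)" by (intro mono) (simp only: of_nat_le_iff)
  also have "\<dots> \<le> B / (2 ^ i * h) ^ d" by (rule P)
  also have "\<dots> \<le> B / 1" using i B0 by (intro divide_left_mono) (auto simp: one_le_power)
  finally show ?thesis by simp
qed

section \<open>Iterated kernels of the uniform walk\<close>

context uniform_walk begin

definition kern :: "'a \<Rightarrow> 'a \<Rightarrow> real" where "kern x y = (if dist x y < h then 1 / vol h else 0)"

lemma kern_measurable [measurable]:
  "f \<in> borel_measurable M \<Longrightarrow> g \<in> borel_measurable M \<Longrightarrow> (\<lambda>p. kern (f p) (g p)) \<in> borel_measurable M"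
  unfolding kern_def by measurable

lemma kern_nonneg [simp]: "0 \<le> kern x y" using vol_pos[OF h] by (simp add: kern_def)

lemma kern_good: "good (1 / vol h) (kern x)"
  unfolding good_def using vol_pos[OF h] by (auto simp: kern_def)

lemma kern_mass: "(\<integral>\<^sup>+y. ennreal (kern x y) \<partial>lborel) = 1"
proof -
  have "(\<integral>\<^sup>+y. ennreal (kern x y) \<partial>lborel) = (\<integral>\<^sup>+y. ennreal (1 / vol h) * indicator (ball x h) y \<partial>lborel)"
    by (intro nn_integral_cong) (simp add: kern_def indicator_def)
  also have "\<dots> = ennreal (1 / vol h) * ennreal (vol h)"
    by (subst nn_integral_cmult_indicator) (auto simp: ball_emeasure[OF h] vol_def)
  also have "\<dots> = 1" using vol_pos[OF h] by (simp add: ennreal_mult[symmetric])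
  finally show ?thesis .
qed

lemma avg_kern:
  assumes f: "good B f"
  shows "ennreal (avg f x) = (\<integral>\<^sup>+y. ennreal (kern x y * f y) \<partial>lborel)"
proof -
  note [measurable] = goodD(1)[OF f]
  have "ennreal (avg f x) = (\<integral>\<^sup>+z. ennreal (f (x + z)) * indicator (ball 0 h) z \<partial>lborel) / ennreal (vol h)"
    unfolding avg_nn[OF f] vol_def by (rule nn_integral_unif) measurable
  also have "\<dots> = (\<integral>\<^sup>+z. ennreal (f (x + z)) * indicator (ball 0 h) z / ennreal (vol h) \<partial>lborel)"
    by (rule nn_integral_divide[symmetric]) measurable
  also have "\<dots> = (\<integral>\<^sup>+z. ennreal (kern x (z + x) * f (z + x)) \<partial>lborel)"
    using vol_pos[OF h] goodD(2)[OF f]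
    by (intro nn_integral_cong) (auto simp: kern_def indicator_def dist_norm divide_ennreal add.commute)
  also have "\<dots> = (\<integral>\<^sup>+y. ennreal (kern x y * f y) \<partial>lborel)"
    by (rule nn_integral_lborel_translate[of "\<lambda>y. ennreal (kern x y * f y)"]) measurable
  finally show ?thesis .
qed

lemma avg_symmetric:
  assumes f: "good B f" and g: "good B' g"
  shows "(\<integral>\<^sup>+x. ennreal (f x * avg g x) \<partial>lborel) = (\<integral>\<^sup>+x. ennreal (avg f x * g x) \<partial>lborel)"
proof -
  note [measurable] = goodD(1)[OF f] goodD(1)[OF g]
  have "(\<integral>\<^sup>+x. ennreal (f x * avg g x) \<partial>lborel) = (\<integral>\<^sup>+x. \<integral>\<^sup>+y. ennreal (f x) * ennreal (kern x y * g y) \<partial>lborel \<partial>lborel)"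
    using goodD(2)[OF f] goodD(2)[OF avg_good[OF g]]
    by (simp add: ennreal_mult avg_kern[OF g] nn_integral_cmult del: ennreal_mult'')
  also have "\<dots> = (\<integral>\<^sup>+y. \<integral>\<^sup>+x. ennreal (f x) * ennreal (kern x y * g y) \<partial>lborel \<partial>lborel)"
    by (rule lborel_pair.Fubini') measurable
  also have "\<dots> = (\<integral>\<^sup>+y. \<integral>\<^sup>+x. ennreal (kern y x * f x) * ennreal (g y) \<partial>lborel \<partial>lborel)"
  proof (intro nn_integral_cong)
    fix x y
    have fg: "0 \<le> f x" "0 \<le> g y" using goodD(2)[OF f] goodD(2)[OF g] by auto
    have "ennreal (f x) * ennreal (kern x y * g y) = ennreal (f x * (kern x y * g y))"
      using fg by (intro ennreal_mult[symmetric]) auto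
    also have "f x * (kern x y * g y) = (kern y x * f x) * g y" by (simp add: kern_def dist_commute)
    also have "ennreal \<dots> = ennreal (kern y x * f x) * ennreal (g y)"
      using fg by (intro ennreal_mult) auto
    finally show "ennreal (f x) * ennreal (kern x y * g y) = ennreal (kern y x * f x) * ennreal (g y)" .
  qed
  also have "\<dots> = (\<integral>\<^sup>+y. ennreal (avg f y) * ennreal (g y) \<partial>lborel)"
    unfolding avg_kern[OF f] by (intro nn_integral_cong nn_integral_multc) measurable
  also have "\<dots> = (\<integral>\<^sup>+x. ennreal (avg f x * g x) \<partial>lborel)"
    using goodD(2)[OF g] goodD(2)[OF avg_good[OF f]] by (simp add: ennreal_mult)
  finally show ?thesis .
qed

lemma funpow_good: "good B f \<Longrightarrow> good B ((avg ^^ n) f)"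
  by (induction n) (auto intro: avg_good)

lemma funpow_symmetric:
  assumes f: "good B f" and g: "good B' g"
  shows "(\<integral>\<^sup>+x. ennreal (f x * (avg ^^ n) g x) \<partial>lborel) = (\<integral>\<^sup>+x. ennreal ((avg ^^ n) f x * g x) \<partial>lborel)"
  using f
proof (induction n arbitrary: f)
  case (Suc n)
  have "(\<integral>\<^sup>+x. ennreal (f x * (avg ^^ Suc n) g x) \<partial>lborel) = (\<integral>\<^sup>+x. ennreal (avg f x * (avg ^^ n) g x) \<partial>lborel)"
    using avg_symmetric[OF Suc.prems funpow_good[OF g, of n]] by simp
  also have "\<dots> = (\<integral>\<^sup>+x. ennreal ((avg ^^ n) (avg f) x * g x) \<partial>lborel)"
    by (rule Suc.IH[OF avg_good[OF Suc.prems]])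
  finally show ?case by (simp add: funpow_swap1)
qed simp

lemma funpow_mass: "good B f \<Longrightarrow> (\<integral>\<^sup>+x. ennreal ((avg ^^ n) f x) \<partial>lborel) = (\<integral>\<^sup>+x. ennreal (f x) \<partial>lborel)"
  by (induction n) (auto simp: avg_mass[OF funpow_good])

text \<open>The value at x after j + 1 steps is the pairing of g with the j-fold average of the
  one-step density at x: symmetry moves j averagings from g to \<open>kern x\<close>, and
  Cauchy-Schwarz separates the two.\<close>

lemma smoothing:
  assumes g: "good B g"
  shows "ennreal (((avg ^^ Suc j) g x)\<^sup>2) \<le> energy ((avg ^^ j) (kern x)) * energy g"
proof -
  note [measurable] = goodD(1)[OF g] goodD(1)[OF funpow_good[OF kern_good[of x]]]
  have "ennreal ((avg ^^ Suc j) g x) = (\<integral>\<^sup>+y. ennreal ((avg ^^ j) (kern x) y * g y) \<partial>lborel)"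
    using avg_kern[OF funpow_good[OF g, of j]] funpow_symmetric[OF kern_good g] by simp
  also have "\<dots> = (\<integral>\<^sup>+y. ennreal ((avg ^^ j) (kern x) y) * ennreal (g y) \<partial>lborel)"
    using goodD(2)[OF g] goodD(2)[OF funpow_good[OF kern_good[of x]]] by (simp add: ennreal_mult)
  finally have "(ennreal ((avg ^^ Suc j) g x))\<^sup>2 = \<dots>\<^sup>2" by simp
  also have "\<dots> \<le> (\<integral>\<^sup>+y. (ennreal ((avg ^^ j) (kern x) y))\<^sup>2 \<partial>lborel) * (\<integral>\<^sup>+y. (ennreal (g y))\<^sup>2 \<partial>lborel)"
    by (rule Cauchy_Schwarz_nn_integral) measurable
  also have "\<dots> = energy ((avg ^^ j) (kern x)) * energy g"
    unfolding energy_def using goodD(2)[OF g] goodD(2)[OF funpow_good[OF kern_good[of x]]]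
    by (simp add: ennreal_power)
  finally show ?thesis
    using goodD(2)[OF funpow_good[OF g, of "Suc j"]] by (simp only: ennreal_power)
qed

lemma energy_finite:
  assumes f: "good B f" and mass: "(\<integral>\<^sup>+x. ennreal (f x) \<partial>lborel) = 1" and B: "0 \<le> B"
  shows "energy f \<le> ennreal B"
proof -
  note [measurable] = goodD(1)[OF f]
  have "energy f \<le> (\<integral>\<^sup>+x. ennreal B * ennreal (f x) \<partial>lborel)"
    unfolding energy_def using goodD[OF f] B
    by (intro nn_integral_mono) (auto simp: ennreal_mult[symmetric] power2_eq_square intro!: ennreal_leI mult_right_mono)
  also have "\<dots> = ennreal B" by (subst nn_integral_cmult) (auto simp: mass)
  finally show ?thesis .
qed

text \<open>Mass 1 and the bound B make the energy at most B. With finite energies the dissipation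
  is 2 (s - s'), and the Nash inequality becomes a recursion for real numbers.\<close>

lemma Nash_real:
  assumes f: "good B f" and mass: "(\<integral>\<^sup>+x. ennreal (f x) \<partial>lborel) = 1" and B: "0 \<le> B" and k: "k \<ge> 1"
  defines "s \<equiv> enn2real (energy f)" and "s' \<equiv> enn2real (energy (avg f))"
  shows "s' \<le> s"
    and "s \<le> 4 * 4 ^ DIM('a) * (real k)\<^sup>2 * (s - s') + 1 / vol (real k * h / 2)"
proof -
  have mass': "(\<integral>\<^sup>+x. ennreal (avg f x) \<partial>lborel) = 1" using avg_mass[OF f] mass by simp
  have e: "energy f = ennreal s"
    unfolding s_def by (rule ennreal_enn2real[OF le_less_trans[OF energy_finite[OF f mass B] ennreal_less_top], symmetric])
  have e': "energy (avg f) = ennreal s'"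
    unfolding s'_def by (rule ennreal_enn2real[OF le_less_trans[OF energy_finite[OF avg_good[OF f] mass' B] ennreal_less_top], symmetric])
  have s0: "0 \<le> s" "0 \<le> s'" by (auto simp: s_def s'_def)
  have sum: "ennreal (2 * s') + dissip f = ennreal (2 * s)"
    using energy_avg[OF f] unfolding e e' using s0 by (simp add: ennreal_mult)
  then have "dissip f \<le> ennreal (2 * s)" by (metis add.commute le_iff_add)
  then obtain D where D: "dissip f = ennreal D" "0 \<le> D"
    by (metis ennreal_enn2real enn2real_nonneg ennreal_less_top le_less_trans)
  have D_eq: "D = 2 * (s - s')"
  proof -
    have "ennreal (2 * s' + D) = ennreal (2 * s)" using sum D s0 by simp
    then have "2 * s' + D = 2 * s" using D s0 by (subst (asm) ennreal_inj) auto
    then show ?thesis by simp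
  qed
  then show "s' \<le> s" using D(2) by simp
  define V where "V = vol (real k * h / 2)"
  have V: "V > 0" unfolding V_def using k h by (intro vol_pos) simp
  define c where "c = (real k)\<^sup>2 * (4 * 4 ^ DIM('a))"
  have c: "c \<ge> 0" by (simp add: c_def)
  have "2 * (ennreal V * ennreal s) \<le> 2 * 1\<^sup>2 + ennreal V * (ennreal c * ennreal D)"
    using Nash[OF f k] unfolding mass e D(1) V_def[symmetric] c_def[symmetric] .
  also have "2 * (ennreal V * ennreal s) = ennreal (2 * (V * s))"
    using V s0 by (simp add: ennreal_mult)
  also have "2 * 1\<^sup>2 + ennreal V * (ennreal c * ennreal D) = ennreal (2 + V * (c * D))"
    using V c D(2) by (simp add: ennreal_mult)
  finally have "2 * (V * s) \<le> 2 + V * (c * D)"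
    using V c D(2) by (subst (asm) ennreal_le_iff) auto
  then have "V * s \<le> V * (c * (s - s') + 1 / V)"
    using V by (simp add: D_eq algebra_simps)
  then have "s \<le> c * (s - s') + 1 / V" using V by simp
  then show "s \<le> 4 * 4 ^ DIM('a) * (real k)\<^sup>2 * (s - s') + 1 / vol (real k * h / 2)"
    by (simp add: c_def V_def mult_ac)
qed

text \<open>The mass stays 1 along the iteration, so 1/vol(k h/2) = Kb/(k h)^d with Kb = 2^d/u,
  where u is the volume of the unit ball. The initial energy is at most 1/(u h^d), and C is twice
  Kb.\<close>

lemma kernel_energy_bound:
  assumes h1: "h \<le> 1"
    and C: "C = 2 * 2 ^ DIM('a) / unit_ball_vol (real DIM('a))"
    and e: "4 * 4 ^ DIM('a) * ln (2 ^ (DIM('a) + 1)) \<le> real e" and j: "8 * real e / h\<^sup>2 \<le> real j"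
  shows "energy ((avg ^^ j) (kern x)) \<le> ennreal C"
proof -
  define u where "u = unit_ball_vol (real DIM('a))"
  have u: "u > 0" by (simp add: u_def)
  define f where "f n = (avg ^^ n) (kern x)" for n
  have f: "good (1 / vol h) (f n)" for n unfolding f_def by (intro funpow_good kern_good)
  have mass: "(\<integral>\<^sup>+y. ennreal (f n y) \<partial>lborel) = 1" for n
    unfolding f_def by (simp add: funpow_mass[OF kern_good] kern_mass)
  have B: "0 \<le> 1 / vol h" using vol_pos[OF h] by simp
  define s where "s n = enn2real (energy (f n))" for n
  have f_Suc: "f (Suc n) = avg (f n)" for n by (simp add: f_def)
  note step = Nash_real[OF f mass B, folded f_Suc, folded s_def]
  have fin: "energy (f n) = ennreal (s n)" for n
    unfolding s_def by (rule ennreal_enn2real[OF le_less_trans[OF energy_finite[OF f mass B] ennreal_less_top], symmetric])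
  have "s j \<le> C"
  proof (rule Nash_sequence[where Kb="2 ^ DIM('a) / u", OF h h1 _ _ _ _ _ _ _ e j])
    show "1 \<le> 4 * (4::real) ^ DIM('a)" using one_le_power[of "4::real" "DIM('a)"] by linarith
    show "0 < 2 ^ DIM('a) / u" using u by simp
    show "0 \<le> s n" for n by (simp add: s_def)
    show "s (Suc n) \<le> s n" for n by (rule step(1)[of 1]) simp
    show "s n \<le> 4 * 4 ^ DIM('a) * (real k)\<^sup>2 * (s n - s (Suc n)) + 2 ^ DIM('a) / u / (real k * h) ^ DIM('a)"
      if "k \<ge> 1" for k n
      using step(2)[OF that, of n] h by (simp add: vol_eq u_def power_divide)
    have "ennreal (s 0) \<le> ennreal (1 / vol h)" unfolding fin[symmetric] by (rule energy_finite[OF f mass B])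
    then have "s 0 \<le> 1 / vol h" using B by (subst (asm) ennreal_le_iff)
    also have "\<dots> = 1 / u / h ^ DIM('a)" using h by (simp add: vol_eq u_def)
    also have "\<dots> \<le> C / h ^ DIM('a)"
    proof (intro divide_right_mono)
      have "1 \<le> 2 * (2::real) ^ DIM('a)" using one_le_power[of "2::real" "DIM('a)"] by linarith
      then show "1 / u \<le> C" using u unfolding C u_def[symmetric] by (intro divide_right_mono) auto
    qed (use h in simp)
    finally show "s 0 \<le> C / h ^ DIM('a)" .
    show "2 * (2 ^ DIM('a) / u) \<le> C" by (simp add: C u_def)
  qed
  then show ?thesis unfolding f_def[symmetric] fin by (rule ennreal_leI)
qed

end

section \<open>Gaussian densities\<close>

context ball_walk begin

lemma m_nn_lebesgue: "ennreal (m x) = (\<integral>\<^sup>+y. ennreal (k x y * \<rho> y) \<partial>lborel)"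
  unfolding m_lebesgue using rho_pos indicator_rho_integrable[of x]
  by (subst nn_integral_eq_integral[symmetric]) (auto simp: indicator_ball less_imp_le)

lemma v_nn: "(\<integral>\<^sup>+y. ennreal (k x y) \<partial>lborel) = ennreal v"
proof -
  have "(\<integral>\<^sup>+y. ennreal (indicator (ball x h) y) \<partial>lborel) = ennreal v"
    using nn_integral_eq_integral[OF ball_indicator_integrable[of x]] ball_indicator_integral[of x] by simp
  then show ?thesis by (simp add: indicator_ball)
qed

end

locale gaussian_walk = ball_walk \<rho> h N for \<rho> :: "real^'n::finite \<Rightarrow> real" and h N +
  fixes \<alpha> \<beta> :: real
  assumes \<alpha>: "\<alpha> > 0" and \<beta>: "\<beta> > 0" and gauss: "\<rho> = (\<lambda>x. \<beta> * exp (- \<alpha> * (norm x)\<^sup>2))"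
begin

sublocale W: uniform_walk h "TYPE(real^'n)" using h by unfold_locales

lemma vol_v: "W.vol h = v" by (simp add: W.vol_def v_def)

text \<open>Averaging over the reflection $y \mapsto 2x - y$ removes the gradient of the density at $x$.\<close>

lemma gauss_reflect:
  assumes "dist x y < h"
  shows "2 * (\<rho> x * exp (- \<alpha> * h\<^sup>2)) \<le> \<rho> y + \<rho> (2 *\<^sub>R x - y)"
proof -
  define A B where "A = - \<alpha> * (norm y)\<^sup>2" and "B = - \<alpha> * (norm (2 *\<^sub>R x - y))\<^sup>2"
  have "(norm y)\<^sup>2 + (norm (2 *\<^sub>R x - y))\<^sup>2 = 2 * (norm x)\<^sup>2 + 2 * (dist x y)\<^sup>2"
    by (simp add: dist_norm power2_norm_eq_inner algebra_simps inner_commute)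
  moreover have "A + B = - \<alpha> * ((norm y)\<^sup>2 + (norm (2 *\<^sub>R x - y))\<^sup>2)" by (simp add: A_def B_def algebra_simps)
  ultimately have "A + B = - \<alpha> * (2 * (norm x)\<^sup>2 + 2 * (dist x y)\<^sup>2)" by simp
  moreover have "(dist x y)\<^sup>2 \<le> h\<^sup>2" using assms by (intro power_mono) auto
  then have "\<alpha> * (dist x y)\<^sup>2 \<le> \<alpha> * h\<^sup>2" using \<alpha> by simp
  ultimately have AB: "- \<alpha> * (norm x)\<^sup>2 + - \<alpha> * h\<^sup>2 \<le> A / 2 + B / 2" by (simp add: algebra_simps)
  have "2 * exp (- \<alpha> * (norm x)\<^sup>2 + - \<alpha> * h\<^sup>2) \<le> 2 * exp (A / 2 + B / 2)" using AB by simp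
  also have "\<dots> \<le> exp A + exp B"
  proof -
    have e: "exp t = exp (t / 2) * exp (t / 2)" for t :: real by (simp flip: exp_add)
    have "0 \<le> (exp (A / 2) - exp (B / 2))\<^sup>2" by simp
    then show ?thesis unfolding e[of A] e[of B] exp_add by (simp add: power2_eq_square algebra_simps)
  qed
  finally have "\<beta> * (2 * exp (- \<alpha> * (norm x)\<^sup>2 + - \<alpha> * h\<^sup>2)) \<le> \<beta> * (exp A + exp B)"
    using \<beta> by (intro mult_left_mono) auto
  then show ?thesis unfolding gauss A_def B_def exp_add by (simp add: algebra_simps)
qed

text \<open>Pairing y with its reflection loses only exp(-\<alpha> h^2), uniformly in x. A
  first-order estimate would lose exp(-c h |x|), which could not be iterated of order h^(-2)
  times.\<close>

lemma gauss_m_lower: "exp (- \<alpha> * h\<^sup>2) * \<rho> x * v \<le> m x"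
proof -
  define c where "c = \<rho> x * exp (- \<alpha> * h\<^sup>2)"
  have c: "c > 0" using rho_pos[of x] by (simp add: c_def)
  have "(\<integral>\<^sup>+y. ennreal (k x (2 *\<^sub>R x + (-1) *\<^sub>R y) * \<rho> (2 *\<^sub>R x + (-1) *\<^sub>R y)) \<partial>lborel) = ennreal (m x)"
    unfolding m_nn_lebesgue
  proof (rule nn_integral_lborel_shift[of "\<lambda>y. ennreal (k x y * \<rho> y)"])
    show "(\<lambda>y. ennreal (k x y * \<rho> y)) \<in> borel_measurable borel" by measurable
  qed simp
  moreover have "k x (2 *\<^sub>R x + (-1) *\<^sub>R y) = k x y" for y
    by (simp add: k_def dist_norm scaleR_2 norm_minus_commute)
  ultimately have refl: "(\<integral>\<^sup>+y. ennreal (k x y * \<rho> (2 *\<^sub>R x - y)) \<partial>lborel) = ennreal (m x)" by simp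
  have "ennreal (2 * c * v) = (\<integral>\<^sup>+y. ennreal (2 * c) * ennreal (k x y) \<partial>lborel)"
    using c v_pos by (subst nn_integral_cmult) (auto simp: v_nn ennreal_mult)
  also have "\<dots> \<le> (\<integral>\<^sup>+y. ennreal (k x y * \<rho> y) + ennreal (k x y * \<rho> (2 *\<^sub>R x - y)) \<partial>lborel)"
  proof (rule nn_integral_mono)
    fix y
    show "ennreal (2 * c) * ennreal (k x y) \<le> ennreal (k x y * \<rho> y) + ennreal (k x y * \<rho> (2 *\<^sub>R x - y))"
      using gauss_reflect[of x y] rho_pos[of y] rho_pos[of "2 *\<^sub>R x - y"]
      by (simp add: k_def c_def less_imp_le ennreal_leI flip: ennreal_plus)
  qed
  also have "\<dots> = ennreal (m x) + ennreal (m x)"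
    unfolding m_nn_lebesgue by (subst nn_integral_add) (measurable, simp add: refl[unfolded m_nn_lebesgue])
  also have "\<dots> = ennreal (2 * m x)" using m_pos[of x] by (simp flip: ennreal_plus)
  finally have "2 * c * v \<le> 2 * m x" using m_pos[of x] by (subst (asm) ennreal_le_iff) auto
  then show ?thesis by (simp add: c_def mult_ac)
qed

lemma avg_mono:
  assumes f: "W.good B f" and g: "W.good B' g" and le: "\<And>y. f y \<le> c * g y"
  shows "W.avg f x \<le> c * W.avg g x"
proof -
  have "W.avg f x \<le> (LINT z|W.unif. c * g (x + z))"
    unfolding W.avg_def
    by (intro integral_mono W.avg_integrable[OF f] integrable_mult_right W.avg_integrable[OF g] le)
  then show ?thesis by (simp add: W.avg_def)
qed

text \<open>The factor $e^{-\alpha |x|^2}$ conjugates the walk to a sub-Markov perturbation of the uniform walk.\<close>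

lemma conjugation_step:
  assumes g: "g \<in> L2 nu" and good: "W.good B (\<lambda>y. \<rho> y * \<bar>g y\<bar>)"
  shows "\<rho> x * \<bar>T g x\<bar> \<le> exp (\<alpha> * h\<^sup>2) * W.avg (\<lambda>y. \<rho> y * \<bar>g y\<bar>) x"
proof -
  note [measurable] = L2_meas[OF g]
  define a where "a = W.avg (\<lambda>y. \<rho> y * \<bar>g y\<bar>) x"
  have a0: "0 \<le> a" unfolding a_def by (rule W.goodD(2)[OF W.avg_good[OF good]])
  have abs_g: "(\<lambda>y. \<bar>g y\<bar>) \<in> L2 nu" using g by (auto simp: L2_def)
  have int: "integrable mu (\<lambda>y. k x y * \<bar>g y\<bar>)" by (rule local_integrable(1)[OF abs_g])
  have "ennreal (LINT y|mu. k x y * \<bar>g y\<bar>) = (\<integral>\<^sup>+y. ennreal (k x y * \<bar>g y\<bar>) \<partial>mu)"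
    by (rule nn_integral_eq_integral[OF int, symmetric]) simp
  also have "\<dots> = (\<integral>\<^sup>+y. ennreal (\<rho> y) * ennreal (k x y * \<bar>g y\<bar>) \<partial>lborel)"
    unfolding mu_def by (rule nn_integral_density) measurable
  also have "\<dots> = (\<integral>\<^sup>+y. ennreal v * ennreal (W.kern x y * (\<rho> y * \<bar>g y\<bar>)) \<partial>lborel)"
    using v_pos rho_pos
    by (intro nn_integral_cong) (simp add: W.kern_def k_def vol_v less_imp_le flip: ennreal_mult)
  also have "\<dots> = ennreal v * ennreal a"
    unfolding a_def W.avg_kern[OF good] by (rule nn_integral_cmult) measurable
  also have "\<dots> = ennreal (v * a)" using v_pos a0 by (simp add: ennreal_mult)
  finally have I: "(LINT y|mu. k x y * \<bar>g y\<bar>) = v * a"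
    using v_pos a0 by (subst (asm) ennreal_inj) (auto intro!: integral_nonneg_AE)
  have "\<bar>LINT y|mu. k x y * g y\<bar> \<le> v * a"
    using integral_norm_bound[of mu "\<lambda>y. k x y * g y"] by (simp add: abs_mult I)
  then have "\<bar>T g x\<bar> \<le> v * a / m x" using m_pos[of x] by (simp add: Th_eq divide_right_mono less_imp_le)
  also have "\<dots> \<le> v * a / (exp (- \<alpha> * h\<^sup>2) * \<rho> x * v)"
    using gauss_m_lower[of x] v_pos a0 rho_pos[of x] m_pos[of x] by (intro divide_left_mono) auto
  also have "\<dots> = exp (\<alpha> * h\<^sup>2) * a / \<rho> x"
    using v_pos by (simp add: exp_minus field_simps)
  finally show ?thesis using rho_pos[of x] by (simp add: a_def pos_le_divide_eq mult.commute)
qed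

lemma good_density:
  assumes g: "g \<in> L2 nu" "\<And>y. \<bar>g y\<bar> \<le> 1" and M: "\<And>y. \<rho> y \<le> M"
  shows "W.good M (\<lambda>y. \<rho> y * \<bar>g y\<bar>)"
proof -
  note [measurable] = L2_meas[OF g(1)]
  have "\<rho> y * \<bar>g y\<bar> \<le> M * 1" for y
    using M[of y] rho_pos[of y] g(2)[of y] by (intro mult_mono) auto
  then show ?thesis using rho_pos by (auto simp: W.good_def less_imp_le)
qed

text \<open>The accumulated loss exp(n \<alpha> h^2) stays bounded while n is of order h^(-2). The
  bound 1 on g passes to all iterates and keeps their products with \<rho> in the class
  \<open>good\<close>.\<close>

lemma conjugation:
  assumes g: "g \<in> L2 nu" "\<And>y. \<bar>g y\<bar> \<le> 1" and M: "\<And>y. \<rho> y \<le> M"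
  shows "\<rho> x * \<bar>(T ^^ n) g x\<bar> \<le> exp (real n * (\<alpha> * h\<^sup>2)) * (W.avg ^^ n) (\<lambda>y. \<rho> y * \<bar>g y\<bar>) x"
proof (induction n arbitrary: x)
  case (Suc n)
  have bd: "\<bar>(T ^^ n) g y\<bar> \<le> 1" for y by (rule funpow_bounded[OF g])
  have L2n: "(T ^^ n) g \<in> L2 nu" using g by simp
  have "\<rho> x * \<bar>(T ^^ Suc n) g x\<bar> \<le> exp (\<alpha> * h\<^sup>2) * W.avg (\<lambda>y. \<rho> y * \<bar>(T ^^ n) g y\<bar>) x"
    using conjugation_step[OF L2n good_density[OF L2n bd M]] by simp
  also have "\<dots> \<le> exp (\<alpha> * h\<^sup>2) * (exp (real n * (\<alpha> * h\<^sup>2)) * W.avg ((W.avg ^^ n) (\<lambda>y. \<rho> y * \<bar>g y\<bar>)) x)"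
    by (intro mult_left_mono avg_mono[OF good_density[OF L2n bd M] W.funpow_good[OF good_density[OF g M]] Suc.IH]) auto
  also have "\<dots> = exp (real (Suc n) * (\<alpha> * h\<^sup>2)) * (W.avg ^^ Suc n) (\<lambda>y. \<rho> y * \<bar>g y\<bar>) x"
    by (simp add: exp_add distrib_right)
  finally show ?case .
qed simp

text \<open>From the weight m \<rho> of the stationary measure to \<rho>^2 under Lebesgue measure:
  one factor \<rho> is exchanged for m through \<open>gauss_m_lower\<close>. This costs 1/v, which Z
  \<le> M v recovers.\<close>

lemma weighted_energy:
  assumes g: "g \<in> L2 nu" and M: "\<And>y. \<rho> y \<le> M"
  shows "energy (\<lambda>y. \<rho> y * \<bar>g y\<bar>) \<le> ennreal (M * exp (\<alpha> * h\<^sup>2) * (Hilbert.nm g)\<^sup>2)"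
proof -
  note [measurable] = L2_meas[OF g]
  define c where "c = exp (\<alpha> * h\<^sup>2) / v"
  have c: "c > 0" using v_pos by (simp add: c_def)
  have M0: "M > 0" using M[of 0] rho_pos[of 0] by linarith
  have "energy (\<lambda>y. \<rho> y * \<bar>g y\<bar>) \<le> (\<integral>\<^sup>+y. ennreal c * (ennreal (\<rho> y) * ennreal (m y * (g y)\<^sup>2)) \<partial>lborel)"
    unfolding energy_def
  proof (rule nn_integral_mono)
    fix y
    have "\<rho> y * (exp (- \<alpha> * h\<^sup>2) * v) \<le> m y" using gauss_m_lower[of y] by (simp add: mult_ac)
    then have "\<rho> y \<le> c * m y"
      using v_pos by (simp add: c_def exp_minus field_simps)
    then have "\<rho> y * (\<rho> y * (g y)\<^sup>2) \<le> (c * m y) * (\<rho> y * (g y)\<^sup>2)"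
      using rho_pos[of y] by (intro mult_right_mono) auto
    then have "(\<rho> y * \<bar>g y\<bar>)\<^sup>2 \<le> c * (\<rho> y * (m y * (g y)\<^sup>2))"
      by (simp add: power_mult_distrib power2_eq_square mult_ac)
    then have "ennreal ((\<rho> y * \<bar>g y\<bar>)\<^sup>2) \<le> ennreal (c * (\<rho> y * (m y * (g y)\<^sup>2)))" by (rule ennreal_leI)
    also have "\<dots> = ennreal c * (ennreal (\<rho> y) * ennreal (m y * (g y)\<^sup>2))"
      using c rho_pos[of y] m_pos[of y] by (simp add: ennreal_mult less_imp_le)
    finally show "ennreal ((\<rho> y * \<bar>g y\<bar>)\<^sup>2) \<le> ennreal c * (ennreal (\<rho> y) * ennreal (m y * (g y)\<^sup>2))" .
  qed
  also have "\<dots> = ennreal c * (\<integral>\<^sup>+y. ennreal (m y * (g y)\<^sup>2) \<partial>mu)"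
    unfolding mu_def by (subst nn_integral_density) (measurable, rule nn_integral_cmult, measurable)
  also have "\<dots> = ennreal (c * sq g)" unfolding sq_nn[OF g] using c by (simp add: ennreal_mult)
  also have "\<dots> \<le> ennreal (M * exp (\<alpha> * h\<^sup>2) * (Hilbert.nm g)\<^sup>2)"
  proof (rule ennreal_leI)
    have "(Hilbert.nm g)\<^sup>2 = sq g / Z" using g Z_pos by (simp add: Hilbert.nm_sq ip_self)
    then have "sq g = Z * (Hilbert.nm g)\<^sup>2" using Z_pos by simp
    also have "\<dots> \<le> (M * v) * (Hilbert.nm g)\<^sup>2" by (intro mult_right_mono Z_upper M) auto
    finally have "c * sq g \<le> c * ((M * v) * (Hilbert.nm g)\<^sup>2)" using c by simp
    then show "c * sq g \<le> M * exp (\<alpha> * h\<^sup>2) * (Hilbert.nm g)\<^sup>2"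
      using v_pos by (simp add: c_def mult_ac)
  qed
  finally show ?thesis .
qed

text \<open>Conjugation turns the walk into the uniform one, whose (j + 1)-step smoothing is the
  kernel energy times the weighted energy. Dividing by \<rho>(x) leaves no negative power of h if (j
  + 1) h^2 is kept bounded.\<close>

lemma gauss_smoothing:
  assumes h1: "h \<le> 1" and M: "\<And>y. \<rho> y \<le> M"
    and C: "C = 2 * 2 ^ CARD('n) / unit_ball_vol (real CARD('n))"
    and e: "4 * 4 ^ CARD('n) * ln (2 ^ (CARD('n) + 1)) \<le> real e" and j: "8 * real e / h\<^sup>2 \<le> real j"
    and g: "g \<in> L2 nu" "\<And>y. \<bar>g y\<bar> \<le> 1"
  shows "\<bar>(T ^^ Suc j) g x\<bar> \<le> exp (real (Suc j) * (\<alpha> * h\<^sup>2)) * sqrt (C * (M * exp (\<alpha> * h\<^sup>2))) / \<rho> x * Hilbert.nm g"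
proof -
  define f where "f = (\<lambda>y. \<rho> y * \<bar>g y\<bar>)"
  have f: "W.good M f" unfolding f_def by (rule good_density[OF g M])
  have M0: "M > 0" using M[of 0] rho_pos[of 0] by linarith
  have C0: "C > 0" by (simp add: C)
  define D where "D = M * exp (\<alpha> * h\<^sup>2) * (Hilbert.nm g)\<^sup>2"
  have D0: "0 \<le> D" using M0 by (simp add: D_def)
  have "ennreal (((W.avg ^^ Suc j) f x)\<^sup>2) \<le> energy ((W.avg ^^ j) (W.kern x)) * energy f"
    by (rule W.smoothing[OF f])
  also have "\<dots> \<le> ennreal C * ennreal D"
    unfolding D_def
    by (intro mult_mono W.kernel_energy_bound[OF h1 _ _ j] weighted_energy[OF g(1) M, folded f_def])
       (use C e in simp_all)
  also have "\<dots> = ennreal (C * D)" using C0 D0 by (simp add: ennreal_mult)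
  finally have "((W.avg ^^ Suc j) f x)\<^sup>2 \<le> C * D" using C0 D0 by (subst (asm) ennreal_le_iff) auto
  then have "(W.avg ^^ Suc j) f x \<le> sqrt (C * D)" by (rule real_le_rsqrt)
  also have "sqrt (C * D) = sqrt (C * (M * exp (\<alpha> * h\<^sup>2))) * Hilbert.nm g"
    using g by (simp add: D_def real_sqrt_mult mult.assoc)
  finally have "\<rho> x * \<bar>(T ^^ Suc j) g x\<bar> \<le> exp (real (Suc j) * (\<alpha> * h\<^sup>2)) * (sqrt (C * (M * exp (\<alpha> * h\<^sup>2))) * Hilbert.nm g)"
    using conjugation[OF g M, of x "Suc j", folded f_def] by (elim order_trans) (rule mult_left_mono, auto)
  then show ?thesis using rho_pos[of x] by (simp add: pos_le_divide_eq mult_ac)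
qed

end

text \<open>The prefactor 1/\<rho>(x) = exp(\<alpha> |x|^2)/\<beta> is at most q/\<beta>, because
  |x|^2 \<le> \<tau> (\<tau> + 3h). The burn-in yields no decay; as (j + 1) g \<le> S G, what is
  missing is absorbed into exp(S G). The 1 in 1 + B serves the cases where only the trivial bound on
  the distance is available.\<close>

lemma gaussian_tv_bound:
  fixes \<rho> :: "real^'n::finite \<Rightarrow> real"
  assumes adm: "admissible_density \<rho>" and \<alpha>: "\<alpha> > 0" and \<beta>: "\<beta> > 0"
    and gauss: "\<rho> = (\<lambda>x. \<beta> * exp (- \<alpha> * (norm x)\<^sup>2))"
  shows "\<exists>C>0. \<exists>h0>0. \<forall>n::nat. \<forall>h. \<forall>\<tau>::real. 0 < h \<and> h \<le> h0 \<and> \<tau> > 0 \<longrightarrow>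
         (\<forall>x. norm x < \<tau> \<longrightarrow>
            tv_dist \<rho> h n x \<le> C * exp (\<alpha> * \<tau> * (\<tau> + 3 * h)) * exp (- real n * spectral_gap \<rho> h))"
proof -
  let ?N = "cover_number TYPE('n)"
  obtain G h0 where Gh: "G > 0" "h0 > 0" "h0 \<le> 1" and alt: "\<And>h. 0 < h \<Longrightarrow> h \<le> h0 \<Longrightarrow> spectral_gap \<rho> h \<le> 0 \<or>
    (lambda1 \<rho> h < 1 \<and> 1 - ball_walk.\<delta> ?N \<le> lambda1 \<rho> h \<and> 0 < lambda1 \<rho> h \<and> spectral_gap \<rho> h \<le> G * h\<^sup>2)"
    using gap_alternatives[OF adm] by blast
  obtain M where M: "M > 0" "\<And>y. \<rho> y \<le> M" using density_upper_bound[OF adm] by blast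
  define e where "e = nat \<lceil>4 * 4 ^ CARD('n) * ln (2 ^ (CARD('n) + 1) :: real)\<rceil>"
  have e: "4 * 4 ^ CARD('n) * ln (2 ^ (CARD('n) + 1)) \<le> real e"
    unfolding e_def by (rule real_nat_ceiling_ge)
  define C where "C = 2 * 2 ^ CARD('n) / unit_ball_vol (real CARD('n))"
  have C: "C > 0" by (simp add: C_def)
  \<comment> \<open>Bounds (j + 1) h^2: 8 e from the burn-in length, and 2 for rounding up and the
    extra step, with h \<le> 1.\<close>
  define S where "S = 8 * real e + 2"
  define B where "B = exp (S * \<alpha>) * sqrt (C * (M * exp \<alpha>)) / \<beta>"
  have B: "B \<ge> 0" using \<beta> M C by (simp add: B_def)
  have main: "tv_dist \<rho> h n x \<le> exp (S * G) * (1 + B) * exp (\<alpha> * \<tau> * (\<tau> + 3 * h)) * exp (- real n * spectral_gap \<rho> h)"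
    if hb: "0 < h" "h \<le> h0" and x: "norm x < \<tau>" for n h \<tau> x
  proof -
    interpret gaussian_walk \<rho> h ?N \<alpha> \<beta> using adm hb \<alpha> \<beta> gauss by unfold_locales auto
    have h1: "h \<le> 1" using hb Gh by simp
    define g where "g = spectral_gap \<rho> h"
    define q where "q = exp (\<alpha> * \<tau> * (\<tau> + 3 * h))"
    have \<tau>: "\<tau> > 0" using x norm_ge_zero[of x] by linarith
    have q: "exp (\<alpha> * (norm x)\<^sup>2) \<le> q" "1 \<le> q"
    proof -
      have "(norm x)\<^sup>2 \<le> \<tau> * (\<tau> + 3 * h)"
        unfolding power2_eq_square using x hb \<tau> by (intro mult_mono) auto
      then have "\<alpha> * (norm x)\<^sup>2 \<le> \<alpha> * (\<tau> * (\<tau> + 3 * h))" using \<alpha> by (intro mult_left_mono) auto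
      then show "exp (\<alpha> * (norm x)\<^sup>2) \<le> q" by (simp add: q_def mult.assoc)
      show "1 \<le> q" using \<alpha> \<tau> hb by (simp add: q_def)
    qed
    have SG: "1 \<le> exp (S * G)" using Gh by (simp add: S_def)
    define j where "j = nat \<lceil>8 * real e / h\<^sup>2\<rceil>"
    have j: "8 * real e / h\<^sup>2 \<le> real j" unfolding j_def by (rule real_nat_ceiling_ge)
    have j_le: "real (Suc j) * h\<^sup>2 \<le> S"
    proof -
      have "real j \<le> 8 * real e / h\<^sup>2 + 1" unfolding j_def by (simp add: of_int_ceiling_le_add_one)
      then have "real (Suc j) \<le> 8 * real e / h\<^sup>2 + 2" by simp
      then have "real (Suc j) * h\<^sup>2 \<le> (8 * real e / h\<^sup>2 + 2) * h\<^sup>2" by (rule mult_right_mono) simp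
      also have "\<dots> = 8 * real e + 2 * h\<^sup>2" using hb by (simp add: distrib_right)
      also have "\<dots> \<le> S" using hb h1 by (simp add: S_def power_le_one)
      finally show ?thesis .
    qed
    have "tv_dist \<rho> h n x \<le> exp (S * G) * ((1 + B) * q) * exp (- real n * g)"
    proof (cases "g \<le> 0")
      case True
      then have "1 \<le> exp (- real n * g)" by (simp add: mult_nonneg_nonpos)
      then have "1 * (1 * 1) * 1 \<le> exp (S * G) * ((1 + B) * q) * exp (- real n * g)"
        using SG B q by (intro mult_mono) auto
      then show ?thesis using tv_le_1[of n x] by simp
    next
      case False
      then have L: "lambda1 \<rho> h < 1" "1 - \<delta> \<le> lambda1 \<rho> h" "0 < lambda1 \<rho> h" and g_le: "g \<le> G * h\<^sup>2"
        using alt[OF hb] by (auto simp: g_def)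
      have "real (Suc j) * g \<le> real (Suc j) * (G * h\<^sup>2)" using g_le by (intro mult_left_mono) auto
      also have "\<dots> = (real (Suc j) * h\<^sup>2) * G" by simp
      also have "\<dots> \<le> S * G" using j_le Gh by (intro mult_right_mono) auto
      finally have jg: "real (Suc j) * g \<le> S * G" .
      show ?thesis
      proof (cases "n < Suc j")
        case True
        \<comment> \<open>Before the burn-in is over n g is at most S G, so the claimed bound is
          still at least 1.\<close>
        then have "real n * g \<le> real (Suc j) * g" using False by (intro mult_right_mono) auto
        then have late: "1 \<le> exp (S * G) * exp (- real n * g)" using jg by (simp flip: exp_add)
        have "1 * 1 \<le> (1 + B) * q" using B q by (intro mult_mono) auto
        then have "1 * 1 \<le> (1 + B) * q * (exp (S * G) * exp (- real n * g))"
          using late by (intro mult_mono[of 1 _ 1]) simp_all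
        then show ?thesis using tv_le_1[of n x] by (simp add: mult_ac)
      next
        case False
        define i where "i = n - Suc j"
        have n: "n = i + Suc j" using False by (simp add: i_def)
        define B' where "B' = exp (real (Suc j) * (\<alpha> * h\<^sup>2)) * sqrt (C * (M * exp (\<alpha> * h\<^sup>2))) / \<rho> x"
        have B': "0 \<le> B'" using C M rho_pos[of x] by (simp add: B'_def)
        have B'_le: "B' \<le> B * q"
        proof -
          have "real (Suc j) * (\<alpha> * h\<^sup>2) \<le> S * \<alpha>"
            using mult_right_mono[OF j_le, of \<alpha>] \<alpha> by (simp add: mult_ac)
          moreover have "\<alpha> * h\<^sup>2 \<le> \<alpha>" using \<alpha> h1 hb by (simp add: power_le_one)
          ultimately have "exp (real (Suc j) * (\<alpha> * h\<^sup>2)) * sqrt (C * (M * exp (\<alpha> * h\<^sup>2))) \<le> exp (S * \<alpha>) * sqrt (C * (M * exp \<alpha>))"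
            using C M by (intro mult_mono real_sqrt_le_mono) auto
          then have "B' \<le> exp (S * \<alpha>) * sqrt (C * (M * exp \<alpha>)) / \<rho> x"
            unfolding B'_def using rho_pos[of x] by (intro divide_right_mono) auto
          also have "\<dots> = B * exp (\<alpha> * (norm x)\<^sup>2)"
            by (simp add: B_def gauss exp_minus divide_inverse)
          also have "\<dots> \<le> B * q" using B q by (intro mult_left_mono) auto
          finally show ?thesis .
        qed
        have "tv_dist \<rho> h n x \<le> B' * exp (- real i * spectral_gap \<rho> h)"
          unfolding n
        proof (rule tv_decay[OF L _ B'])
          fix f assume "f \<in> L2 nu" "\<And>y. \<bar>f y\<bar> \<le> 1"
          then show "\<bar>(T ^^ Suc j) f x\<bar> \<le> B' * Hilbert.nm f"
            unfolding B'_def by (rule gauss_smoothing[OF h1 M(2) C_def e j])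
        qed
        also have "\<dots> \<le> ((1 + B) * q) * (exp (S * G) * exp (- real n * g))"
        proof (rule mult_mono)
          show "B' \<le> (1 + B) * q" using B'_le q by (simp add: distrib_right)
          show "exp (- real i * spectral_gap \<rho> h) \<le> exp (S * G) * exp (- real n * g)"
            using jg by (simp add: n g_def algebra_simps flip: exp_add)
        qed (use B q in auto)
        finally show ?thesis by (simp add: mult_ac)
      qed
    qed
    then show ?thesis by (simp add: q_def g_def mult.assoc)
  qed
  moreover have "exp (S * G) * (1 + B) > 0" using B by simp
  ultimately show ?thesis using Gh(2) by blast
qed

theorem theorem5p3:
  fixes \<rho> :: "real^'n::finite \<Rightarrow> real"
  assumes adm: "admissible_density \<rho>"
  shows
   "(smooth_tempered_exp \<rho> \<longrightarrow>
      (\<exists>C>0. \<exists>h0>0. \<forall>n::nat. \<forall>h. \<forall>\<tau>::real. 0 < h \<and> h \<le> h0 \<and> \<tau> > 0 \<longrightarrow>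
         (\<forall>x. norm x < \<tau> \<longrightarrow>
            tv_dist \<rho> h n x \<le> C * (h powr (- real CARD('n) / 2) * (SUP y\<in>ball 0 \<tau>. 1 / \<rho> y))
                                 * exp (- real n * spectral_gap \<rho> h))))
  \<and> (\<forall>\<alpha> \<beta>::real. \<alpha> > 0 \<and> \<beta> > 0 \<and> \<rho> = (\<lambda>x. \<beta> * exp (- \<alpha> * (norm x)^2)) \<longrightarrow>
      (\<exists>C>0. \<exists>h0>0. \<forall>n::nat. \<forall>h. \<forall>\<tau>::real. 0 < h \<and> h \<le> h0 \<and> \<tau> > 0 \<longrightarrow>
         (\<forall>x. norm x < \<tau> \<longrightarrow>
            tv_dist \<rho> h n x \<le> C * exp (\<alpha> * \<tau> * (\<tau> + 3 * h))
                                 * exp (- real n * spectral_gap \<rho> h))))"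
proof (intro conjI impI allI)
  assume "smooth_tempered_exp \<rho>"
  then show "\<exists>C>0. \<exists>h0>0. \<forall>n::nat. \<forall>h. \<forall>\<tau>::real. 0 < h \<and> h \<le> h0 \<and> \<tau> > 0 \<longrightarrow>
         (\<forall>x. norm x < \<tau> \<longrightarrow>
            tv_dist \<rho> h n x \<le> C * (h powr (- real CARD('n) / 2) * (SUP y\<in>ball 0 \<tau>. 1 / \<rho> y))
                                 * exp (- real n * spectral_gap \<rho> h))"
    by (rule tempered_tv_bound[OF adm])
next
  fix \<alpha> \<beta> :: real
  assume g: "\<alpha> > 0 \<and> \<beta> > 0 \<and> \<rho> = (\<lambda>x. \<beta> * exp (- \<alpha> * (norm x)^2))"
  show "\<exists>C>0. \<exists>h0>0. \<forall>n::nat. \<forall>h. \<forall>\<tau>::real. 0 < h \<and> h \<le> h0 \<and> \<tau> > 0 \<longrightarrow>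
         (\<forall>x. norm x < \<tau> \<longrightarrow>
            tv_dist \<rho> h n x \<le> C * exp (\<alpha> * \<tau> * (\<tau> + 3 * h))
                                 * exp (- real n * spectral_gap \<rho> h))"
    using g by (intro gaussian_tv_bound[OF adm, of \<alpha> \<beta>]) auto
qed

end
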